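(* Let $0<q\le p<\infty$, let $Y(\mathbb{R}^n)$ be a ball quasi-Banach function space, and let $Y(\Omega)$ be the restriction of $Y(\mathbb{R}^n)$ to $\Omega$, where $\Omega\subseteq\mathbb{R}^n$ is a measurable set satisfying the weak measure density (WMD) condition. Assume that $Y^{\frac1p}(\mathbb{R}^n)$ is a ball Banach function space and that either (a) the Hardy--Littlewood maximal operator $\mathcal{M}$ is bounded on $[Y^{\frac1p}(\mathbb{R}^n)]'$, or (b) there exists a sequence $\{\theta_m\}_{m\in\mathbb{N}}$ in $(0,1)$ with $\lim_{m\to\infty}\theta_m=1$ such that, for any $m\in\mathbb{N}$, $Y^{\frac1{p\theta_m}}(\mathbb{R}^n)$ is a ball Banach function space, $\mathcal{M}$ is bounded on $[Y^{\frac1{p\theta_m}}(\mathbb{R}^n)]'$, and $\lim_{m\to\infty}\|\mathcal{M}\|_{[Y^{\frac1{p\theta_m}}(\mathbb{R}^n)]'\to[Y^{\frac1{p\theta_m}}(\mathbb{R}^n)]'}<\infty$. Then there exist two positive constants $C$ and $\widetilde{C}$ such that the following assertions hold. (i) For any $f\in C_{\mathrm c}(\Omega)\cap\bigcup_{s\in(0,1)}\dot{W}^{s,q}_Y(\Omega)$, $$C\|f\|_{Y(\Omega)}\le\liminf_{s\to0^+}s^{\frac1q}\left\|\left\{\int_{\Omega}\frac{|f(\cdot)-f(y)|^q}{|\cdot-y|^{n+sq}}\,dy\right\}^{\frac1q}\right\|_{Y(\Omega)}\le\limsup_{s\to0^+}s^{\frac1q}\left\|\left\{\int_{\Omega}\frac{|f(\cdot)-f(y)|^q}{|\cdot-y|^{n+sq}}\,dy\right\}^{\frac1q}\right\|_{Y(\Omega)}\le\widetilde{C}\|f\|_{Y(\Omega)}.$$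 (ii) If $Y(\mathbb{R}^n)$ is further assumed to have an absolutely continuous quasi-norm, then, for any $f\in[Y(\Omega)/\mathbb{R}]\cap\bigcup_{s\in(0,1)}\dot{W}^{s,q}_Y(\Omega)$, $$C\|f\|_{Y(\Omega)/\mathbb{R}}\le\liminf_{s\to0^+}s^{\frac1q}\left\|\left\{\int_{\Omega}\frac{|f(\cdot)-f(y)|^q}{|\cdot-y|^{n+sq}}\,dy\right\}^{\frac1q}\right\|_{Y(\Omega)}\le\limsup_{s\to0^+}s^{\frac1q}\left\|\left\{\int_{\Omega}\frac{|f(\cdot)-f(y)|^q}{|\cdot-y|^{n+sq}}\,dy\right\}^{\frac1q}\right\|_{Y(\Omega)}\le\widetilde{C}\|f\|_{Y(\Omega)/\mathbb{R}}.$$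
   Context: $\mathbb{R}^n$ carries the Euclidean distance and Lebesgue measure; $B(x,r)$ are open Euclidean balls and $|E|$ is the Lebesgue measure of $E$. A measurable $\Omega\subseteq\mathbb{R}^n$ satisfies the WMD condition if there exist $x_0\in\mathbb{R}^n$ and $C_0\in(0,1]$ with $\liminf_{r\to\infty}\frac{|B(x_0,r)\cap\Omega|}{|B(x_0,r)|}\ge C_0$. $\mathscr{M}(\mathbb{R}^n)$, $\mathscr{M}(\Omega)$: measurable functions. A ball quasi-Banach function space $Y(\mathbb{R}^n)$ is a quasi-Banach space of functions in $\mathscr{M}(\mathbb{R}^n)$ whose quasi-norm makes sense (with values in $[0,\infty]$) for all $f\in\mathscr{M}(\mathbb{R}^n)$, such that: (i) $\|f\|_{Y}=0$ implies $f=0$ a.e.; (ii) $|g|\le|f|$ a.e. implies $\|g\|_{Y}\le\|f\|_{Y}$; (iii) $0\le f_m\uparrow f$ a.e. implies $\|f_m\|_{Y}\uparrow\|f\|_{Y}$; (iv) $\mathbf{1}_B\in Y(\mathbb{R}^n)$ for every ball $B$. It is a ball Banach function space if moreover (v) the triangle inequality holds and (vi) for each ball $B$ there is $C_{(B)}\in(0,\infty)$ with $\int_B|f|\,dx\le C_{(B)}\|f\|_{Y}$ for all $f\in Y(\mathbb{R}^n)$. For $t\in(0,\infty)$, $Y^t(\mathbb{R}^n):=\{f:|f|^t\in Y(\mathbb{R}^n)\}$ with $\|f\|_{Y^t}:=\||f|^t\|_{Y}^{1/t}$. For a ball Banach function space $Z(\mathbb{R}^n)$, $[Z(\mathbb{R}^n)]':=\{f\in\mathscr{M}(\mathbb{R}^n):\|f\|_{[Z(\mathbb{R}^n)]'}:=\sup_{\|g\|_{Z}\le1}\|fg\|_{L^1}<\infty\}$.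 $\mathcal{M}f(x):=\sup_{B\ni x}\frac1{|B|}\int_B|f|$, supremum over all balls containing $x$; $\|\mathcal{M}\|_{Z\to Z}$ is its operator norm. $Y(\mathbb{R}^n)$ has an absolutely continuous quasi-norm if $\|f\mathbf{1}_{E_j}\|_{Y}\to0$ whenever $f\in Y(\mathbb{R}^n)$ and $\{E_j\}$ are measurable sets with $\mathbf{1}_{E_j}\to0$ a.e. $Y(\Omega):=\{f\in\mathscr{M}(\Omega): f=g|_\Omega\text{ for some }g\in Y(\mathbb{R}^n)\}$ with $\|f\|_{Y(\Omega)}:=\inf\{\|g\|_{Y(\mathbb{R}^n)}:g\in Y(\mathbb{R}^n),g|_\Omega=f\}$ (and $\infty$ if no such $g$). $\dot W^{s,q}_Y(\Omega)$: all measurable $f$ on $\Omega$ with $\big\|\{\int_{\Omega}\frac{|f(\cdot)-f(y)|^q}{|\cdot-y|^{n+sq}}dy\}^{1/q}\big\|_{Y(\Omega)}<\infty$. $Y(\Omega)/\mathbb{R}$: (classes modulo additive real constants of) measurable $f$ on $\Omega$ with $\|f\|_{Y(\Omega)/\mathbb{R}}:=\inf_{a\in\mathbb{R}}\|f+a\|_{Y(\Omega)}<\infty$. $C_{\mathrm c}(\Omega)$: continuous functions on $\Omega$ with compact support in $\Omega$. $s\to0^+$ means $s\in(0,1)$, $s\to0$. *)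

theory Defs
  imports "HOL-Analysis.Analysis"
begin

text \<open>
  \<open>\<real>\<^sup>n\<close> is rendered as a Euclidean space \<open>'a\<close> with \<open>n = DIM('a)\<close>. A function space is given
  by its quasi-norm \<open>Y\<close>, defined on real-valued Lebesgue measurable functions with values
  in \<open>[0, \<infinity>]\<close>; the values of \<open>Y\<close> at non-measurable functions are never used.
  Real-valued functions suffice: by homogeneity, definiteness and the lattice property a function
  that is infinite on a set of positive measure has infinite quasi-norm.
\<close>

definition ennreal_powr :: "ennreal \<Rightarrow> real \<Rightarrow> ennreal"
  \<comment> \<open>Only used for exponents \<open>a > 0\<close>.\<close>
  where "ennreal_powr x a = (if x = \<infinity> then \<infinity> else ennreal (enn2real x powr a))"

definition fspace :: "(('a::euclidean_space \<Rightarrow> real) \<Rightarrow> ennreal) \<Rightarrow> ('a \<Rightarrow> real) set"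
  where "fspace Y = {f \<in> borel_measurable lebesgue. Y f < \<infinity>}"

locale ball_quasi_banach_function_space =
  fixes Y :: "('a::euclidean_space \<Rightarrow> real) \<Rightarrow> ennreal"
  assumes homogeneous:
      "f \<in> borel_measurable lebesgue \<Longrightarrow> Y (\<lambda>x. c * f x) = ennreal \<bar>c\<bar> * Y f"
    and quasi_triangle:
      "\<exists>K\<ge>1. \<forall>f\<in>borel_measurable lebesgue. \<forall>g\<in>borel_measurable lebesgue.
         Y (\<lambda>x. f x + g x) \<le> ennreal K * (Y f + Y g)"
    and complete:
      "\<lbrakk>\<And>m. F m \<in> fspace Y;
        \<And>e::real. e > 0 \<Longrightarrow> \<exists>M. \<forall>m\<ge>M. \<forall>k\<ge>M. Y (\<lambda>x. F m x - F k x) < ennreal e\<rbrakk>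
       \<Longrightarrow> \<exists>f\<in>fspace Y. (\<lambda>m::nat. Y (\<lambda>x. F m x - f x)) \<longlonglongrightarrow> 0"
    and definite:
      "\<lbrakk>f \<in> borel_measurable lebesgue; Y f = 0\<rbrakk> \<Longrightarrow> AE x in lebesgue. f x = 0"
    and lattice:
      "\<lbrakk>f \<in> borel_measurable lebesgue; g \<in> borel_measurable lebesgue;
        AE x in lebesgue. \<bar>g x\<bar> \<le> \<bar>f x\<bar>\<rbrakk> \<Longrightarrow> Y g \<le> Y f"
    and fatou:
      "\<lbrakk>\<And>m. F m \<in> borel_measurable lebesgue; f \<in> borel_measurable lebesgue;
        AE x in lebesgue. (\<forall>m. 0 \<le> F m x \<and> F m x \<le> F (Suc m) x) \<and> (\<lambda>m. F m x) \<longlonglongrightarrow> f x\<rbrakk>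
       \<Longrightarrow> incseq (\<lambda>m. Y (F m)) \<and> (\<lambda>m. Y (F m)) \<longlonglongrightarrow> Y f"
    and indicator_ball: "r > 0 \<Longrightarrow> indicator (ball x r) \<in> fspace Y"

locale ball_banach_function_space = ball_quasi_banach_function_space Y
  for Y :: "('a::euclidean_space \<Rightarrow> real) \<Rightarrow> ennreal" +
  assumes triangle:
      "\<lbrakk>f \<in> borel_measurable lebesgue; g \<in> borel_measurable lebesgue\<rbrakk>
       \<Longrightarrow> Y (\<lambda>x. f x + g x) \<le> Y f + Y g"
    and locally_integrable:
      "r > 0 \<Longrightarrow> \<exists>C::real. C > 0 \<and>
         (\<forall>f\<in>fspace Y. (\<integral>\<^sup>+y\<in>ball x r. ennreal \<bar>f y\<bar> \<partial>lebesgue) \<le> ennreal C * Y f)"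

definition absolutely_continuous_norm :: "(('a::euclidean_space \<Rightarrow> real) \<Rightarrow> ennreal) \<Rightarrow> bool"
  where "absolutely_continuous_norm Y \<longleftrightarrow>
    (\<forall>f\<in>fspace Y. \<forall>E::nat \<Rightarrow> 'a set.
       (\<forall>j. E j \<in> sets lebesgue) \<and>
       (AE x in lebesgue. (\<lambda>j. indicator (E j) x :: real) \<longlonglongrightarrow> 0) \<longrightarrow>
       (\<lambda>j. Y (\<lambda>x. f x * indicator (E j) x)) \<longlonglongrightarrow> 0)"

definition power_norm ::
    "(('a::euclidean_space \<Rightarrow> real) \<Rightarrow> ennreal) \<Rightarrow> real \<Rightarrow> ('a \<Rightarrow> real) \<Rightarrow> ennreal"
  where "power_norm Y t f = ennreal_powr (Y (\<lambda>x. \<bar>f x\<bar> powr t)) (1 / t)"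

definition associate_norm ::
    "(('a::euclidean_space \<Rightarrow> real) \<Rightarrow> ennreal) \<Rightarrow> ('a \<Rightarrow> real) \<Rightarrow> ennreal"
  where "associate_norm Z f =
    (SUP g\<in>{g \<in> borel_measurable lebesgue. Z g \<le> 1}. \<integral>\<^sup>+x. ennreal \<bar>f x * g x\<bar> \<partial>lebesgue)"

text \<open>
  The quasi-norm of the restriction of \<open>Y\<close> to \<open>\<Omega>\<close>. Functions on \<open>\<Omega>\<close> are total functions of
  which only the values on \<open>\<Omega>\<close> matter, and equality on \<open>\<Omega>\<close> is equality of measurable
  functions, i.e. almost everywhere. The argument is extended-real-valued because maximal
  functions and difference quotient integrals may be infinite at some points. If \<open>f\<close> is
  infinite on a subset of \<open>\<Omega>\<close> of positive measure, the infimum is over the empty set and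
  the quasi-norm is \<open>\<infinity>\<close>. For \<open>\<Omega> = UNIV\<close> this extends \<open>Y\<close> to extended-real-valued functions.
\<close>

definition restrict_norm ::
    "(('a::euclidean_space \<Rightarrow> real) \<Rightarrow> ennreal) \<Rightarrow> 'a set \<Rightarrow> ('a \<Rightarrow> ereal) \<Rightarrow> ennreal"
  where "restrict_norm Y \<Omega> f =
    (INF g\<in>{g \<in> fspace Y. AE x in lebesgue. x \<in> \<Omega> \<longrightarrow> ereal (g x) = f x}. Y g)"

definition maximal_function :: "('a::euclidean_space \<Rightarrow> real) \<Rightarrow> 'a \<Rightarrow> ennreal"
  where "maximal_function f x =
    (SUP (z, r)\<in>{(z, r). r > 0 \<and> x \<in> ball z r}.
       (\<integral>\<^sup>+y\<in>ball z r. ennreal \<bar>f y\<bar> \<partial>lebesgue) / emeasure lebesgue (ball z r))"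

definition maximal_operator_norm :: "(('a::euclidean_space \<Rightarrow> real) \<Rightarrow> ennreal) \<Rightarrow> ennreal"
  where "maximal_operator_norm Z =
    (SUP f\<in>{f \<in> borel_measurable lebesgue. Z f \<le> 1}.
       restrict_norm Z UNIV (\<lambda>x. enn2ereal (maximal_function f x)))"

definition maximal_bounded :: "(('a::euclidean_space \<Rightarrow> real) \<Rightarrow> ennreal) \<Rightarrow> bool"
  where "maximal_bounded Z \<longleftrightarrow>
    (\<exists>C::real. C > 0 \<and> (\<forall>f\<in>fspace Z.
       restrict_norm Z UNIV (\<lambda>x. enn2ereal (maximal_function f x)) \<le> ennreal C * Z f))"

definition WMD :: "'a::euclidean_space set \<Rightarrow> bool"
  where "WMD \<Omega> \<longleftrightarrow> (\<exists>x0. \<exists>C0::real. 0 < C0 \<and> C0 \<le> 1 \<and>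
    Liminf at_top (\<lambda>r::real. ereal (measure lebesgue (ball x0 r \<inter> \<Omega>) / measure lebesgue (ball x0 r)))
      \<ge> ereal C0)"

definition gagliardo_norm ::
    "(('a::euclidean_space \<Rightarrow> real) \<Rightarrow> ennreal) \<Rightarrow> 'a set \<Rightarrow> real \<Rightarrow> real \<Rightarrow> ('a \<Rightarrow> real) \<Rightarrow> ennreal"
  where "gagliardo_norm Y \<Omega> s q f =
    restrict_norm Y \<Omega> (\<lambda>x. enn2ereal (ennreal_powr
      (\<integral>\<^sup>+y\<in>\<Omega>. ennreal (\<bar>f x - f y\<bar> powr q / norm (x - y) powr (real DIM('a) + s * q)) \<partial>lebesgue)
      (1 / q)))"

definition homogeneous_sobolev ::
    "(('a::euclidean_space \<Rightarrow> real) \<Rightarrow> ennreal) \<Rightarrow> 'a set \<Rightarrow> real \<Rightarrow> real \<Rightarrow> ('a \<Rightarrow> real) set"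
  where "homogeneous_sobolev Y \<Omega> s q =
    {f \<in> borel_measurable (lebesgue_on \<Omega>). gagliardo_norm Y \<Omega> s q f < \<infinity>}"

definition quotient_norm ::
    "(('a::euclidean_space \<Rightarrow> real) \<Rightarrow> ennreal) \<Rightarrow> 'a set \<Rightarrow> ('a \<Rightarrow> real) \<Rightarrow> ennreal"
  where "quotient_norm Y \<Omega> f = (INF a::real. restrict_norm Y \<Omega> (\<lambda>x. ereal (f x + a)))"

definition quotient_space ::
    "(('a::euclidean_space \<Rightarrow> real) \<Rightarrow> ennreal) \<Rightarrow> 'a set \<Rightarrow> ('a \<Rightarrow> real) set"
  \<comment> \<open>The representatives of the classes modulo constants; \<open>quotient_norm\<close> and
    \<open>gagliardo_norm\<close> do not depend on the representative.\<close>
  where "quotient_space Y \<Omega> =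
    {f \<in> borel_measurable (lebesgue_on \<Omega>). quotient_norm Y \<Omega> f < \<infinity>}"

definition C_c :: "'a::euclidean_space set \<Rightarrow> ('a \<Rightarrow> real) set"
  \<comment> \<open>The support of \<open>f\<close> relative to \<open>\<Omega>\<close> is compact
    iff the closure in the whole space is compact and contained in \<open>\<Omega>\<close>.\<close>
  where "C_c \<Omega> = {f. continuous_on \<Omega> f \<and>
    compact (closure {x \<in> \<Omega>. f x \<noteq> 0}) \<and> closure {x \<in> \<Omega>. f x \<noteq> 0} \<subseteq> \<Omega>}"

end

theory Submission
  imports Defs
begin

text \<open>
  Write \<open>k\<^sub>s\<close> for the Gagliardo kernel, the function \<open>(x, y) \<mapsto> \<bar>x - y\<bar> powr (- (n + s q))\<close>.
  As \<open>s\<close> tends to 0, the part of \<open>k\<^sub>s\<close> near the diagonal contributes nothing after multiplication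
  with \<open>s powr (1 / q)\<close>, because the seminorm is finite for some \<open>s0\<close>. The part at distance at
  least 1 has integral of order \<open>1 / s\<close>, and all of its mass escapes to infinity. There \<open>f y\<close> is
  negligible, so that \<open>s \<integral> \<bar>f x - f y\<bar>\<^sup>q k\<^sub>s(x, y) dy\<close> becomes comparable with \<open>\<bar>f x\<bar>\<^sup>q\<close>.

  To make \<open>f y\<close> negligible in the quasi-norm \<open>Y\<close>, one needs the operators
  \<open>f \<mapsto> (\<integral> s k\<^sub>s(x, y) \<bar>f y\<bar>\<^sup>q dy) powr (1 / q)\<close>, with the kernel cut off near the diagonal,
  to be bounded on \<open>Y\<close> uniformly in \<open>s\<close>. The cut-off kernel is
  dominated by a constant multiple of a symmetric kernel of total mass 1 that averages over
  dyadic balls (\<open>powr_kernel_le_averaging_kernel\<close>), and by monotonicity of power means it is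
  enough to treat the exponent \<open>p\<close>, where the claim concerns linear averages on the Banach
  function space \<open>Z\<close> with norm \<open>Y (\<bar>f\<bar> powr (1 / p)) powr p\<close>. Such averages are dominated by the
  maximal operator, but this operator is assumed to be bounded on the associate space of \<open>Z\<close>, not
  on \<open>Z\<close>.
  Since the kernel is symmetric, one passes to the associate space by duality and comes back
  by the Lorentz-Luxemburg theorem \<open>Lorentz_Luxemburg\<close>, which says that the norm of \<open>Z\<close> is
  dominated by its second associate norm. If the maximal operator is only
  controlled for exponents \<open>p \<theta>\<^sub>m\<close> tending to \<open>p\<close>, Fatou's lemma transfers the bound to \<open>p\<close>
  (\<open>power_mean_bounded_uniformly\<close>).

  This gives the upper estimate \<open>Limsup_gagliardo_le\<close>. For the lower estimate
  \<open>norm_le_Liminf_gagliardo\<close>, the weak measure density condition guarantees that the part of \<open>\<Omega>\<close>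
  far away still carries kernel mass of order \<open>1 / s\<close> (\<open>integral_powr_kernel_ge_if_WMD\<close>). By the
  uniform bound for the averages, the error
  is at most a multiple of the norm of the tail of \<open>f\<close>. This norm is eventually 0 for compactly
  supported functions, and tends to 0 for functions of finite norm if the quasi-norm is absolutely
  continuous. The Gagliardo seminorm is invariant under adding constants, so in the second case
  \<open>f\<close> may be replaced by \<open>f + a\<close>.
\<close>

section \<open>Powers of extended nonnegative reals\<close>

lemma ennreal_powr_top [simp]: "ennreal_powr top a = top"
  by (simp add: ennreal_powr_def)

lemma ennreal_powr_0 [simp]: "ennreal_powr 0 a = 0"
  by (simp add: ennreal_powr_def)

lemma ennreal_powr_ennreal [simp]: "0 \<le> x \<Longrightarrow> ennreal_powr (ennreal x) a = ennreal (x powr a)"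
  by (simp add: ennreal_powr_def)

lemma ennreal_powr_mono: "x \<le> y \<Longrightarrow> 0 \<le> a \<Longrightarrow> ennreal_powr x a \<le> ennreal_powr y a"
  by (cases x; cases y) (auto intro!: ennreal_leI powr_mono2 simp: top_unique)

lemma ennreal_powr_powr:
  "ennreal_powr (ennreal_powr x a) b = ennreal_powr x (a * b)"
  by (cases x) (auto simp: powr_powr)

lemma ennreal_powr_1 [simp]: "ennreal_powr x 1 = x"
  by (cases x) auto

lemma ennreal_powr_mult:
  "0 < c \<Longrightarrow> ennreal_powr (ennreal c * x) a = ennreal (c powr a) * ennreal_powr x a"
proof (cases x)
  case (real r)
  assume "0 < c"
  with real show ?thesis
    by (simp add: powr_mult flip: ennreal_mult)
qed (simp add: ennreal_mult_top)

lemma ennreal_powr_le_iff: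
  "0 < a \<Longrightarrow> ennreal_powr x a \<le> ennreal_powr y a \<longleftrightarrow> x \<le> y"
  using ennreal_powr_mono[of x y a] ennreal_powr_mono[of "ennreal_powr x a" "ennreal_powr y a" "1 / a"]
  by (auto simp: ennreal_powr_powr)

lemma ennreal_powr_le_swap:
  "0 < a \<Longrightarrow> ennreal_powr x a \<le> y \<longleftrightarrow> x \<le> ennreal_powr y (1 / a)"
  using ennreal_powr_le_iff[of a x "ennreal_powr y (1 / a)"] by (simp add: ennreal_powr_powr)

lemma ennreal_powr_add_le:
  assumes "0 < a"
  shows "ennreal_powr (x + y) a \<le> ennreal (2 powr a) * (ennreal_powr x a + ennreal_powr y a)"
proof -
  have *: "x + y \<le> ennreal 2 * max x y"
    using add_mono[of x "max x y" y "max x y"] by (simp add: mult_2)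
  have "ennreal_powr (x + y) a \<le> ennreal (2 powr a) * ennreal_powr (max x y) a"
    using ennreal_powr_mono[OF *, of a] assms ennreal_powr_mult[of 2 "max x y" a] by simp
  also have "\<dots> \<le> ennreal (2 powr a) * (ennreal_powr x a + ennreal_powr y a)"
    by (intro mult_left_mono) (auto simp: max_def)
  finally show ?thesis .
qed

lemma abs_add_powr_le:
  fixes x y a :: real
  assumes "0 < a"
  shows "\<bar>x + y\<bar> powr a \<le> 2 powr a * (\<bar>x\<bar> powr a + \<bar>y\<bar> powr a)"
proof -
  have "\<bar>x + y\<bar> powr a \<le> (2 * max \<bar>x\<bar> \<bar>y\<bar>) powr a"
    using assms by (intro powr_mono2) auto
  also have "\<dots> = 2 powr a * max \<bar>x\<bar> \<bar>y\<bar> powr a"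
    by (simp add: powr_mult)
  also have "\<dots> \<le> 2 powr a * (\<bar>x\<bar> powr a + \<bar>y\<bar> powr a)"
    by (intro mult_left_mono) (auto simp: max_def)
  finally show ?thesis .
qed

lemma ennreal_powr_measurable [measurable]:
  assumes [measurable]: "f \<in> borel_measurable M"
  shows "(\<lambda>x. ennreal_powr (f x) a) \<in> borel_measurable M"
  unfolding ennreal_powr_def infinity_ennreal_def by measurable

section \<open>Extending a quasi-norm to extended nonnegative functions\<close>

text \<open>
  The difference quotient integrals and the kernel means below take values in \<open>[0, \<infinity>]\<close>, while a
  quasi-norm is only given on real-valued functions. By the Fatou property, the supremum over
  truncations extends it. Monotonicity, homogeneity, the quasi-triangle inequality and the
  Fatou property pass from the truncations to the supremum.
\<close>

definition extended_norm ::
    "(('a::euclidean_space \<Rightarrow> real) \<Rightarrow> ennreal) \<Rightarrow> ('a \<Rightarrow> ennreal) \<Rightarrow> ennreal"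
  where "extended_norm Y F = (SUP n::nat. Y (\<lambda>x. enn2real (min (F x) (of_nat n))))"

lemma enn2real_min_of_nat_mono:
  "x \<le> y \<Longrightarrow> m \<le> n \<Longrightarrow> enn2real (min x (of_nat m)) \<le> enn2real (min y (of_nat n))"
  by (intro enn2real_mono min.mono)
     (auto simp: of_nat_less_top min_less_iff_disj)

lemma ennreal_enn2real_min_of_nat [simp]:
  "ennreal (enn2real (min x (of_nat n))) = min x (of_nat n)"
  by (intro ennreal_enn2real) (auto simp: of_nat_less_top min_less_iff_disj)

context ball_quasi_banach_function_space
begin

lemma mono_abs:
  "f \<in> borel_measurable lebesgue \<Longrightarrow> g \<in> borel_measurable lebesgue \<Longrightarrow>
    (AE x in lebesgue. \<bar>g x\<bar> \<le> \<bar>f x\<bar>) \<Longrightarrow> Y g \<le> Y f"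
  using lattice by blast

lemma cong_abs:
  "f \<in> borel_measurable lebesgue \<Longrightarrow> g \<in> borel_measurable lebesgue \<Longrightarrow>
    (AE x in lebesgue. \<bar>g x\<bar> = \<bar>f x\<bar>) \<Longrightarrow> Y g = Y f"
  by (intro antisym mono_abs) auto

lemma norm_zero: "Y (\<lambda>x. 0) = 0"
  using homogeneous[of "\<lambda>x. 0" 0] by simp

lemma fatou_SUP:
  assumes "\<And>m. F m \<in> borel_measurable lebesgue" "f \<in> borel_measurable lebesgue"
    and "AE x in lebesgue. (\<forall>m. 0 \<le> F m x \<and> F m x \<le> F (Suc m) x) \<and> (\<lambda>m. F m x) \<longlonglongrightarrow> f x"
  shows "Y f = (SUP m. Y (F m))"
  using fatou[OF assms] LIMSEQ_SUP LIMSEQ_unique by blast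

lemma extended_norm_mono:
  assumes [measurable]: "F \<in> borel_measurable lebesgue" "G \<in> borel_measurable lebesgue"
    and "AE x in lebesgue. F x \<le> G x"
  shows "extended_norm Y F \<le> extended_norm Y G"
  unfolding extended_norm_def
proof (rule SUP_mono)
  fix n :: nat
  have "Y (\<lambda>x. enn2real (min (F x) (of_nat n))) \<le> Y (\<lambda>x. enn2real (min (G x) (of_nat n)))"
    using assms(3) by (intro mono_abs) (auto elim!: eventually_mono intro: enn2real_min_of_nat_mono)
  then show "\<exists>m\<in>UNIV. Y (\<lambda>x. enn2real (min (F x) (of_nat n))) \<le> Y (\<lambda>x. enn2real (min (G x) (of_nat m)))"
    by blast
qed

lemma extended_norm_real:
  assumes [measurable]: "f \<in> borel_measurable lebesgue"
  shows "extended_norm Y (\<lambda>x. ennreal \<bar>f x\<bar>) = Y f"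
proof -
  have eq: "enn2real (min (ennreal \<bar>f x\<bar>) (of_nat n)) = min \<bar>f x\<bar> (real n)" for x n
    by (simp add: min_ennreal ennreal_of_nat_eq_real_of_nat)
  have lim: "(\<lambda>n. min \<bar>f x\<bar> (real n)) \<longlonglongrightarrow> \<bar>f x\<bar>" for x
  proof (rule tendsto_eventually)
    obtain n0 :: nat where "\<bar>f x\<bar> \<le> real n0" using real_arch_simple by blast
    then show "\<forall>\<^sub>F n in sequentially. min \<bar>f x\<bar> (real n) = \<bar>f x\<bar>"
      by (intro eventually_sequentiallyI[of n0]) linarith
  qed
  have "Y (\<lambda>x. \<bar>f x\<bar>) = (SUP n. Y (\<lambda>x. min \<bar>f x\<bar> (real n)))"
    by (rule fatou_SUP) (auto simp: lim)
  moreover have "Y (\<lambda>x. \<bar>f x\<bar>) = Y f"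
    by (rule cong_abs) auto
  ultimately show ?thesis
    by (simp add: extended_norm_def eq)
qed

lemma extended_norm_cmult_le:
  assumes [measurable]: "F \<in> borel_measurable lebesgue" and c: "0 < c"
  shows "extended_norm Y (\<lambda>x. ennreal c * F x) \<le> ennreal c * extended_norm Y F"
  unfolding extended_norm_def
proof (rule SUP_least)
  fix n :: nat
  obtain m :: nat where m: "real n / c \<le> real m" using real_arch_simple by blast
  have le: "min (ennreal c * F x) (of_nat n) \<le> ennreal c * min (F x) (of_nat m)" for x
  proof (cases "F x \<le> of_nat m")
    case False
    have "of_nat n \<le> ennreal c * of_nat m"
      using m c by (simp add: ennreal_of_nat_eq_real_of_nat field_simps flip: ennreal_mult)
    with False show ?thesis by (auto simp: min_def)
  qed (auto simp: min_def)
  have le': "enn2real (min (ennreal c * F x) (of_nat n)) \<le> c * enn2real (min (F x) (of_nat m))" for x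
  proof -
    have "enn2real (min (ennreal c * F x) (of_nat n)) \<le> enn2real (ennreal c * min (F x) (of_nat m))"
      using le by (intro enn2real_mono)
        (auto simp: ennreal_mult_less_top of_nat_less_top min_less_iff_disj)
    also have "\<dots> = c * enn2real (min (F x) (of_nat m))"
      using c by (simp add: enn2real_mult)
    finally show ?thesis .
  qed
  have "Y (\<lambda>x. enn2real (min (ennreal c * F x) (of_nat n)))
      \<le> Y (\<lambda>x. c * enn2real (min (F x) (of_nat m)))"
    using le' c by (intro mono_abs) auto
  also have "\<dots> = ennreal c * Y (\<lambda>x. enn2real (min (F x) (of_nat m)))"
    using c by (subst homogeneous) auto
  also have "\<dots> \<le> ennreal c * (SUP n. Y (\<lambda>x. enn2real (min (F x) (of_nat n))))"
    by (intro mult_left_mono SUP_upper) auto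
  finally show "Y (\<lambda>x. enn2real (min (ennreal c * F x) (of_nat n)))
      \<le> ennreal c * (SUP n. Y (\<lambda>x. enn2real (min (F x) (of_nat n))))" .
qed

lemma extended_norm_add_le:
  obtains K where "K \<ge> 1"
    "\<And>F G. F \<in> borel_measurable lebesgue \<Longrightarrow> G \<in> borel_measurable lebesgue \<Longrightarrow>
      extended_norm Y (\<lambda>x. F x + G x) \<le> ennreal K * (extended_norm Y F + extended_norm Y G)"
proof -
  obtain K where K: "K \<ge> 1" "\<And>f g. f\<in>borel_measurable lebesgue \<Longrightarrow> g\<in>borel_measurable lebesgue \<Longrightarrow>
         Y (\<lambda>x. f x + g x) \<le> ennreal K * (Y f + Y g)"
    using quasi_triangle by blast
  have "extended_norm Y (\<lambda>x. F x + G x) \<le> ennreal K * (extended_norm Y F + extended_norm Y G)"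
    if [measurable]: "F \<in> borel_measurable lebesgue" "G \<in> borel_measurable lebesgue" for F G
  proof -
    have "Y (\<lambda>x. enn2real (min (F x + G x) (of_nat n))) \<le> ennreal K * (extended_norm Y F + extended_norm Y G)" for n
    proof -
      let ?f = "\<lambda>x. enn2real (min (F x) (of_nat n))" and ?g = "\<lambda>x. enn2real (min (G x) (of_nat n))"
      have "enn2real (min (F x + G x) (of_nat n)) \<le> ?f x + ?g x" for x
      proof -
        have "min (F x + G x) (of_nat n) \<le> min (F x) (of_nat n) + min (G x) (of_nat n)"
        proof (cases "F x \<le> of_nat n \<and> G x \<le> of_nat n")
          case False
          then have "of_nat n \<le> min (F x) (of_nat n) + min (G x) (of_nat n)"
            by (auto simp: min_def add_increasing add_increasing2)
          then show ?thesis by (rule min.coboundedI2)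
        qed (auto simp: min_def)
        also have "\<dots> = ennreal (?f x + ?g x)"
          by (subst ennreal_plus) auto
        finally show ?thesis
          by (intro enn2real_leI) auto
      qed
      then have "Y (\<lambda>x. enn2real (min (F x + G x) (of_nat n))) \<le> Y (\<lambda>x. ?f x + ?g x)"
        by (intro mono_abs) (auto simp del: abs_of_nonneg simp: abs_of_nonneg intro!: order_trans[OF _ abs_ge_self])
      also have "\<dots> \<le> ennreal K * (Y ?f + Y ?g)"
        by (intro K) auto
      also have "\<dots> \<le> ennreal K * (extended_norm Y F + extended_norm Y G)"
        unfolding extended_norm_def by (intro mult_left_mono add_mono SUP_upper) auto
      finally show ?thesis .
    qed
    then show ?thesis
      by (subst extended_norm_def) (blast intro: SUP_least)
  qed
  with K(1) show ?thesis using that by blast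
qed

lemma extended_norm_SUP:
  assumes [measurable]: "\<And>m. F m \<in> borel_measurable lebesgue" and inc: "\<And>x. incseq (\<lambda>m. F m x)"
  shows "extended_norm Y (\<lambda>x. SUP m. F m x) = (SUP m::nat. extended_norm Y (F m))"
proof -
  have *: "Y (\<lambda>x. enn2real (min (SUP m. F m x) (of_nat n)))
      = (SUP m. Y (\<lambda>x. enn2real (min (F m x) (of_nat n))))" for n
  proof (rule fatou_SUP)
    show "AE x in lebesgue. (\<forall>m. 0 \<le> enn2real (min (F m x) (of_nat n)) \<and>
            enn2real (min (F m x) (of_nat n)) \<le> enn2real (min (F (Suc m) x) (of_nat n))) \<and>
        (\<lambda>m. enn2real (min (F m x) (of_nat n))) \<longlonglongrightarrow> enn2real (min (SUP m. F m x) (of_nat n))"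
    proof (intro AE_I2 conjI allI)
      fix x m
      show "enn2real (min (F m x) (of_nat n)) \<le> enn2real (min (F (Suc m) x) (of_nat n))"
        using inc by (intro enn2real_min_of_nat_mono) (auto simp: incseq_Suc_iff)
      have "(\<lambda>m. min (F m x) (of_nat n)) \<longlonglongrightarrow> min (SUP m. F m x) (of_nat n)"
        using LIMSEQ_SUP[OF inc[of x]] by (intro tendsto_min) auto
      then show "(\<lambda>m. enn2real (min (F m x) (of_nat n))) \<longlonglongrightarrow> enn2real (min (SUP m. F m x) (of_nat n))"
        by (intro tendsto_enn2real) (auto simp: of_nat_less_top min_less_iff_disj)
    qed auto
  qed auto
  show ?thesis
    unfolding extended_norm_def * by (rule SUP_commute)
qed

lemma extended_norm_liminf_le:
  assumes [measurable]: "\<And>m. F m \<in> borel_measurable lebesgue"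
  shows "extended_norm Y (\<lambda>x. liminf (\<lambda>m. F m x)) \<le> liminf (\<lambda>m. extended_norm Y (F m))"
proof -
  have "extended_norm Y (\<lambda>x. liminf (\<lambda>m. F m x)) = extended_norm Y (\<lambda>x. SUP k. INF m\<in>{k..}. F m x)"
    by (simp add: liminf_SUP_INF)
  also have "\<dots> = (SUP k. extended_norm Y (\<lambda>x. INF m\<in>{k..}. F m x))"
    by (rule extended_norm_SUP) (auto simp: incseq_def intro!: INF_superset_mono)
  also have "\<dots> \<le> (SUP k. INF m\<in>{k..}. extended_norm Y (F m))"
    by (intro SUP_mono' INF_greatest extended_norm_mono) (auto intro!: INF_lower)
  also have "\<dots> = liminf (\<lambda>m. extended_norm Y (F m))"
    by (simp add: liminf_SUP_INF)
  finally show ?thesis .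
qed

lemma AE_finite_if_extended_norm_finite:
  assumes [measurable]: "F \<in> borel_measurable lebesgue" and fin: "extended_norm Y F < \<infinity>"
  shows "AE x in lebesgue. F x < \<infinity>"
proof -
  define E where "E = {x. F x = \<infinity>}"
  have [measurable]: "E \<in> sets lebesgue"
    using measurable_sets[OF assms(1), of "{\<infinity>}"] by (simp add: E_def vimage_def)
  have "ennreal (real n) * Y (indicator E) \<le> extended_norm Y F" for n :: nat
  proof -
    have "ennreal (real n) * Y (indicator E) = Y (\<lambda>x. real n * indicator E x)"
      by (subst homogeneous) auto
    also have "\<dots> \<le> Y (\<lambda>x. enn2real (min (F x) (of_nat n)))"
      by (intro mono_abs) (auto simp: E_def indicator_def min_def top_unique)
    also have "\<dots> \<le> extended_norm Y F"
      unfolding extended_norm_def by (rule SUP_upper) auto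
    finally show ?thesis .
  qed
  then have "(SUP n::nat. of_nat n * Y (indicator E)) \<le> extended_norm Y F"
    by (intro SUP_least) (simp add: ennreal_of_nat_eq_real_of_nat)
  then have "top * Y (indicator E) \<le> extended_norm Y F"
    by (simp flip: SUP_mult_right_ennreal add: ennreal_SUP_of_nat_eq_top)
  with fin have "Y (indicator E) = 0"
    by (auto simp: ennreal_top_mult split: if_splits)
  then have "AE x in lebesgue. (indicator E x :: real) = 0"
    by (intro definite) auto
  then show ?thesis
    by eventually_elim (auto simp: E_def indicator_def less_top)
qed

text \<open>
  Among all extensions of a function from \<open>\<Omega>\<close> to the whole space the zero extension has the
  smallest quasi-norm, by the lattice property.
\<close>

lemma restrict_norm_eq_extended_norm:
  fixes G \<phi> :: "'a \<Rightarrow> ereal"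
  assumes [measurable]: "G \<in> borel_measurable lebesgue"
    and on: "\<And>x. x \<in> \<Omega> \<Longrightarrow> G x = \<phi> x" and off: "\<And>x. x \<notin> \<Omega> \<Longrightarrow> G x = 0"
  shows "restrict_norm Y \<Omega> \<phi> = extended_norm Y (\<lambda>x. e2ennreal \<bar>G x\<bar>)"
proof (rule antisym)
  show "restrict_norm Y \<Omega> \<phi> \<le> extended_norm Y (\<lambda>x. e2ennreal \<bar>G x\<bar>)"
  proof (cases "extended_norm Y (\<lambda>x. e2ennreal \<bar>G x\<bar>) < \<infinity>")
    case True
    have "AE x in lebesgue. e2ennreal \<bar>G x\<bar> < \<infinity>"
      by (rule AE_finite_if_extended_norm_finite[OF _ True]) measurable
    then have fin: "AE x in lebesgue. \<bar>G x\<bar> \<noteq> \<infinity>"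
      by eventually_elim auto
    let ?g = "\<lambda>x. real_of_ereal (G x)"
    have "Y ?g = extended_norm Y (\<lambda>x. ennreal \<bar>?g x\<bar>)"
      by (subst extended_norm_real) auto
    also have "\<dots> = extended_norm Y (\<lambda>x. e2ennreal \<bar>G x\<bar>)"
    proof -
      have "AE x in lebesgue. ennreal \<bar>?g x\<bar> = e2ennreal \<bar>G x\<bar>"
        using fin
      proof eventually_elim
        fix x assume "\<bar>G x\<bar> \<noteq> \<infinity>"
        then show "ennreal \<bar>?g x\<bar> = e2ennreal \<bar>G x\<bar>"
          by (cases "G x") auto
      qed
      then show ?thesis
        by (intro antisym extended_norm_mono) auto
    qed
    finally have eq: "Y ?g = extended_norm Y (\<lambda>x. e2ennreal \<bar>G x\<bar>)" .
    have "AE x in lebesgue. x \<in> \<Omega> \<longrightarrow> ereal (?g x) = \<phi> x"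
      using fin by eventually_elim (auto simp: ereal_real on)
    then have "restrict_norm Y \<Omega> \<phi> \<le> Y ?g"
      unfolding restrict_norm_def using True eq by (intro INF_lower) (auto simp: fspace_def)
    with eq show ?thesis by simp
  qed (simp add: top_unique not_less)
next
  show "extended_norm Y (\<lambda>x. e2ennreal \<bar>G x\<bar>) \<le> restrict_norm Y \<Omega> \<phi>"
    unfolding restrict_norm_def
  proof (intro INF_greatest)
    fix g assume "g \<in> {g \<in> fspace Y. AE x in lebesgue. x \<in> \<Omega> \<longrightarrow> ereal (g x) = \<phi> x}"
    then have [measurable]: "g \<in> borel_measurable lebesgue"
      and eq: "AE x in lebesgue. x \<in> \<Omega> \<longrightarrow> ereal (g x) = \<phi> x"
      by (auto simp: fspace_def)
    have "extended_norm Y (\<lambda>x. e2ennreal \<bar>G x\<bar>) \<le> extended_norm Y (\<lambda>x. ennreal \<bar>g x\<bar>)"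
    proof (rule extended_norm_mono)
      show "AE x in lebesgue. e2ennreal \<bar>G x\<bar> \<le> ennreal \<bar>g x\<bar>"
        using eq
      proof eventually_elim
        fix x assume "x \<in> \<Omega> \<longrightarrow> ereal (g x) = \<phi> x"
        then show "e2ennreal \<bar>G x\<bar> \<le> ennreal \<bar>g x\<bar>"
          by (cases "x \<in> \<Omega>") (auto simp: off on[symmetric] zero_ereal_def dest!: sym[of "ereal _"] simp del: ereal_eq_0)
      qed
    qed measurable
    then show "extended_norm Y (\<lambda>x. e2ennreal \<bar>G x\<bar>) \<le> Y g"
      by (simp add: extended_norm_real)
  qed
qed

end

lemma sigma_finite_lebesgue: "sigma_finite_measure (lebesgue :: 'a::euclidean_space measure)"
proof
  obtain A :: "'a set set" where A: "countable A" "A \<subseteq> sets lborel" "\<Union>A = space lborel" "\<forall>a\<in>A. emeasure lborel a \<noteq> \<infinity>"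
    using lborel.sigma_finite_countable by blast
  then show "\<exists>A::'a set set. countable A \<and> A \<subseteq> sets lebesgue \<and> \<Union>A = space lebesgue \<and> (\<forall>a\<in>A. emeasure lebesgue a \<noteq> \<infinity>)"
    by (intro exI[of _ A]) (auto simp: subset_iff)
qed

section \<open>The second associate norm\<close>

lemma integrable_if_bounded_on_ball:
  fixes f :: "'a::euclidean_space \<Rightarrow> real"
  assumes "f \<in> borel_measurable lebesgue" "\<And>x. \<bar>f x\<bar> \<le> C * indicator (ball z R) x"
  shows "integrable lebesgue f"
proof (rule Bochner_Integration.integrable_bound)
  show "integrable lebesgue (\<lambda>x. C * indicator (ball z R) x)"
    by (intro integrable_mult_right integrable_real_indicator) (use emeasure_bounded_finite[of "ball z R"] in auto)
qed (use assms in \<open>auto intro: order_trans[OF _ abs_ge_self]\<close>)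

text \<open>
  The part of the completeness of \<open>L\<^sup>2\<close> that is needed: a sequence with geometrically small
  increments converges almost everywhere.
\<close>

lemma AE_convergent_if_consecutive_L2_small:
  fixes u :: "nat \<Rightarrow> 'a \<Rightarrow> real"
  assumes [measurable]: "\<And>n. u n \<in> borel_measurable M"
    and small: "\<And>n. (\<integral>\<^sup>+x. ennreal ((u (Suc n) x - u n x)\<^sup>2) \<partial>M) \<le> ennreal (C / 4 ^ n)"
    and C: "0 \<le> C"
  shows "AE x in M. convergent (\<lambda>n. u n x)"
proof -
  let ?w = "\<lambda>n x. u (Suc n) x - u n x"
  have le: "(\<integral>\<^sup>+x. ennreal (2 ^ n * (?w n x)\<^sup>2) \<partial>M) \<le> ennreal (C * (1 / 2) ^ n)" for n
  proof -
    have "(\<integral>\<^sup>+x. ennreal (2 ^ n * (?w n x)\<^sup>2) \<partial>M) = ennreal (2 ^ n) * (\<integral>\<^sup>+x. ennreal ((?w n x)\<^sup>2) \<partial>M)"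
      by (subst nn_integral_cmult[symmetric]) (auto simp: ennreal_mult)
    also have "\<dots> \<le> ennreal (2 ^ n) * ennreal (C / 4 ^ n)"
      by (intro mult_left_mono small) auto
    also have "\<dots> = ennreal (C * (1 / 2) ^ n)"
      using C by (simp add: power_mult_distrib[symmetric] field_simps flip: ennreal_mult)
    finally show ?thesis .
  qed
  have "(\<integral>\<^sup>+x. (\<Sum>n. ennreal (2 ^ n * (?w n x)\<^sup>2)) \<partial>M) = (\<Sum>n. \<integral>\<^sup>+x. ennreal (2 ^ n * (?w n x)\<^sup>2) \<partial>M)"
    by (rule nn_integral_suminf) measurable
  also have "\<dots> \<le> (\<Sum>n. ennreal (C * (1 / 2) ^ n))"
    by (intro suminf_le le) auto
  also have "\<dots> < \<infinity>"
    using C by (subst suminf_ennreal2) (auto intro!: summable_mult summable_geometric)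
  finally have "AE x in M. (\<Sum>n. ennreal (2 ^ n * (?w n x)\<^sup>2)) \<noteq> \<infinity>"
    by (intro nn_integral_PInf_AE) auto
  then show ?thesis
  proof eventually_elim
    fix x assume "(\<Sum>n. ennreal (2 ^ n * (?w n x)\<^sup>2)) \<noteq> \<infinity>"
    then have "summable (\<lambda>n. 2 ^ n * (?w n x)\<^sup>2)"
      by (intro summable_suminf_not_top) auto
    then have sm: "summable (\<lambda>n. (1 / 2) ^ n + 2 ^ n * (?w n x)\<^sup>2)"
      by (intro summable_add summable_geometric) auto
    have "summable (\<lambda>n. ?w n x)"
    proof (rule summable_comparison_test'[OF sm])
      fix n :: nat
      let ?a = "(1 / 2) ^ n :: real" and ?b = "\<bar>?w n x\<bar>"
      \<comment> \<open>Weighting the squared increments by \<open>2\<^sup>n\<close> trades their square summability for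
          absolute summability: either \<open>b \<le> a\<close> or \<open>1 \<le> 2\<^sup>n b\<close>.\<close>
      have "?b \<le> ?a + 2 ^ n * ?b\<^sup>2"
      proof (cases "?b \<le> ?a")
        case False
        then have "1 \<le> 2 ^ n * ?b"
          by (simp add: field_simps)
        then have "?b * 1 \<le> ?b * (2 ^ n * ?b)"
          by (intro mult_left_mono) auto
        then show ?thesis
          by (simp add: power2_eq_square mult_ac add_increasing)
      qed (simp add: add_increasing2)
      then show "norm (?w n x) \<le> (1 / 2) ^ n + 2 ^ n * (?w n x)\<^sup>2"
        by simp
    qed
    then have "(\<lambda>n. u 0 x + (\<Sum>k<n. ?w k x)) \<longlonglongrightarrow> u 0 x + (\<Sum>k. ?w k x)"
      by (intro tendsto_add tendsto_const summable_LIMSEQ)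
    moreover have "(\<lambda>n. u 0 x + (\<Sum>k<n. ?w k x)) = (\<lambda>n. u n x)"
      by (simp add: sum_lessThan_telescope[of "\<lambda>n. u n x"])
    ultimately show "convergent (\<lambda>n. u n x)"
      by (auto intro: convergentI)
  qed
qed

context ball_banach_function_space
begin

lemma convex_combination_le_1:
  assumes "f \<in> borel_measurable lebesgue" "g \<in> borel_measurable lebesgue"
    and "Y f \<le> 1" "Y g \<le> 1" "0 \<le> t" "t \<le> 1"
  shows "Y (\<lambda>x. (1 - t) * f x + t * g x) \<le> 1"
proof -
  have "Y (\<lambda>x. (1 - t) * f x + t * g x) \<le> Y (\<lambda>x. (1 - t) * f x) + Y (\<lambda>x. t * g x)"
    using assms by (intro triangle) auto
  also have "\<dots> = ennreal (1 - t) * Y f + ennreal t * Y g"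
    using assms by (simp add: homogeneous)
  also have "\<dots> \<le> ennreal (1 - t) * 1 + ennreal t * 1"
    using assms by (intro add_mono mult_left_mono) auto
  also have "\<dots> = 1"
    using assms by (simp flip: ennreal_plus)
  finally show ?thesis .
qed

text \<open>
  The unit ball is convex, solid and closed under almost everywhere limits. Let \<open>v\<close> be the
  \<open>L\<^sup>2\<close>-nearest point to \<open>h\<close> in the unit ball. If \<open>v\<close> differs from \<open>h\<close>, then \<open>g = h - v\<close> separates
  \<open>h\<close> from the unit ball: the variational inequality bounds \<open>\<integral> g w\<close> by \<open>\<integral> g v\<close> for every \<open>w\<close> in
  the unit ball, whereas \<open>\<integral> g h\<close> exceeds \<open>\<integral> g v\<close> by \<open>\<integral> g\<^sup>2\<close>. So a multiple of \<open>g\<close> has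
  associate norm at most 1 but pairs with \<open>h\<close> to more than 1. This Hilbert space projection
  takes the place of the Hahn-Banach theorem.
\<close>

lemma le_1_if_dual_le_1_bounded:
  assumes h [measurable]: "h \<in> borel_measurable lebesgue"
    and nonneg: "\<And>x. 0 \<le> h x" and bound: "\<And>x. h x \<le> N * indicator (ball 0 R) x"
    and dual: "\<And>g. g \<in> borel_measurable lebesgue \<Longrightarrow> associate_norm Y g \<le> 1 \<Longrightarrow>
      (\<integral>\<^sup>+x. ennreal \<bar>h x * g x\<bar> \<partial>lebesgue) \<le> 1"
  shows "Y h \<le> 1"
proof -
  let ?B = "ball (0::'a) R"
  have [measurable]: "?B \<in> sets lebesgue"
    by simp
  \<comment> \<open>Restricting to \<open>0 \<le> u \<le> h\<close> loses nothing, since replacing \<open>u\<close> by \<open>min u h\<close> brings it closer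
      to \<open>h\<close> and does not increase its norm; it gives the functions in \<open>S\<close> a common integrable
      bound.\<close>
  define S where "S = {u \<in> borel_measurable lebesgue. (\<forall>x. 0 \<le> u x \<and> u x \<le> h x) \<and> Y u \<le> 1}"
  define J where "J u = (\<integral>x. (h x - u x)\<^sup>2 \<partial>lebesgue)" for u
  define d where "d = (INF u\<in>S. J u)"
  have bounded_integrable: "integrable lebesgue f"
    if "f \<in> borel_measurable lebesgue" "\<And>x. \<bar>f x\<bar> \<le> C * indicator ?B x" for f :: "'a \<Rightarrow> real" and C
    using that by (rule integrable_if_bounded_on_ball)
  have prod_integrable: "integrable lebesgue (\<lambda>x. f x * g x)"
    if "f \<in> borel_measurable lebesgue" "\<And>x. \<bar>f x\<bar> \<le> C * indicator ?B x"
      "g \<in> borel_measurable lebesgue" "\<And>x. \<bar>g x\<bar> \<le> D * indicator ?B x" for f g :: "'a \<Rightarrow> real" and C D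
  proof (rule bounded_integrable[where C = "C * D"])
    show "\<bar>f x * g x\<bar> \<le> C * D * indicator ?B x" for x
      using that(2)[of x] that(4)[of x] by (auto simp: abs_mult indicator_def split: if_splits intro: mult_mono')
  qed (use that in auto)
  have S_bound: "\<bar>u x\<bar> \<le> N * indicator ?B x" "\<bar>h x - u x\<bar> \<le> N * indicator ?B x" if "u \<in> S" for u x
    using that bound[of x] unfolding S_def by (auto intro: order_trans) (smt (verit))
  have S_meas: "u \<in> borel_measurable lebesgue" if "u \<in> S" for u
    using that by (simp add: S_def)
  have zero_S: "(\<lambda>x. 0) \<in> S"
    by (simp add: S_def nonneg norm_zero)
  have d_le: "d \<le> J u" if "u \<in> S" for u
    unfolding d_def by (intro cINF_lower that bdd_belowI[of _ 0]) (auto simp: J_def)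
  have "\<exists>u\<in>S. J u < d + 1 / 4 ^ n" for n :: nat
  proof -
    have "(INF u\<in>S. J u) < d + 1 / 4 ^ n"
      by (simp add: d_def)
    then show ?thesis
      using zero_S by (subst (asm) cINF_less_iff) (auto intro!: bdd_belowI[of _ 0] simp: J_def)
  qed
  then obtain u where u: "\<And>n. u n \<in> S" "\<And>n. J (u n) < d + 1 / 4 ^ n"
    by metis
  have [measurable]: "u n \<in> borel_measurable lebesgue" for n
    using u(1) by (rule S_meas)
  have sq_int: "integrable lebesgue (\<lambda>x. (h x - w x)\<^sup>2)" if "w \<in> S" for w
    unfolding power2_eq_square
    by (rule prod_integrable[OF _ S_bound(2)[OF that] _ S_bound(2)[OF that]]) (use S_meas[OF that] in auto)
  \<comment> \<open>The parallelogram law, applied to the midpoint, which is again in \<open>S\<close> and therefore at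
      squared distance at least \<open>d\<close>.\<close>
  have cauchy: "(\<integral>x. (u m x - u n x)\<^sup>2 \<partial>lebesgue) \<le> 2 * (1 / 4 ^ m + 1 / 4 ^ n)" for m n
  proof -
    have mid: "(\<lambda>x. (1 - 1/2) * u m x + 1/2 * u n x) \<in> S"
    proof -
      have "Y (\<lambda>x. (1 - 1/2) * u m x + 1/2 * u n x) \<le> 1"
        using u(1)[of m] u(1)[of n] by (intro convex_combination_le_1) (auto simp: S_def)
      moreover have "0 \<le> (1 - 1/2) * u m x + 1/2 * u n x \<and> (1 - 1/2) * u m x + 1/2 * u n x \<le> h x" for x
        using u(1)[of m] u(1)[of n] unfolding S_def by (auto; smt (verit) field_sum_of_halves)
      ultimately show ?thesis
        by (auto simp: S_def)
    qed
    let ?m = "\<lambda>x. (1 - 1/2) * u m x + 1/2 * u n x"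
    have "(\<integral>x. (u m x - u n x)\<^sup>2 \<partial>lebesgue)
        = (\<integral>x. 2 * (h x - u m x)\<^sup>2 + 2 * (h x - u n x)\<^sup>2 - 4 * (h x - ?m x)\<^sup>2 \<partial>lebesgue)"
      by (intro Bochner_Integration.integral_cong) (auto simp: power2_eq_square field_simps)
    also have "\<dots> = 2 * J (u m) + 2 * J (u n) - 4 * J ?m"
      unfolding J_def using sq_int[OF u(1)[of m]] sq_int[OF u(1)[of n]] sq_int[OF mid]
      by (subst Bochner_Integration.integral_diff Bochner_Integration.integral_add; simp)+
    also have "\<dots> \<le> 2 * (1 / 4 ^ m + 1 / 4 ^ n)"
      using u(2)[of m] u(2)[of n] d_le[OF mid] by simp
    finally show ?thesis .
  qed
  have conv: "AE x in lebesgue. convergent (\<lambda>n. u n x)"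
  proof (rule AE_convergent_if_consecutive_L2_small)
    fix n
    have "(\<integral>\<^sup>+x. ennreal ((u (Suc n) x - u n x)\<^sup>2) \<partial>lebesgue) = ennreal (\<integral>x. (u (Suc n) x - u n x)\<^sup>2 \<partial>lebesgue)"
    proof (rule nn_integral_eq_integral)
      have "\<bar>u (Suc n) x - u n x\<bar> \<le> N * indicator ?B x" for x
        using u(1)[of n] u(1)[of "Suc n"] bound[of x] unfolding S_def by (auto; smt (verit))
      then show "integrable lebesgue (\<lambda>x. (u (Suc n) x - u n x)\<^sup>2)"
        unfolding power2_eq_square by (intro prod_integrable[where C = N and D = N]) auto
    qed auto
    also have "\<dots> \<le> ennreal (2 * (1 / 4 ^ Suc n + 1 / 4 ^ n))"
      by (intro ennreal_leI cauchy)
    also have "\<dots> \<le> ennreal (4 / 4 ^ n)"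
      by (intro ennreal_leI) (auto simp: field_simps)
    finally show "(\<integral>\<^sup>+x. ennreal ((u (Suc n) x - u n x)\<^sup>2) \<partial>lebesgue) \<le> ennreal (4 / 4 ^ n)" .
  qed auto
  \<comment> \<open>Clamping makes \<open>0 \<le> v \<le> h\<close> hold everywhere, also where the sequence diverges.\<close>
  define v where "v x = max 0 (min (h x) (lim (\<lambda>n. u n x)))" for x
  have v_meas [measurable]: "v \<in> borel_measurable lebesgue"
    unfolding v_def by measurable
  have v_lim: "AE x in lebesgue. (\<lambda>n. u n x) \<longlonglongrightarrow> v x"
    using conv
  proof eventually_elim
    fix x assume "convergent (\<lambda>n. u n x)"
    then have *: "(\<lambda>n. u n x) \<longlonglongrightarrow> lim (\<lambda>n. u n x)"
      by (simp add: convergent_LIMSEQ_iff)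
    have "0 \<le> lim (\<lambda>n. u n x)" "lim (\<lambda>n. u n x) \<le> h x"
      using u(1) by (auto intro!: LIMSEQ_le_const[OF *] LIMSEQ_le_const2[OF *] simp: S_def)
    with * show "(\<lambda>n. u n x) \<longlonglongrightarrow> v x"
      by (simp add: v_def)
  qed
  have Yv: "Y v \<le> 1"
  proof -
    have "Y v = extended_norm Y (\<lambda>x. ennreal \<bar>v x\<bar>)"
      by (simp add: extended_norm_real)
    also have "\<dots> \<le> extended_norm Y (\<lambda>x. liminf (\<lambda>n. ennreal \<bar>u n x\<bar>))"
    proof (rule extended_norm_mono)
      show "AE x in lebesgue. ennreal \<bar>v x\<bar> \<le> liminf (\<lambda>n. ennreal \<bar>u n x\<bar>)"
        using v_lim
      proof eventually_elim
        fix x assume "(\<lambda>n. u n x) \<longlonglongrightarrow> v x"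
        then have "(\<lambda>n. ennreal \<bar>u n x\<bar>) \<longlonglongrightarrow> ennreal \<bar>v x\<bar>"
          by (intro tendsto_ennrealI tendsto_rabs)
        then show "ennreal \<bar>v x\<bar> \<le> liminf (\<lambda>n. ennreal \<bar>u n x\<bar>)"
          by (subst lim_imp_Liminf) auto
      qed
    qed auto
    also have "\<dots> \<le> liminf (\<lambda>n. extended_norm Y (\<lambda>x. ennreal \<bar>u n x\<bar>))"
      by (rule extended_norm_liminf_le) measurable
    also have "\<dots> = liminf (\<lambda>n. Y (u n))"
      by (simp add: extended_norm_real)
    also have "\<dots> \<le> 1"
      using u(1) by (intro Liminf_le) (auto simp: S_def)
    finally show ?thesis .
  qed
  have vS: "v \<in> S"
    using Yv nonneg by (auto simp: S_def v_def)
  have Jv: "J v \<le> d"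
  proof -
    have "(\<lambda>n. J (u n)) \<longlonglongrightarrow> J v"
      unfolding J_def
    proof (rule integral_dominated_convergence)
      show "integrable lebesgue (\<lambda>x. (N * indicator ?B x)\<^sup>2)"
        by (rule bounded_integrable[where C = "N\<^sup>2"], measurable) (auto simp: power_mult_distrib indicator_def)
      show "AE x in lebesgue. (\<lambda>n. (h x - u n x)\<^sup>2) \<longlonglongrightarrow> (h x - v x)\<^sup>2"
        using v_lim by eventually_elim (intro tendsto_intros)
      show "AE x in lebesgue. norm ((h x - u n x)\<^sup>2) \<le> (N * indicator ?B x)\<^sup>2" for n
        using S_bound(2)[OF u(1)] by (auto intro!: AE_I2 power2_le_iff_abs_le[THEN iffD2] intro: order_trans[OF abs_ge_zero])
    qed auto
    moreover have "(\<lambda>n. d + 1 / 4 ^ n) \<longlonglongrightarrow> d + 0"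
      by (intro tendsto_add tendsto_const) (simp add: LIMSEQ_power_zero flip: power_one_over)
    ultimately show ?thesis
      using u(2) by (intro LIMSEQ_le[of "\<lambda>n. J (u n)" _ "\<lambda>n. d + 1 / 4 ^ n"]) (auto intro: less_imp_le)
  qed
  define g where "g x = h x - v x" for x
  have g_meas [measurable]: "g \<in> borel_measurable lebesgue"
    unfolding g_def by measurable
  have g_bound: "\<bar>g x\<bar> \<le> N * indicator ?B x" for x
    unfolding g_def by (rule S_bound(2)[OF vS])
  have g_nonneg: "0 \<le> g x" for x
    using vS by (simp add: g_def S_def)
  have v_bound: "\<bar>v x\<bar> \<le> N * indicator ?B x" for x
    by (rule S_bound(1)[OF vS])
  define c where "c = (\<integral>x. g x * v x \<partial>lebesgue)"
  have c_nonneg: "0 \<le> c"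
    unfolding c_def using g_nonneg vS by (intro integral_nonneg_AE) (auto simp: S_def)
  have variational: "(\<integral>x. g x * w x \<partial>lebesgue) \<le> c"
    if [measurable]: "w \<in> borel_measurable lebesgue" and "Y w \<le> 1" and w_nonneg: "\<And>x. 0 \<le> w x"
      and w_bound: "\<And>x. \<bar>w x\<bar> \<le> C * indicator ?B x" for w C
  proof -
    have wv_bound: "\<bar>w x - v x\<bar> \<le> (C + N) * indicator ?B x" for x
      using w_bound[of x] v_bound[of x] by (auto simp: indicator_def split: if_splits)
    define a where "a = (\<integral>x. g x * (w x - v x) \<partial>lebesgue)"
    define b where "b = (\<integral>x. (w x - v x)\<^sup>2 \<partial>lebesgue)"
    have ig: "integrable lebesgue (\<lambda>x. g x * (w x - v x))"
      by (intro prod_integrable[where C = N and D = "C + N"] g_bound wv_bound) auto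
    have ib: "integrable lebesgue (\<lambda>x. (w x - v x)\<^sup>2)"
      unfolding power2_eq_square by (intro prod_integrable[where C = "C + N" and D = "C + N"] wv_bound) auto
    have step: "2 * a \<le> t * b" if t: "0 < t" "t \<le> 1" for t
    proof -
      let ?z = "\<lambda>x. (1 - t) * v x + t * w x"
      have Yz: "Y ?z \<le> 1"
        using t Yv \<open>Y w \<le> 1\<close> by (intro convex_combination_le_1) auto
      have z_nonneg: "0 \<le> ?z x" for x
        using t w_nonneg[of x] vS by (auto simp: S_def)
      have "Y (\<lambda>x. min (?z x) (h x)) \<le> Y ?z"
        using z_nonneg nonneg by (intro mono_abs) (auto simp: min_def)
      with Yz z_nonneg nonneg have mem: "(\<lambda>x. min (?z x) (h x)) \<in> S"
        by (auto simp: S_def)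
      have eq: "(h x - ?z x)\<^sup>2 = (h x - v x)\<^sup>2 - 2 * t * (g x * (w x - v x)) + t\<^sup>2 * (w x - v x)\<^sup>2" for x
        by (simp add: g_def power2_eq_square algebra_simps)
      have int: "integrable lebesgue (\<lambda>x. (h x - ?z x)\<^sup>2)"
        unfolding eq using ig ib sq_int[OF vS] by auto
      have "d \<le> J (\<lambda>x. min (?z x) (h x))"
        by (rule d_le[OF mem])
      also have "\<dots> \<le> (\<integral>x. (h x - ?z x)\<^sup>2 \<partial>lebesgue)"
        unfolding J_def by (intro integral_mono sq_int[OF mem] int) (auto simp: min_def)
      also have "\<dots> = J v - 2 * t * a + t\<^sup>2 * b"
        unfolding eq J_def a_def b_def using ig ib sq_int[OF vS]
        by (subst Bochner_Integration.integral_diff Bochner_Integration.integral_add; simp)+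
      finally have "t * (2 * a) \<le> t * (t * b)"
        using Jv by (simp add: power2_eq_square algebra_simps)
      with t show ?thesis by simp
    qed
    have "2 * a \<le> 0"
    proof (rule tendsto_lowerbound)
      show "((\<lambda>t. t * b) \<longlongrightarrow> 0) (at_right 0)"
        by (rule tendsto_eq_intros | simp)+
      show "\<forall>\<^sub>F t in at_right 0. 2 * a \<le> t * b"
        unfolding eventually_at_right_field by (intro exI[of _ 1]) (auto intro: step)
    qed auto
    moreover have "a = (\<integral>x. g x * w x \<partial>lebesgue) - c"
    proof -
      have "integrable lebesgue (\<lambda>x. g x * w x)" "integrable lebesgue (\<lambda>x. g x * v x)"
        by (intro prod_integrable[where C = N and D = C] prod_integrable[where C = N and D = N]
            g_bound w_bound v_bound; measurable)+
      then show ?thesis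
        by (simp add: a_def c_def right_diff_distrib)
    qed
    ultimately show ?thesis by simp
  qed
  have dual_g: "(\<integral>\<^sup>+x. ennreal \<bar>g x * w x\<bar> \<partial>lebesgue) \<le> ennreal c"
    if [measurable]: "w \<in> borel_measurable lebesgue" and w1: "Y w \<le> 1" for w
  proof -
    define wk where "wk k x = min \<bar>w x\<bar> (real k) * indicator ?B x" for k x
    have [measurable]: "wk k \<in> borel_measurable lebesgue" for k
      unfolding wk_def by measurable
    have wk_le: "(\<integral>\<^sup>+x. ennreal (g x * wk k x) \<partial>lebesgue) \<le> ennreal c" for k
    proof -
      have bd: "\<bar>wk k x\<bar> \<le> real k * indicator ?B x" for x
        by (auto simp: wk_def indicator_def)
      have "Y (wk k) \<le> Y w"
        by (intro mono_abs) (auto simp: wk_def indicator_def)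
      then have Ywk: "Y (wk k) \<le> 1"
        using w1 by (rule order_trans)
      have nn: "0 \<le> wk k x" for x
        by (simp add: wk_def)
      have "(\<integral>x. g x * wk k x \<partial>lebesgue) \<le> c"
        by (intro variational[where C = "real k"] bd Ywk nn) auto
      moreover have "integrable lebesgue (\<lambda>x. g x * wk k x)"
        by (intro prod_integrable[where C = N and D = k] g_bound bd) auto
      ultimately show ?thesis
        using g_nonneg nn by (subst nn_integral_eq_integral) (auto intro!: ennreal_leI)
    qed
    have "(\<integral>\<^sup>+x. ennreal \<bar>g x * w x\<bar> \<partial>lebesgue) = (\<integral>\<^sup>+x. liminf (\<lambda>k. ennreal (g x * wk k x)) \<partial>lebesgue)"
    proof (rule nn_integral_cong)
      fix x
      obtain k0 :: nat where k0: "\<bar>w x\<bar> \<le> real k0" using real_arch_simple by blast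
      have "eventually (\<lambda>k. g x * wk k x = \<bar>g x * w x\<bar>) sequentially"
      proof (rule eventually_sequentiallyI[of k0])
        fix k assume "k0 \<le> k"
        with k0 have "min \<bar>w x\<bar> (real k) = \<bar>w x\<bar>" by simp
        then show "g x * wk k x = \<bar>g x * w x\<bar>"
          using g_bound[of x] g_nonneg[of x] by (auto simp: wk_def abs_mult indicator_def split: if_splits)
      qed
      then have "(\<lambda>k. g x * wk k x) \<longlonglongrightarrow> \<bar>g x * w x\<bar>"
        by (rule tendsto_eventually)
      then show "ennreal \<bar>g x * w x\<bar> = liminf (\<lambda>k. ennreal (g x * wk k x))"
        by (intro lim_imp_Liminf[symmetric] tendsto_ennrealI) auto
    qed
    also have "\<dots> \<le> liminf (\<lambda>k. \<integral>\<^sup>+x. ennreal (g x * wk k x) \<partial>lebesgue)"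
      by (rule nn_integral_liminf) measurable
    also have "\<dots> \<le> ennreal c"
      using wk_le by (intro Liminf_le) auto
    finally show ?thesis .
  qed
  have "J v = 0"
  proof (rule ccontr)
    assume "J v \<noteq> 0"
    then have J_pos: "0 < J v"
      using integral_nonneg_AE[of "\<lambda>x. (h x - v x)\<^sup>2" lebesgue] by (simp add: J_def less_le)
    \<comment> \<open>Any value strictly between \<open>\<integral> g v\<close> and \<open>\<integral> g h\<close> is a suitable normalization, and unlike
        \<open>\<integral> g v\<close> it is never 0.\<close>
    define c1 where "c1 = c + J v / 2"
    have c1: "0 < c1" "c \<le> c1"
      using J_pos c_nonneg by (auto simp: c1_def)
    have "associate_norm Y (\<lambda>x. g x / c1) \<le> 1"
      unfolding associate_norm_def
    proof (rule SUP_least)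
      fix w assume "w \<in> {w \<in> borel_measurable lebesgue. Y w \<le> 1}"
      then have [measurable]: "w \<in> borel_measurable lebesgue" and w: "Y w \<le> 1" by auto
      have "(\<integral>\<^sup>+x. ennreal \<bar>g x / c1 * w x\<bar> \<partial>lebesgue) = (\<integral>\<^sup>+x. ennreal (1 / c1) * ennreal \<bar>g x * w x\<bar> \<partial>lebesgue)"
        using c1 by (intro nn_integral_cong) (auto simp: abs_mult simp flip: ennreal_mult)
      also have "\<dots> = ennreal (1 / c1) * (\<integral>\<^sup>+x. ennreal \<bar>g x * w x\<bar> \<partial>lebesgue)"
        by (rule nn_integral_cmult) measurable
      also have "\<dots> \<le> ennreal (1 / c1) * ennreal c"
        by (intro mult_left_mono dual_g w) auto
      also have "\<dots> \<le> 1"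
        using c1 c_nonneg by (simp flip: ennreal_mult)
      finally show "(\<integral>\<^sup>+x. ennreal \<bar>g x / c1 * w x\<bar> \<partial>lebesgue) \<le> 1" .
    qed
    then have *: "(\<integral>\<^sup>+x. ennreal \<bar>h x * (g x / c1)\<bar> \<partial>lebesgue) \<le> 1"
      by (intro dual) auto
    have h_bound: "\<bar>h x\<bar> \<le> N * indicator ?B x" for x
      using nonneg[of x] bound[of x] by simp
    have int_hg: "integrable lebesgue (\<lambda>x. h x * g x)"
      by (intro prod_integrable[where C = N and D = N] h_bound g_bound) auto
    have "(\<integral>\<^sup>+x. ennreal \<bar>h x * (g x / c1)\<bar> \<partial>lebesgue) = ennreal (\<integral>x. h x * g x / c1 \<partial>lebesgue)"
      using nonneg g_nonneg c1 int_hg by (subst nn_integral_eq_integral[symmetric]) auto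
    with * have "(\<integral>x. h x * g x \<partial>lebesgue) \<le> c1"
      using c1 by simp
    moreover have "(\<integral>x. h x * g x \<partial>lebesgue) = c + J v"
    proof -
      have "integrable lebesgue (\<lambda>x. g x * v x)"
        by (intro prod_integrable[where C = N and D = N] g_bound v_bound) auto
      then have "c + J v = (\<integral>x. g x * v x + (h x - v x)\<^sup>2 \<partial>lebesgue)"
        unfolding c_def J_def using sq_int[OF vS] by simp
      also have "\<dots> = (\<integral>x. h x * g x \<partial>lebesgue)"
        by (intro Bochner_Integration.integral_cong) (auto simp: g_def power2_eq_square algebra_simps)
      finally show ?thesis by simp
    qed
    ultimately show False
      using J_pos by (simp add: c1_def)
  qed
  then have "AE x in lebesgue. (h x - v x)\<^sup>2 = 0"
    unfolding J_def using sq_int[OF vS] by (subst (asm) integral_nonneg_eq_0_iff_AE) auto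
  then have "Y h \<le> Y v"
    by (intro mono_abs) (auto elim!: eventually_mono)
  with Yv show ?thesis by simp
qed

text \<open>
  By the Fatou property and homogeneity it suffices to treat the truncations of \<open>h\<close>, and these
  inherit the bound on the pairings.
\<close>

lemma Lorentz_Luxemburg:
  assumes h [measurable]: "h \<in> borel_measurable lebesgue" and c: "0 < c"
    and dual: "\<And>g. g \<in> borel_measurable lebesgue \<Longrightarrow> associate_norm Y g \<le> 1 \<Longrightarrow>
      (\<integral>\<^sup>+x. ennreal \<bar>h x * g x\<bar> \<partial>lebesgue) \<le> ennreal c"
  shows "Y h \<le> ennreal c"
proof -
  define hk where "hk k x = min (\<bar>h x\<bar> / c) (real k) * indicator (ball 0 (real k)) x" for k x
  have [measurable]: "ball (0::'a) r \<in> sets lebesgue" for r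
    by simp
  have [measurable]: "hk k \<in> borel_measurable lebesgue" for k
    unfolding hk_def by measurable
  have "Y (hk k) \<le> 1" for k
  proof (rule le_1_if_dual_le_1_bounded)
    show "hk k x \<le> real k * indicator (ball 0 (real k)) x" for x
      by (auto simp: hk_def indicator_def)
    show "0 \<le> hk k x" for x
      using c by (auto simp: hk_def)
    fix g assume [measurable]: "g \<in> borel_measurable lebesgue" and g: "associate_norm Y g \<le> 1"
    have "(\<integral>\<^sup>+x. ennreal \<bar>hk k x * g x\<bar> \<partial>lebesgue) \<le> (\<integral>\<^sup>+x. ennreal (1 / c) * ennreal \<bar>h x * g x\<bar> \<partial>lebesgue)"
    proof (rule nn_integral_mono)
      fix x
      have "\<bar>hk k x\<bar> \<le> \<bar>h x\<bar> / c"
        using c by (auto simp: hk_def indicator_def)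
      then have "\<bar>hk k x\<bar> * \<bar>g x\<bar> \<le> \<bar>h x\<bar> / c * \<bar>g x\<bar>"
        by (rule mult_right_mono) auto
      then show "ennreal \<bar>hk k x * g x\<bar> \<le> ennreal (1 / c) * ennreal \<bar>h x * g x\<bar>"
        using c by (subst ennreal_mult[symmetric]) (auto simp: abs_mult intro!: ennreal_leI)
    qed
    also have "\<dots> = ennreal (1 / c) * (\<integral>\<^sup>+x. ennreal \<bar>h x * g x\<bar> \<partial>lebesgue)"
      by (rule nn_integral_cmult) measurable
    also have "\<dots> \<le> ennreal (1 / c) * ennreal c"
      by (intro mult_left_mono dual g) auto
    also have "\<dots> = 1"
      using c by (simp flip: ennreal_mult)
    finally show "(\<integral>\<^sup>+x. ennreal \<bar>hk k x * g x\<bar> \<partial>lebesgue) \<le> 1" .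
  qed auto
  moreover have "Y (\<lambda>x. \<bar>h x\<bar> / c) = (SUP k. Y (hk k))"
  proof (rule fatou_SUP)
    show "AE x in lebesgue. (\<forall>k. 0 \<le> hk k x \<and> hk k x \<le> hk (Suc k) x) \<and> (\<lambda>k. hk k x) \<longlonglongrightarrow> \<bar>h x\<bar> / c"
    proof (intro AE_I2 conjI allI)
      fix x k
      show "0 \<le> hk k x" using c by (auto simp: hk_def)
      show "hk k x \<le> hk (Suc k) x" using c by (auto simp: hk_def indicator_def min_def)
    next
      fix x
      obtain k0 :: nat where k0: "max (norm x + 1) (\<bar>h x\<bar> / c) \<le> real k0" using real_arch_simple by blast
      show "(\<lambda>k. hk k x) \<longlonglongrightarrow> \<bar>h x\<bar> / c"
        by (rule tendsto_eventually, rule eventually_sequentiallyI[of k0])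
          (use k0 in \<open>auto simp: hk_def indicator_def min_def\<close>)
    qed
  qed auto
  ultimately have "Y (\<lambda>x. \<bar>h x\<bar> / c) \<le> 1"
    by (auto intro: SUP_least)
  moreover have "Y h = ennreal \<bar>c\<bar> * Y (\<lambda>x. \<bar>h x\<bar> / c)"
    using c by (subst homogeneous[symmetric]) (auto intro!: cong_abs)
  ultimately show ?thesis
    using c mult_left_mono[of "Y (\<lambda>x. \<bar>h x\<bar> / c)" 1 "ennreal c"] by simp
qed

end

interpretation lebesgue: sigma_finite_measure "lebesgue :: 'a::euclidean_space measure"
  by (rule sigma_finite_lebesgue)

interpretation lebesgue_pair: pair_sigma_finite
    "lebesgue :: 'a::euclidean_space measure" "lebesgue :: 'b::euclidean_space measure"
  by unfold_locales

section \<open>Kernels that average over dyadic balls\<close>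

text \<open>
  For \<open>0 < t < 1\<close> this is the average of the normalized indicators of the balls
  \<open>B(x, 2), B(x, 4), B(x, 8), \<dots>\<close> with the probability weights \<open>(1 - t) t\<^sup>k\<close>. It is symmetric,
  has integral 1, is dominated by the maximal operator, and with \<open>t\<close> equal to 2 to the power
  \<open>- s q\<close> it dominates a multiple of the Gagliardo kernel off a neighbourhood of the diagonal.
\<close>

definition averaging_kernel :: "real \<Rightarrow> 'a::euclidean_space \<Rightarrow> 'a \<Rightarrow> ennreal"
  where "averaging_kernel t x y =
    (\<Sum>k. ennreal ((1 - t) * t ^ k / (measure lebesgue (ball (0::'a) 1) * (2 ^ Suc k) ^ DIM('a))) *
      indicator {z. dist x z < 2 ^ Suc k} y)"

lemma emeasure_ball_eq:
  fixes x :: "'a::euclidean_space"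
  assumes "0 \<le> r"
  shows "emeasure lebesgue (ball x r) = ennreal (measure lebesgue (ball (0::'a) 1) * r ^ DIM('a))"
proof -
  have "emeasure lebesgue (ball (0::'a) 1) = ennreal (measure lebesgue (ball (0::'a) 1))"
    using emeasure_lborel_ball_finite[of "0::'a" 1] by (intro emeasure_eq_ennreal_measure) auto
  with assms show ?thesis
    by (simp add: emeasure_lebesgue_ball_conv_unit_ball[OF assms] ennreal_mult mult.commute
        del: emeasure_completion)
qed

lemma unit_ball_pos: "0 < measure lebesgue (ball (0::'a::euclidean_space) 1)"
  using content_ball_pos[of 1 "0::'a"] by simp

lemma dist_measurable_lebesgue_pair [measurable]:
  "(\<lambda>p. dist (fst p) (snd p)) \<in> borel_measurable
     ((lebesgue :: 'a::euclidean_space measure) \<Otimes>\<^sub>M (lebesgue :: 'a measure))"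
proof -
  have id: "(\<lambda>x. x) \<in> (lebesgue :: 'a measure) \<rightarrow>\<^sub>M borel"
    using id_borel_measurable_lebesgue by (simp add: id_def)
  have [measurable]: "fst \<in> borel_measurable ((lebesgue :: 'a measure) \<Otimes>\<^sub>M (lebesgue :: 'a measure))"
    using measurable_compose[OF measurable_fst[of lebesgue lebesgue] id] by simp
  have [measurable]: "snd \<in> borel_measurable ((lebesgue :: 'a measure) \<Otimes>\<^sub>M (lebesgue :: 'a measure))"
    using measurable_compose[OF measurable_snd[of lebesgue lebesgue] id] by simp
  show ?thesis by measurable
qed

lemma dist_measurable_lebesgue [measurable]:
  "(\<lambda>y. dist x y) \<in> borel_measurable (lebesgue :: 'a::euclidean_space measure)"
  using measurable_compose[OF measurable_Pair1' dist_measurable_lebesgue_pair, of x] by simp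

lemma averaging_kernel_measurable_pair [measurable]:
  "(\<lambda>p. averaging_kernel t (fst p) (snd p)) \<in> borel_measurable
     ((lebesgue :: 'a::euclidean_space measure) \<Otimes>\<^sub>M lebesgue)"
  unfolding averaging_kernel_def indicator_def by measurable

lemma averaging_kernel_measurable [measurable]:
  "averaging_kernel t x \<in> borel_measurable (lebesgue :: 'a::euclidean_space measure)"
  using measurable_compose[OF measurable_Pair1' averaging_kernel_measurable_pair, of x t] by simp

lemma averaging_kernel_commute: "averaging_kernel t x y = averaging_kernel t y x"
  by (simp add: averaging_kernel_def indicator_def dist_commute)

lemma averaging_kernel_integral_measurable [measurable]:
  assumes [measurable]: "g \<in> borel_measurable (lebesgue :: 'a::euclidean_space measure)"
  shows "(\<lambda>x. \<integral>\<^sup>+y. averaging_kernel t x y * g y \<partial>lebesgue) \<in> borel_measurable lebesgue"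
proof -
  have "(\<lambda>(x, y). averaging_kernel t x y * g y) \<in> borel_measurable (lebesgue \<Otimes>\<^sub>M lebesgue)"
    unfolding split_beta by measurable
  then show ?thesis
    by (rule lebesgue.borel_measurable_nn_integral)
qed

lemma integral_averaging_kernel:
  assumes [measurable]: "g \<in> borel_measurable (lebesgue :: 'a::euclidean_space measure)"
    and t: "0 < t" "t < 1"
  shows "(\<integral>\<^sup>+y. averaging_kernel t x y * g y \<partial>lebesgue) =
    (\<Sum>k. ennreal ((1 - t) * t ^ k) *
      ((\<integral>\<^sup>+y\<in>ball x (2 ^ Suc k). g y \<partial>lebesgue) / emeasure lebesgue (ball x (2 ^ Suc k))))"
proof -
  let ?V = "measure lebesgue (ball (0::'a) 1)"
  let ?c = "\<lambda>k. (1 - t) * t ^ k" and ?m = "\<lambda>k::nat. ?V * (2 ^ Suc k) ^ DIM('a)"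
  have m: "0 < ?m k" for k
    using unit_ball_pos[where 'a='a] by simp
  have [measurable]: "ball x r \<in> sets lebesgue" for r :: real
    by simp
  have "(\<integral>\<^sup>+y. averaging_kernel t x y * g y \<partial>lebesgue) =
    (\<integral>\<^sup>+y. (\<Sum>k. ennreal (?c k / ?m k) * (g y * indicator (ball x (2 ^ Suc k)) y)) \<partial>lebesgue)"
    unfolding averaging_kernel_def
    by (intro nn_integral_cong) (simp add: ball_def mult_ac del: power_Suc flip: ennreal_suminf_multc)
  also have "\<dots> = (\<Sum>k. ennreal (?c k / ?m k) * (\<integral>\<^sup>+y\<in>ball x (2 ^ Suc k). g y \<partial>lebesgue))"
    by (subst nn_integral_suminf) (auto simp: nn_integral_cmult)
  also have "\<dots> = (\<Sum>k. ennreal (?c k) *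
      ((\<integral>\<^sup>+y\<in>ball x (2 ^ Suc k). g y \<partial>lebesgue) / emeasure lebesgue (ball x (2 ^ Suc k))))"
  proof (intro suminf_cong)
    fix k
    have "emeasure lebesgue (ball x (2 ^ Suc k)) = ennreal (?m k)"
      by (rule emeasure_ball_eq) auto
    moreover have "ennreal (?c k / ?m k) = ennreal (?c k) / ennreal (?m k)"
      using m[of k] t by (intro divide_ennreal[symmetric]) auto
    ultimately show "ennreal (?c k / ?m k) * (\<integral>\<^sup>+y\<in>ball x (2 ^ Suc k). g y \<partial>lebesgue) = ennreal (?c k) *
      ((\<integral>\<^sup>+y\<in>ball x (2 ^ Suc k). g y \<partial>lebesgue) / emeasure lebesgue (ball x (2 ^ Suc k)))"
      by (simp add: ennreal_divide_times del: power_Suc emeasure_completion)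
  qed
  finally show ?thesis .
qed

lemma geometric_weights:
  assumes "0 < t" "t < (1::real)"
  shows "(\<Sum>k. ennreal ((1 - t) * t ^ k)) = 1"
proof -
  have "(\<lambda>k. (1 - t) * t ^ k) sums ((1 - t) * (1 / (1 - t)))"
    using assms by (intro sums_mult geometric_sums) auto
  then have "(\<lambda>k. ennreal ((1 - t) * t ^ k)) sums ennreal 1"
    using assms by (subst sums_ennreal) auto
  then show ?thesis
    by (simp add: sums_iff)
qed

lemma averaging_kernel_le_maximal_function:
  assumes "f \<in> borel_measurable (lebesgue :: 'a::euclidean_space measure)" and t: "0 < t" "t < 1"
  shows "(\<integral>\<^sup>+y. averaging_kernel t x y * ennreal \<bar>f y\<bar> \<partial>lebesgue) \<le> maximal_function f x"
proof -
  have [measurable]: "f \<in> borel_measurable lebesgue" by fact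
  have "(\<integral>\<^sup>+y. averaging_kernel t x y * ennreal \<bar>f y\<bar> \<partial>lebesgue) =
    (\<Sum>k. ennreal ((1 - t) * t ^ k) *
      ((\<integral>\<^sup>+y\<in>ball x (2 ^ Suc k). ennreal \<bar>f y\<bar> \<partial>lebesgue) / emeasure lebesgue (ball x (2 ^ Suc k))))"
    by (rule integral_averaging_kernel[OF _ t]) measurable
  also have "\<dots> \<le> (\<Sum>k. ennreal ((1 - t) * t ^ k) * maximal_function f x)"
  proof (intro suminf_le mult_left_mono)
    fix k
    show "(\<integral>\<^sup>+y\<in>ball x (2 ^ Suc k). ennreal \<bar>f y\<bar> \<partial>lebesgue) / emeasure lebesgue (ball x (2 ^ Suc k))
        \<le> maximal_function f x"
      unfolding maximal_function_def by (rule SUP_upper2[of "(x, 2 ^ Suc k)"]) auto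
  qed auto
  also have "\<dots> = maximal_function f x"
    by (simp only: ennreal_suminf_multc geometric_weights[OF t] mult_1)
  finally show ?thesis .
qed

lemma averaging_kernel_less_top:
  assumes t: "0 < t" "t < 1"
  shows "averaging_kernel t x (y::'a::euclidean_space) < top"
proof -
  let ?V = "measure lebesgue (ball (0::'a) 1)"
  have V: "0 < ?V" by (rule unit_ball_pos)
  have "averaging_kernel t x y \<le> (\<Sum>k. ennreal ((1 - t) * t ^ k) * ennreal (1 / ?V))"
    unfolding averaging_kernel_def
  proof (intro suminf_le)
    fix k
    have "(1 - t) * t ^ k / (?V * (2 ^ Suc k) ^ DIM('a)) \<le> (1 - t) * t ^ k / (?V * 1)"
      using V t by (intro divide_left_mono mult_left_mono one_le_power mult_pos_pos) auto
    then have "ennreal ((1 - t) * t ^ k / (?V * (2 ^ Suc k) ^ DIM('a)))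
        \<le> ennreal ((1 - t) * t ^ k) * ennreal (1 / ?V)"
      using V t by (subst ennreal_mult[symmetric]) (auto intro!: ennreal_leI)
    then show "ennreal ((1 - t) * t ^ k / (?V * (2 ^ Suc k) ^ DIM('a))) * indicator {z. dist x z < 2 ^ Suc k} y
        \<le> ennreal ((1 - t) * t ^ k) * ennreal (1 / ?V)"
      by (auto simp: indicator_def)
  qed auto
  also have "\<dots> = ennreal (1 / ?V)"
    by (simp only: ennreal_suminf_multc geometric_weights[OF t] mult_1)
  finally show ?thesis
    by (auto intro: le_less_trans)
qed

lemma integral_averaging_kernel_le_1:
  assumes t: "0 < t" "t < 1"
  shows "(\<integral>\<^sup>+y. averaging_kernel t x y \<partial>(lebesgue :: 'a::euclidean_space measure)) \<le> 1"
proof -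
  have "(\<integral>\<^sup>+y. averaging_kernel t x y * 1 \<partial>lebesgue) \<le> (\<Sum>k. ennreal ((1 - t) * t ^ k) * 1)"
    by (subst integral_averaging_kernel[OF _ t])
       (auto intro!: suminf_le mult_left_mono divide_le_posI_ennreal simp: emeasure_ball_eq
         unit_ball_pos simp del: emeasure_completion mult_1_right)
  then show ?thesis
    by (simp add: geometric_weights[OF t])
qed

lemma integral_averaging_kernel_duality:
  assumes [measurable]: "f \<in> borel_measurable lebesgue" "g \<in> borel_measurable (lebesgue :: 'a::euclidean_space measure)"
  shows "(\<integral>\<^sup>+x. (\<integral>\<^sup>+y. averaging_kernel t x y * f y \<partial>lebesgue) * g x \<partial>lebesgue) =
    (\<integral>\<^sup>+y. f y * (\<integral>\<^sup>+x. averaging_kernel t y x * g x \<partial>lebesgue) \<partial>lebesgue)"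
proof -
  have "(\<integral>\<^sup>+x. (\<integral>\<^sup>+y. averaging_kernel t x y * f y \<partial>lebesgue) * g x \<partial>lebesgue) =
     (\<integral>\<^sup>+x. (\<integral>\<^sup>+y. averaging_kernel t x y * f y * g x \<partial>lebesgue) \<partial>lebesgue)"
    by (intro nn_integral_cong nn_integral_multc[symmetric]) measurable
  also have "\<dots> = (\<integral>\<^sup>+y. (\<integral>\<^sup>+x. averaging_kernel t x y * f y * g x \<partial>lebesgue) \<partial>lebesgue)"
  proof (rule lebesgue_pair.Fubini'[symmetric])
    show "(\<lambda>(x, y). averaging_kernel t x y * f y * g x) \<in> borel_measurable (lebesgue \<Otimes>\<^sub>M lebesgue)"
      unfolding split_beta by measurable
  qed
  also have "\<dots> = (\<integral>\<^sup>+y. (\<integral>\<^sup>+x. f y * (averaging_kernel t y x * g x) \<partial>lebesgue) \<partial>lebesgue)"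
    by (simp add: averaging_kernel_commute[of t] mult_ac)
  also have "\<dots> = (\<integral>\<^sup>+y. f y * (\<integral>\<^sup>+x. averaging_kernel t y x * g x \<partial>lebesgue) \<partial>lebesgue)"
    by (intro nn_integral_cong nn_integral_cmult) measurable
  finally show ?thesis .
qed

section \<open>Averaging kernels on Banach function spaces\<close>

context ball_banach_function_space
begin

lemma Hoelder_associate_norm:
  assumes [measurable]: "f \<in> borel_measurable lebesgue" "g \<in> borel_measurable lebesgue"
    and fin: "Y f < \<infinity>"
  shows "(\<integral>\<^sup>+x. ennreal \<bar>f x * g x\<bar> \<partial>lebesgue) \<le> Y f * associate_norm Y g"
proof (cases "Y f = 0")
  case True
  then have "AE x in lebesgue. f x = 0"
    by (intro definite) auto
  then have "AE x in lebesgue. ennreal \<bar>f x * g x\<bar> = 0"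
    by eventually_elim simp
  then have "(\<integral>\<^sup>+x. ennreal \<bar>f x * g x\<bar> \<partial>lebesgue) = 0"
    by (subst nn_integral_0_iff_AE) auto
  then show ?thesis by simp
next
  case False
  with fin obtain a where a: "Y f = ennreal a" "0 < a"
    by (cases "Y f") (auto simp: less_le)
  have "Y (\<lambda>x. 1 / a * f x) = 1"
    using a by (subst homogeneous) (auto simp flip: ennreal_mult)
  then have "(\<integral>\<^sup>+x. ennreal \<bar>g x * (1 / a * f x)\<bar> \<partial>lebesgue) \<le> associate_norm Y g"
    unfolding associate_norm_def by (intro SUP_upper) auto
  then have "ennreal a * (\<integral>\<^sup>+x. ennreal \<bar>g x * (1 / a * f x)\<bar> \<partial>lebesgue) \<le> ennreal a * associate_norm Y g"
    by (intro mult_left_mono) auto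
  also have "ennreal a * (\<integral>\<^sup>+x. ennreal \<bar>g x * (1 / a * f x)\<bar> \<partial>lebesgue)
      = (\<integral>\<^sup>+x. ennreal a * ennreal \<bar>g x * (1 / a * f x)\<bar> \<partial>lebesgue)"
    by (rule nn_integral_cmult[symmetric]) measurable
  also have "\<dots> = (\<integral>\<^sup>+x. ennreal \<bar>f x * g x\<bar> \<partial>lebesgue)"
    using a by (intro nn_integral_cong) (auto simp: abs_mult mult_ac simp flip: ennreal_mult)
  finally show ?thesis using a by simp
qed

text \<open>
  By symmetry of the kernel, pairing the mean of \<open>u\<close> with \<open>g\<close> is pairing \<open>u\<close> with the mean of
  \<open>g\<close>, which is at most the maximal function of \<open>g\<close>. So boundedness of the maximal operator on
  the associate space gives boundedness of the means on the second associate space, which is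
  the space itself.
\<close>

lemma averaging_kernel_bounded:
  assumes [measurable]: "u \<in> borel_measurable lebesgue" "h \<in> borel_measurable lebesgue"
    and maximal: "\<And>g. g \<in> borel_measurable lebesgue \<Longrightarrow> associate_norm Y g \<le> 1 \<Longrightarrow>
      restrict_norm (associate_norm Y) UNIV (\<lambda>x. enn2ereal (maximal_function g x)) \<le> ennreal C"
    and C: "0 \<le> C" and t: "0 < t" "t < 1"
    and h_le: "\<And>x. ennreal \<bar>h x\<bar> \<le> (\<integral>\<^sup>+y. averaging_kernel t x y * ennreal \<bar>u y\<bar> \<partial>lebesgue)"
  shows "Y h \<le> ennreal (C + 1) * Y u"
proof (cases "Y u")
  case (real a)
  show ?thesis
  proof (rule ennreal_le_epsilon)
    fix e :: real assume e: "0 < e"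
    \<comment> \<open>The duality argument needs a positive bound, also when \<open>Y u = 0\<close>; hence the \<open>e\<close>. The constant
        is \<open>C + 1\<close> because the restricted norm is an infimum that may not be attained.\<close>
    have "Y h \<le> ennreal ((C + 1) * a + e)"
    proof (rule Lorentz_Luxemburg)
      show "0 < (C + 1) * a + e"
        using real C e by (intro add_nonneg_pos) auto
      fix g assume [measurable]: "g \<in> borel_measurable lebesgue" and g: "associate_norm Y g \<le> 1"
      have "restrict_norm (associate_norm Y) UNIV (\<lambda>x. enn2ereal (maximal_function g x)) < ennreal (C + 1)"
        using maximal[OF _ g] C by (auto intro: le_less_trans simp: ennreal_less_iff)
      then obtain k where k: "k \<in> fspace (associate_norm Y)" "associate_norm Y k < ennreal (C + 1)"
        "AE x in lebesgue. ereal (k x) = enn2ereal (maximal_function g x)"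
        unfolding restrict_norm_def by (auto simp: INF_less_iff)
      then have [measurable]: "k \<in> borel_measurable lebesgue"
        by (simp add: fspace_def)
      have "(\<integral>\<^sup>+x. ennreal \<bar>h x * g x\<bar> \<partial>lebesgue) \<le>
          (\<integral>\<^sup>+x. (\<integral>\<^sup>+y. averaging_kernel t x y * ennreal \<bar>u y\<bar> \<partial>lebesgue) * ennreal \<bar>g x\<bar> \<partial>lebesgue)"
        by (intro nn_integral_mono) (auto simp: abs_mult ennreal_mult intro!: mult_right_mono h_le)
      also have "\<dots> = (\<integral>\<^sup>+y. ennreal \<bar>u y\<bar> * (\<integral>\<^sup>+x. averaging_kernel t y x * ennreal \<bar>g x\<bar> \<partial>lebesgue) \<partial>lebesgue)"
        by (rule integral_averaging_kernel_duality) measurable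
      also have "\<dots> \<le> (\<integral>\<^sup>+y. ennreal \<bar>u y * k y\<bar> \<partial>lebesgue)"
      proof (rule nn_integral_mono_AE)
        show "AE y in lebesgue. ennreal \<bar>u y\<bar> * (\<integral>\<^sup>+x. averaging_kernel t y x * ennreal \<bar>g x\<bar> \<partial>lebesgue)
            \<le> ennreal \<bar>u y * k y\<bar>"
          using k(3)
        proof eventually_elim
          fix y assume k: "ereal (k y) = enn2ereal (maximal_function g y)"
          have "(\<integral>\<^sup>+x. averaging_kernel t y x * ennreal \<bar>g x\<bar> \<partial>lebesgue) \<le> maximal_function g y"
            by (rule averaging_kernel_le_maximal_function[OF _ t]) measurable
          also have "maximal_function g y = ennreal (k y)"
            using arg_cong[OF k, of e2ennreal] by simp
          also have "\<dots> \<le> ennreal \<bar>k y\<bar>"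
            by (intro ennreal_leI) auto
          finally show "ennreal \<bar>u y\<bar> * (\<integral>\<^sup>+x. averaging_kernel t y x * ennreal \<bar>g x\<bar> \<partial>lebesgue)
            \<le> ennreal \<bar>u y * k y\<bar>"
            by (auto simp: abs_mult ennreal_mult intro!: mult_left_mono)
        qed
      qed
      also have "\<dots> \<le> Y u * associate_norm Y k"
        using real by (intro Hoelder_associate_norm) auto
      also have "\<dots> \<le> ennreal a * ennreal (C + 1)"
        using k(2) real by (intro mult_mono) auto
      also have "\<dots> = ennreal ((C + 1) * a)"
        using real C by (subst ennreal_mult[symmetric]) (auto simp: mult.commute)
      also have "\<dots> \<le> ennreal ((C + 1) * a + e)"
        using e by (intro ennreal_leI) auto
      finally show "(\<integral>\<^sup>+x. ennreal \<bar>h x * g x\<bar> \<partial>lebesgue) \<le> ennreal ((C + 1) * a + e)" .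
    qed measurable
    also have "\<dots> = ennreal (C + 1) * Y u + ennreal e"
      using real C e by (subst ennreal_plus) (auto simp: ennreal_mult)
    finally show "Y h \<le> ennreal (C + 1) * Y u + ennreal e" .
  qed
next
  case top
  with C show ?thesis by (simp add: ennreal_mult_top)
qed

end

section \<open>Power means with respect to an averaging kernel\<close>

definition power_mean :: "real \<Rightarrow> real \<Rightarrow> ('a::euclidean_space \<Rightarrow> real) \<Rightarrow> 'a \<Rightarrow> ennreal"
  where "power_mean t p f x =
    ennreal_powr (\<integral>\<^sup>+y. averaging_kernel t x y * ennreal (\<bar>f y\<bar> powr p) \<partial>lebesgue) (1 / p)"

lemma power_mean_measurable [measurable]:
  assumes [measurable]: "f \<in> borel_measurable lebesgue"
  shows "power_mean t p f \<in> borel_measurable lebesgue"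
  unfolding power_mean_def by measurable

text \<open>
  The graph of \<open>u powr r\<close> lies above its tangent at \<open>a\<close>. Integrated against a subprobability
  kernel, this is Jensen's inequality.
\<close>

lemma tangent_powr_le:
  fixes a u r :: real
  assumes "1 \<le> r" "0 < a" "0 \<le> u"
  shows "r * a powr (r - 1) * u \<le> u powr r + (r - 1) * a powr r"
proof (cases "u = 0")
  case False
  with assms have u: "0 < u" by simp
  have "(u powr r) powr (1 / r) * (a powr r) powr (1 - 1 / r) \<le> 1 / r * u powr r + (1 - 1 / r) * a powr r"
    using assms u by (intro Youngs_inequality_0) auto
  moreover have "(u powr r) powr (1 / r) * (a powr r) powr (1 - 1 / r) = u * a powr (r - 1)"
    using assms u by (simp add: powr_powr right_diff_distrib)
  ultimately have "r * (u * a powr (r - 1)) \<le> r * (1 / r * u powr r + (1 - 1 / r) * a powr r)"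
    using assms by (intro mult_left_mono) auto
  also have "\<dots> = u powr r + (r - 1) * a powr r"
    using assms by (simp add: field_simps)
  finally show ?thesis by (simp add: mult_ac)
qed (use assms in simp)

lemma power_mean_mono_exponent:
  assumes [measurable]: "f \<in> borel_measurable lebesgue" and q: "0 < q" "q \<le> p" and t: "0 < t" "t < 1"
  shows "power_mean t q f x \<le> power_mean t p f x"
proof -
  let ?w = "averaging_kernel t x"
  define r where "r = p / q"
  have r: "1 \<le> r" "p = q * r"
    using q by (auto simp: r_def)
  define I where "I = (\<integral>\<^sup>+y. ?w y * ennreal (\<bar>f y\<bar> powr p) \<partial>lebesgue)"
  have w: "(\<integral>\<^sup>+y. ?w y \<partial>lebesgue) \<le> 1"
    by (rule integral_averaging_kernel_le_1[OF t])
  have main: "ennreal_powr (\<integral>\<^sup>+y. ?w y * ennreal (\<bar>f y\<bar> powr q) \<partial>lebesgue) r \<le> I"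
  proof (cases "\<integral>\<^sup>+y. ?w y * ennreal (\<bar>f y\<bar> powr q) \<partial>lebesgue")
    case top
    have "(\<integral>\<^sup>+y. ?w y * ennreal (\<bar>f y\<bar> powr q) \<partial>lebesgue)
        \<le> (\<integral>\<^sup>+y. ?w y + ?w y * ennreal (\<bar>f y\<bar> powr p) \<partial>lebesgue)"
    proof (rule nn_integral_mono)
      fix y
      have "\<bar>f y\<bar> powr q \<le> 1 + \<bar>f y\<bar> powr p"
      proof (cases "1 \<le> \<bar>f y\<bar>")
        case True
        then have "\<bar>f y\<bar> powr q \<le> \<bar>f y\<bar> powr p"
          using q by (intro powr_mono) auto
        then show ?thesis by simp
      next
        case False
        then have "\<bar>f y\<bar> powr q \<le> 1 powr q"
          using q by (intro powr_mono2) auto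
        then show ?thesis by (simp add: add_increasing2)
      qed
      then have "?w y * ennreal (\<bar>f y\<bar> powr q) \<le> ?w y * ennreal (1 + \<bar>f y\<bar> powr p)"
        by (intro mult_left_mono ennreal_leI) auto
      then show "?w y * ennreal (\<bar>f y\<bar> powr q) \<le> ?w y + ?w y * ennreal (\<bar>f y\<bar> powr p)"
        by (simp add: distrib_left)
    qed
    also have "\<dots> = (\<integral>\<^sup>+y. ?w y \<partial>lebesgue) + I"
      unfolding I_def by (rule nn_integral_add) measurable
    also have "\<dots> \<le> 1 + I"
      using w by (rule add_right_mono)
    finally show ?thesis
      using top by (simp add: top_unique)
  next
    case (real a)
    show ?thesis
    proof (cases "a = 0")
      case False
      with real have a: "0 < a" by simp
      \<comment> \<open>Integrate the tangent inequality at the point \<open>a\<close> that is the mean itself.\<close>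
      have "ennreal (r * a powr (r - 1)) * ennreal a
          = (\<integral>\<^sup>+y. ennreal (r * a powr (r - 1)) * (?w y * ennreal (\<bar>f y\<bar> powr q)) \<partial>lebesgue)"
        unfolding real(2)[symmetric] by (rule nn_integral_cmult[symmetric]) measurable
      also have "\<dots> \<le> (\<integral>\<^sup>+y. ?w y * ennreal (\<bar>f y\<bar> powr p) + ennreal ((r - 1) * a powr r) * ?w y \<partial>lebesgue)"
      proof (rule nn_integral_mono)
        fix y
        have "r * a powr (r - 1) * \<bar>f y\<bar> powr q \<le> \<bar>f y\<bar> powr p + (r - 1) * a powr r"
          using tangent_powr_le[of r a "\<bar>f y\<bar> powr q"] r a by (simp add: powr_powr)
        then have "?w y * ennreal (r * a powr (r - 1) * \<bar>f y\<bar> powr q)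
            \<le> ?w y * ennreal (\<bar>f y\<bar> powr p + (r - 1) * a powr r)"
          by (intro mult_left_mono ennreal_leI) auto
        then show "ennreal (r * a powr (r - 1)) * (?w y * ennreal (\<bar>f y\<bar> powr q))
          \<le> ?w y * ennreal (\<bar>f y\<bar> powr p) + ennreal ((r - 1) * a powr r) * ?w y"
          using r a by (simp add: ennreal_mult ennreal_plus distrib_left mult_ac)
      qed
      also have "\<dots> = I + ennreal ((r - 1) * a powr r) * (\<integral>\<^sup>+y. ?w y \<partial>lebesgue)"
        unfolding I_def by (subst nn_integral_add) (auto simp: nn_integral_cmult)
      also have "\<dots> \<le> I + ennreal ((r - 1) * a powr r) * 1"
        by (intro add_left_mono mult_left_mono w) auto
      finally have *: "ennreal (r * a powr (r - 1)) * ennreal a \<le> I + ennreal ((r - 1) * a powr r)"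
        by simp
      have "a powr (r - 1) * a = a powr r"
        using a by (simp add: powr_diff)
      with * have "ennreal (r * a powr r) \<le> I + ennreal ((r - 1) * a powr r)"
        using r a by (simp add: mult.assoc flip: ennreal_mult)
      then have "ennreal (a powr r) \<le> I"
      proof (cases I)
        case (real b)
        with * \<open>ennreal (r * a powr r) \<le> I + ennreal ((r - 1) * a powr r)\<close>
        have "ennreal (r * a powr r) \<le> ennreal (b + (r - 1) * a powr r)"
          using r by (subst ennreal_plus) auto
        then have "r * a powr r \<le> b + (r - 1) * a powr r"
          using real r by (subst (asm) ennreal_le_iff) auto
        with real show ?thesis
          by (simp add: algebra_simps)
      qed simp
      with real show ?thesis by simp
    qed (use real in simp)
  qed
  have "power_mean t q f x = ennreal_powr (ennreal_powr (\<integral>\<^sup>+y. ?w y * ennreal (\<bar>f y\<bar> powr q) \<partial>lebesgue) r) (1 / p)"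
    unfolding power_mean_def using q r by (simp add: ennreal_powr_powr)
  also have "\<dots> \<le> ennreal_powr I (1 / p)"
    using q by (intro ennreal_powr_mono main) auto
  finally show ?thesis
    by (simp add: power_mean_def I_def)
qed

lemma tendsto_ennreal_powr_exponent:
  assumes "p \<longlonglongrightarrow> a" "a > 0" "\<And>m::nat. 0 < p m"
  shows "(\<lambda>m. ennreal_powr y (p m)) \<longlonglongrightarrow> ennreal_powr y a"
proof (cases y)
  case (real r)
  show ?thesis
  proof (cases "r = 0")
    case False
    with real have "(\<lambda>m. r powr p m) \<longlonglongrightarrow> r powr a"
      using assms by (intro tendsto_powr) auto
    with real show ?thesis by simp
  qed (use real in simp)
qed simp

text \<open>
  Fatou's lemma for integrands whose exponents converge. Testing the limit inferior with numbers
  \<open>y\<close> below the mean reduces it to the convergence of \<open>y powr p m\<close> to \<open>y powr a\<close>.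
\<close>

lemma power_mean_le_liminf:
  assumes [measurable]: "f \<in> borel_measurable lebesgue"
    and p: "p \<longlonglongrightarrow> a" "0 < a" "\<And>m::nat. 0 < p m"
    and t: "0 < t" "t < 1"
  shows "power_mean t a f x \<le> liminf (\<lambda>m. power_mean t (p m) f x)"
proof -
  define I where "I b = (\<integral>\<^sup>+y. averaging_kernel t x y * ennreal (\<bar>f y\<bar> powr b) \<partial>lebesgue)" for b
  have "I a = (\<integral>\<^sup>+y. liminf (\<lambda>m. averaging_kernel t x y * ennreal (\<bar>f y\<bar> powr p m)) \<partial>lebesgue)"
    unfolding I_def
  proof (rule nn_integral_cong)
    fix y
    have "(\<lambda>m. ennreal_powr (ennreal \<bar>f y\<bar>) (p m)) \<longlonglongrightarrow> ennreal_powr (ennreal \<bar>f y\<bar>) a"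
      by (rule tendsto_ennreal_powr_exponent[OF p])
    then have lim: "(\<lambda>m. ennreal (\<bar>f y\<bar> powr p m)) \<longlonglongrightarrow> ennreal (\<bar>f y\<bar> powr a)"
      by (simp only: ennreal_powr_ennreal abs_ge_zero)
    have "(\<lambda>m. averaging_kernel t x y * ennreal (\<bar>f y\<bar> powr p m)) \<longlonglongrightarrow>
        averaging_kernel t x y * ennreal (\<bar>f y\<bar> powr a)"
      by (intro ennreal_tendsto_cmult lim averaging_kernel_less_top[OF t])
    then show "averaging_kernel t x y * ennreal (\<bar>f y\<bar> powr a)
        = liminf (\<lambda>m. averaging_kernel t x y * ennreal (\<bar>f y\<bar> powr p m))"
      by (simp add: lim_imp_Liminf)
  qed
  also have "\<dots> \<le> liminf (\<lambda>m. I (p m))"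
    unfolding I_def by (rule nn_integral_liminf) measurable
  finally have fatou: "I a \<le> liminf (\<lambda>m. I (p m))" .
  show ?thesis
    unfolding le_Liminf_iff
  proof (intro allI impI)
    fix y assume "y < power_mean t a f x"
    then have "\<not> power_mean t a f x \<le> y"
      by (simp only: not_le)
    then have "\<not> I a \<le> ennreal_powr y a"
      using p(2) ennreal_powr_le_swap[of "1 / a" "I a" y] by (simp add: power_mean_def I_def)
    then obtain z where z: "ennreal_powr y a < z" "z < I a"
      using dense by (auto simp: not_le)
    have "eventually (\<lambda>m. ennreal_powr y (p m) < z) sequentially"
      using order_tendstoD(2)[OF tendsto_ennreal_powr_exponent[OF p, of y] z(1)] .
    moreover have "eventually (\<lambda>m. z < I (p m)) sequentially"
      using fatou z(2) by (auto simp: le_Liminf_iff)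
    ultimately show "eventually (\<lambda>m. y < power_mean t (p m) f x) sequentially"
    proof eventually_elim
      case (elim m)
      then have "\<not> I (p m) \<le> ennreal_powr y (p m)"
        by auto
      then have "\<not> power_mean t (p m) f x \<le> y"
        using p(3)[of m] ennreal_powr_le_swap[of "1 / p m" "I (p m)" y]
        by (simp add: power_mean_def I_def)
      then show ?case
        by (rule not_le_imp_less)
    qed
  qed
qed


text \<open>
  Passing from \<open>f\<close> to \<open>\<bar>f\<bar> powr p\<close> turns power means into linear means and \<open>Y\<close> into the norm
  \<open>power_norm Y (1 / p)\<close>, for which averaging kernels are bounded.
\<close>

lemma power_mean_bounded:
  assumes Y: "ball_quasi_banach_function_space Y" and p: "0 < p"
    and Z: "ball_banach_function_space (power_norm Y (1 / p))"
    and maximal: "\<And>g. g \<in> borel_measurable lebesgue \<Longrightarrow> associate_norm (power_norm Y (1 / p)) g \<le> 1 \<Longrightarrow>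
      restrict_norm (associate_norm (power_norm Y (1 / p))) UNIV (\<lambda>x. enn2ereal (maximal_function g x))
        \<le> ennreal C"
    and C: "0 \<le> C" and t: "0 < t" "t < 1" and F [measurable]: "F \<in> borel_measurable lebesgue"
  shows "extended_norm Y (power_mean t p F) \<le> ennreal ((C + 1) powr (1 / p)) * Y F"
  unfolding extended_norm_def
proof (rule SUP_least)
  fix n :: nat
  interpret Y: ball_quasi_banach_function_space Y by fact
  interpret Z: ball_banach_function_space "power_norm Y (1 / p)" by fact
  define h where "h x = enn2real (min (power_mean t p F x) (of_nat n))" for x
  have [measurable]: "h \<in> borel_measurable lebesgue"
    unfolding h_def by measurable
  have h_nonneg: "0 \<le> h x" for x
    by (simp add: h_def)
  have "power_norm Y (1 / p) (\<lambda>x. h x powr p) \<le> ennreal (C + 1) * power_norm Y (1 / p) (\<lambda>x. \<bar>F x\<bar> powr p)"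
  proof (rule Z.averaging_kernel_bounded[OF _ _ maximal C t])
    fix x
    have "ennreal (h x powr p) = ennreal_powr (ennreal (h x)) p"
      using h_nonneg by simp
    also have "\<dots> \<le> ennreal_powr (power_mean t p F x) p"
      using p by (intro ennreal_powr_mono) (auto simp: h_def)
    also have "\<dots> = (\<integral>\<^sup>+y. averaging_kernel t x y * ennreal (\<bar>F y\<bar> powr p) \<partial>lebesgue)"
      using p by (simp add: power_mean_def ennreal_powr_powr)
    finally show "ennreal \<bar>h x powr p\<bar> \<le> (\<integral>\<^sup>+y. averaging_kernel t x y * ennreal \<bar>\<bar>F y\<bar> powr p\<bar> \<partial>lebesgue)"
      by simp
  qed measurable
  moreover have "power_norm Y (1 / p) (\<lambda>x. h x powr p) = ennreal_powr (Y h) p"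
    using p h_nonneg by (simp add: power_norm_def powr_powr)
  moreover have "power_norm Y (1 / p) (\<lambda>x. \<bar>F x\<bar> powr p) = ennreal_powr (Y F) p"
  proof -
    have "Y (\<lambda>x. \<bar>F x\<bar>) = Y F"
      by (rule Y.cong_abs) auto
    with p show ?thesis by (simp add: power_norm_def powr_powr)
  qed
  ultimately have "Y h \<le> ennreal_powr (ennreal (C + 1) * ennreal_powr (Y F) p) (1 / p)"
    using p ennreal_powr_le_swap[of p "Y h"] by simp
  also have "\<dots> = ennreal ((C + 1) powr (1 / p)) * Y F"
    using p C ennreal_powr_mult[of "C + 1"] by (simp add: ennreal_powr_powr)
  finally show "Y (\<lambda>x. enn2real (min (power_mean t p F x) (of_nat n))) \<le> ennreal ((C + 1) powr (1 / p)) * Y F"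
    by (simp only: h_def[abs_def])
qed

text \<open>
  The constant must not depend on \<open>t\<close>, because \<open>t\<close> tends to 1 as \<open>s\<close> tends to 0. If the maximal
  operator is only controlled for the exponents \<open>p \<theta>\<^sub>m\<close>, the bounds for these exponents are
  uniform in \<open>m\<close> and pass to the limit \<open>p\<close> by Fatou's lemma. The exponent \<open>q \<le> p\<close> is then covered
  because power means increase with the exponent.
\<close>

lemma power_mean_bounded_uniformly:
  assumes q: "0 < q" "q \<le> p" and Y: "ball_quasi_banach_function_space Y"
    and Z: "ball_banach_function_space (power_norm Y (1 / p))"
    and maximal: "maximal_bounded (associate_norm (power_norm Y (1 / p))) \<or>
      (\<exists>\<theta>::nat \<Rightarrow> real.
         (\<forall>m. 0 < \<theta> m \<and> \<theta> m < 1) \<and> \<theta> \<longlonglongrightarrow> 1 \<and>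
         (\<forall>m. ball_banach_function_space (power_norm Y (1 / (p * \<theta> m))) \<and>
              maximal_bounded (associate_norm (power_norm Y (1 / (p * \<theta> m))))) \<and>
         (\<exists>L<\<infinity>. (\<lambda>m. maximal_operator_norm (associate_norm (power_norm Y (1 / (p * \<theta> m)))))
            \<longlonglongrightarrow> L))"
  obtains A where "0 < A" "\<And>t F. 0 < t \<Longrightarrow> t < 1 \<Longrightarrow> F \<in> borel_measurable lebesgue \<Longrightarrow>
    extended_norm Y (power_mean t q F) \<le> ennreal A * Y F"
proof -
  interpret Y: ball_quasi_banach_function_space Y by fact
  have p: "0 < p" using q by simp
  have "\<exists>A>0. \<forall>t F. 0 < t \<longrightarrow> t < 1 \<longrightarrow> F \<in> borel_measurable lebesgue \<longrightarrow>
    extended_norm Y (power_mean t p F) \<le> ennreal A * Y F"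
    using maximal
  proof (elim disjE exE conjE)
    assume "maximal_bounded (associate_norm (power_norm Y (1 / p)))"
    then obtain C where C: "0 < C" "\<And>f. f \<in> fspace (associate_norm (power_norm Y (1 / p))) \<Longrightarrow>
       restrict_norm (associate_norm (power_norm Y (1 / p))) UNIV (\<lambda>x. enn2ereal (maximal_function f x))
         \<le> ennreal C * associate_norm (power_norm Y (1 / p)) f"
      unfolding maximal_bounded_def by blast
    have "restrict_norm (associate_norm (power_norm Y (1 / p))) UNIV (\<lambda>x. enn2ereal (maximal_function g x))
        \<le> ennreal C"
      if g: "g \<in> borel_measurable lebesgue" "associate_norm (power_norm Y (1 / p)) g \<le> 1" for g
    proof -
      have "g \<in> fspace (associate_norm (power_norm Y (1 / p)))"
        using g by (auto simp: fspace_def intro: le_less_trans)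
      then have "restrict_norm (associate_norm (power_norm Y (1 / p))) UNIV (\<lambda>x. enn2ereal (maximal_function g x))
         \<le> ennreal C * associate_norm (power_norm Y (1 / p)) g"
        by (rule C)
      also have "\<dots> \<le> ennreal C * 1"
        using g by (intro mult_left_mono) auto
      finally show ?thesis by simp
    qed
    then show ?thesis
      using power_mean_bounded[OF Y p Z, of C] C(1)
      by (intro exI[of _ "(C + 1) powr (1 / p)"]) auto
  next
    fix \<theta> :: "nat \<Rightarrow> real" and L
    assume \<theta>: "\<forall>m. 0 < \<theta> m \<and> \<theta> m < 1" "\<theta> \<longlonglongrightarrow> 1"
      and Zm: "\<forall>m. ball_banach_function_space (power_norm Y (1 / (p * \<theta> m))) \<and>
              maximal_bounded (associate_norm (power_norm Y (1 / (p * \<theta> m))))"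
      and L: "L < \<infinity>" "(\<lambda>m. maximal_operator_norm (associate_norm (power_norm Y (1 / (p * \<theta> m))))) \<longlonglongrightarrow> L"
    obtain l where l: "L = ennreal l" "0 \<le> l"
      using L(1) by (cases L) auto
    have "L < ennreal (l + 1)"
      using l by (simp add: ennreal_less_iff)
    then have "\<forall>\<^sub>F m in sequentially. maximal_operator_norm (associate_norm (power_norm Y (1 / (p * \<theta> m)))) < ennreal (l + 1)"
      using L(2) by (rule order_tendstoD(2)[rotated])
    moreover have "\<forall>\<^sub>F m in sequentially. 1 / 2 < \<theta> m"
      using \<theta>(2) by (rule order_tendstoD(1)) auto
    ultimately have "\<forall>\<^sub>F m in sequentially. 1 / 2 < \<theta> m \<and>
        maximal_operator_norm (associate_norm (power_norm Y (1 / (p * \<theta> m)))) < ennreal (l + 1)"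
      by eventually_elim auto
    then obtain M where M: "\<And>m. M \<le> m \<Longrightarrow> 1 / 2 < \<theta> m"
        "\<And>m. M \<le> m \<Longrightarrow> maximal_operator_norm (associate_norm (power_norm Y (1 / (p * \<theta> m)))) < ennreal (l + 1)"
      by (auto simp: eventually_sequentially)
    have bound: "extended_norm Y (power_mean t (p * \<theta> m) F) \<le> ennreal ((l + 2) powr (2 / p)) * Y F"
      if "M \<le> m" "0 < t" "t < 1" "F \<in> borel_measurable lebesgue" for m t F
    proof -
      have "extended_norm Y (power_mean t (p * \<theta> m) F) \<le> ennreal (((l + 1) + 1) powr (1 / (p * \<theta> m))) * Y F"
      proof (rule power_mean_bounded)
        fix g assume g: "g \<in> borel_measurable lebesgue" "associate_norm (power_norm Y (1 / (p * \<theta> m))) g \<le> 1"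
        have "restrict_norm (associate_norm (power_norm Y (1 / (p * \<theta> m)))) UNIV (\<lambda>x. enn2ereal (maximal_function g x))
            \<le> maximal_operator_norm (associate_norm (power_norm Y (1 / (p * \<theta> m))))"
          unfolding maximal_operator_norm_def using g by (intro SUP_upper) auto
        also have "\<dots> \<le> ennreal (l + 1)"
          using M(2)[OF that(1)] by simp
        finally show "restrict_norm (associate_norm (power_norm Y (1 / (p * \<theta> m)))) UNIV (\<lambda>x. enn2ereal (maximal_function g x))
            \<le> ennreal (l + 1)" .
      qed (use that Y Zm p \<theta> l in auto)
      also have "\<dots> \<le> ennreal ((l + 2) powr (2 / p)) * Y F"
      proof (intro mult_right_mono ennreal_leI)
        have "1 / (p * \<theta> m) \<le> 2 / p"
          using M(1)[OF that(1)] p by (simp add: field_simps)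
        then have "(l + 2) powr (1 / (p * \<theta> m)) \<le> (l + 2) powr (2 / p)"
          using l by (intro powr_mono) auto
        then show "(l + 1 + 1) powr (1 / (p * \<theta> m)) \<le> (l + 2) powr (2 / p)"
          by (simp add: add.assoc)
      qed auto
      finally show ?thesis .
    qed
    have "extended_norm Y (power_mean t p F) \<le> ennreal ((l + 2) powr (2 / p)) * Y F"
      if t: "0 < t" "t < 1" and [measurable]: "F \<in> borel_measurable lebesgue" for t F
    proof -
      have p_lim: "(\<lambda>m. p * \<theta> m) \<longlonglongrightarrow> p"
        using tendsto_mult_left[OF \<theta>(2), of p] by simp
      have "extended_norm Y (power_mean t p F)
          \<le> extended_norm Y (\<lambda>x. liminf (\<lambda>m. power_mean t (p * \<theta> m) F x))"
        using p \<theta>(1) by (intro Y.extended_norm_mono AE_I2 power_mean_le_liminf[OF _ p_lim _ _ t]) auto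
      also have "\<dots> \<le> liminf (\<lambda>m. extended_norm Y (power_mean t (p * \<theta> m) F))"
        by (rule Y.extended_norm_liminf_le) measurable
      also have "\<dots> \<le> ennreal ((l + 2) powr (2 / p)) * Y F"
        using bound t by (intro Liminf_le eventually_sequentiallyI[of M]) auto
      finally show ?thesis .
    qed
    moreover have "0 < (l + 2) powr (2 / p)"
      using l by simp
    ultimately show ?thesis by blast
  qed
  then obtain A where A: "0 < A" "\<And>t F. 0 < t \<Longrightarrow> t < 1 \<Longrightarrow> F \<in> borel_measurable lebesgue \<Longrightarrow>
    extended_norm Y (power_mean t p F) \<le> ennreal A * Y F"
    by blast
  have "extended_norm Y (power_mean t q F) \<le> ennreal A * Y F"
    if t: "0 < t" "t < 1" and [measurable]: "F \<in> borel_measurable lebesgue" for t F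
  proof -
    have "extended_norm Y (power_mean t q F) \<le> extended_norm Y (power_mean t p F)"
      using q t by (intro Y.extended_norm_mono AE_I2 power_mean_mono_exponent) auto
    also have "\<dots> \<le> ennreal A * Y F"
      using A(2) t by simp
    finally show ?thesis .
  qed
  with A(1) show ?thesis using that by blast
qed

section \<open>The Gagliardo kernel near and far from the diagonal\<close>

text \<open>
  The smallest of the dyadic balls around \<open>x\<close> that contains \<open>y\<close> already contributes enough. The
  factor \<open>s\<close> on the left matches the normalization \<open>1 - t\<close> of the weights, which is of the
  order of \<open>s\<close>.
\<close>

lemma powr_kernel_le_averaging_kernel:
  assumes q: "0 < q"
  obtains B where "0 < B" "\<And>s x (y::'a::euclidean_space). 0 < s \<Longrightarrow> s < 1 \<Longrightarrow> 1 \<le> dist x y \<Longrightarrow>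
    ennreal (s / dist x y powr (real DIM('a) + s * q)) \<le> ennreal B * averaging_kernel (2 powr (- (s * q))) x y"
proof -
  let ?n = "DIM('a)" and ?V = "measure lebesgue (ball (0::'a) 1)"
  define b where "b = 1 - 2 powr (- q)"
  have b: "0 < b"
    using q by (simp add: b_def powr_less_one)
  have V: "0 < ?V" by (rule unit_ball_pos)
  have "ennreal (s / dist x y powr (real ?n + s * q))
      \<le> ennreal (2 ^ ?n * ?V / b) * averaging_kernel (2 powr (- (s * q))) x y"
    if s: "0 < s" "s < 1" and d: "1 \<le> dist x y" for s and x y :: 'a
  proof -
    define t where "t = (2::real) powr (- (s * q))"
    have t: "0 < t" "t < 1"
      using s q by (auto simp: t_def powr_less_one)
    \<comment> \<open>Convexity of \<open>s \<mapsto> 2 powr (- q s)\<close> between 0 and 1.\<close>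
    have convex: "s * b \<le> 1 - t"
    proof -
      have "(2 powr (- q)) powr s * 1 powr (1 - s) \<le> s * 2 powr (- q) + (1 - s) * (1::real)"
        using s by (intro Youngs_inequality_0) auto
      then show ?thesis
        by (simp add: t_def b_def powr_powr algebra_simps)
    qed
    define k where "k = nat \<lfloor>log 2 (dist x y)\<rfloor>"
    have "x \<noteq> y"
      using d by auto
    then have "0 \<le> log 2 (dist x y)"
      using d by (simp add: zero_le_log_cancel_iff)
    then have k: "real k \<le> log 2 (dist x y)" "log 2 (dist x y) < real k + 1"
      unfolding k_def by linarith+
    have k1: "2 ^ k \<le> dist x y"
      using k(1) \<open>x \<noteq> y\<close> by (simp add: le_log_iff powr_realpow)
    have k2: "dist x y < 2 ^ Suc k"
      using k(2) \<open>x \<noteq> y\<close> by (simp add: log_less_iff powr_add powr_realpow mult.commute)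
    have "2 ^ (k * ?n) / t ^ k = (2 ^ k) powr (real ?n + s * q)"
      by (simp add: t_def powr_powr powr_add powr_minus powr_realpow[symmetric] field_simps
          flip: powr_realpow)
    also have "\<dots> \<le> dist x y powr (real ?n + s * q)"
      using k1 s q by (intro powr_mono2) auto
    finally have "s / dist x y powr (real ?n + s * q) \<le> s / (2 ^ (k * ?n) / t ^ k)"
      using s t d by (intro divide_left_mono mult_pos_pos) auto
    also have "\<dots> = s * t ^ k / 2 ^ (k * ?n)"
      by simp
    also have "\<dots> \<le> ((1 - t) / b) * t ^ k / 2 ^ (k * ?n)"
      using convex b t by (intro divide_right_mono mult_right_mono) (auto simp: field_simps)
    also have "\<dots> = (2 ^ ?n * ?V / b) * ((1 - t) * t ^ k / (?V * (2 ^ Suc k) ^ ?n))"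
      using V b by (simp add: power_mult_distrib power_mult field_simps)
    finally have *: "s / dist x y powr (real ?n + s * q)
        \<le> (2 ^ ?n * ?V / b) * ((1 - t) * t ^ k / (?V * (2 ^ Suc k) ^ ?n))" .
    have "ennreal ((1 - t) * t ^ k / (?V * (2 ^ Suc k) ^ ?n)) \<le> averaging_kernel t x y"
      using k2 sum_le_suminf[of "\<lambda>k. ennreal ((1 - t) * t ^ k / (?V * (2 ^ Suc k) ^ ?n)) * indicator {z. dist x z < 2 ^ Suc k} y" "{k}"]
      by (simp add: averaging_kernel_def del: power_Suc)
    then have kterm: "ennreal (2 ^ ?n * ?V / b) * ennreal ((1 - t) * t ^ k / (?V * (2 ^ Suc k) ^ ?n))
        \<le> ennreal (2 ^ ?n * ?V / b) * averaging_kernel t x y"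
      by (rule mult_left_mono) auto
    have ksplit: "ennreal (2 ^ ?n * ?V / b) * ennreal ((1 - t) * t ^ k / (?V * (2 ^ Suc k) ^ ?n))
        = ennreal ((2 ^ ?n * ?V / b) * ((1 - t) * t ^ k / (?V * (2 ^ Suc k) ^ ?n)))"
      using V b t by (intro ennreal_mult[symmetric]) auto
    have "ennreal (s / dist x y powr (real ?n + s * q))
        \<le> ennreal ((2 ^ ?n * ?V / b) * ((1 - t) * t ^ k / (?V * (2 ^ Suc k) ^ ?n)))"
      by (rule ennreal_leI[OF *])
    then show ?thesis
      unfolding ksplit[symmetric] t_def[symmetric] using kterm by (rule order_trans)
  qed
  then show ?thesis
    using V b that[of "2 ^ ?n * ?V / b"] by auto
qed

lemma eventually_volume_ge_if_WMD:
  fixes \<Omega> :: "'a::euclidean_space set"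
  assumes "WMD \<Omega>"
  obtains x0 C0 R where "0 < C0" "C0 \<le> 1" "1 \<le> R"
    "\<And>r. R \<le> r \<Longrightarrow> C0 / 2 * (measure lebesgue (ball (0::'a) 1) * r ^ DIM('a)) \<le> measure lebesgue (ball x0 r \<inter> \<Omega>)"
proof -
  let ?V = "measure lebesgue (ball (0::'a) 1)"
  from assms obtain x0 C0 where C0: "0 < C0" "C0 \<le> 1" and
    liminf: "ereal C0 \<le> Liminf at_top (\<lambda>r. ereal (measure lebesgue (ball x0 r \<inter> \<Omega>) / measure lebesgue (ball x0 r)))"
    unfolding WMD_def by auto
  have "ereal (C0 / 2) < ereal C0" using C0 by simp
  with liminf have "eventually (\<lambda>r. ereal (C0 / 2) < ereal (measure lebesgue (ball x0 r \<inter> \<Omega>) / measure lebesgue (ball x0 r))) at_top"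
    unfolding le_Liminf_iff by blast
  then obtain R where R: "\<And>r. R \<le> r \<Longrightarrow> C0 / 2 < measure lebesgue (ball x0 r \<inter> \<Omega>) / measure lebesgue (ball x0 r)"
    by (auto simp: eventually_at_top_linorder)
  have "C0 / 2 * (?V * r ^ DIM('a)) \<le> measure lebesgue (ball x0 r \<inter> \<Omega>)" if r: "max 1 R \<le> r" for r
  proof -
    have m: "measure lebesgue (ball x0 r) = ?V * r ^ DIM('a)"
      using r emeasure_ball_eq[of r x0] unit_ball_pos[where 'a='a] by (simp add: measure_def)
    have "0 < ?V * r ^ DIM('a)"
      using r unit_ball_pos[where 'a='a] by (intro mult_pos_pos) auto
    with R[of r] r show ?thesis
      unfolding m by (simp add: field_simps)
  qed
  with C0 show ?thesis
    using that[of C0 "max 1 R" x0] by simp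
qed

text \<open>
  On annuli with a sufficiently large ratio \<open>\<rho>\<close> of radii, the set \<open>\<Omega>\<close> has a fixed share of the
  volume: it fills at least the share \<open>C0 / 2\<close> of the outer ball, and the inner ball has at most half of
  that volume. Summing over the annuli gives a geometric series with ratio \<open>\<rho> powr (- s q)\<close>, whose
  sum is of the order of \<open>1 / s\<close>. The bound \<open>c\<close> does not depend on \<open>M\<close>; only the range
  of \<open>s\<close> does.
\<close>

lemma integral_powr_kernel_ge_if_WMD:
  fixes \<Omega> :: "'a::euclidean_space set"
  assumes q: "0 < q" and \<Omega>: "\<Omega> \<in> sets lebesgue" and WMD: "WMD \<Omega>"
  obtains x0 c R where "0 < c"
    "\<And>M. R \<le> M \<Longrightarrow> \<forall>\<^sub>F s in at_right 0.
      ennreal c \<le> (\<integral>\<^sup>+y\<in>{y \<in> \<Omega>. M \<le> dist x0 y}. ennreal (s / dist x0 y powr (real DIM('a) + s * q)) \<partial>lebesgue)"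
proof -
  let ?n = "DIM('a)" and ?V = "measure lebesgue (ball (0::'a) 1)"
  have V: "0 < ?V" by (rule unit_ball_pos)
  obtain x0 C0 R where C0: "0 < C0" "C0 \<le> 1" "1 \<le> R" and
    vol: "\<And>r. R \<le> r \<Longrightarrow> C0 / 2 * (?V * r ^ ?n) \<le> measure lebesgue (ball x0 r \<inter> \<Omega>)"
    by (rule eventually_volume_ge_if_WMD[OF WMD]) (rule that)
  define \<rho> where "\<rho> = 4 / C0"
  have \<rho>: "4 \<le> \<rho>"
    using C0 by (simp add: \<rho>_def field_simps)
  have ln\<rho>: "0 < ln \<rho>" using \<rho> by simp
  define c where "c = C0 * ?V / (8 * q * ln \<rho>)"
  have [measurable]: "\<Omega> \<in> sets lebesgue" by fact
  have ev: "\<forall>\<^sub>F s in at_right 0.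
      ennreal c \<le> (\<integral>\<^sup>+y\<in>{y \<in> \<Omega>. M \<le> dist x0 y}. ennreal (s / dist x0 y powr (real ?n + s * q)) \<partial>lebesgue)"
    if M: "R \<le> M" for M
  proof -
    have M1: "1 \<le> M" using M C0 by simp
    have \<rho>M: "1 < \<rho> * M"
      using mult_mono[of 4 \<rho> 1 M] \<rho> M1 by simp
    define A where "A k = {y \<in> \<Omega>. \<rho> ^ k * M \<le> dist x0 y \<and> dist x0 y < \<rho> ^ Suc k * M}" for k
    have [measurable]: "A k \<in> sets lebesgue" for k
    proof -
      have "A k = \<Omega> \<inter> {y \<in> space lebesgue. \<rho> ^ k * M \<le> dist x0 y \<and> dist x0 y < \<rho> ^ Suc k * M}"
        by (auto simp: A_def)
      also have "\<dots> \<in> sets lebesgue" by measurable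
      finally show ?thesis .
    qed
    have vol_A: "ennreal (C0 / 4 * (?V * (\<rho> ^ Suc k * M) ^ ?n)) \<le> emeasure lebesgue (A k)" for k
    proof -
      let ?r = "\<rho> ^ k * M" and ?r' = "\<rho> ^ Suc k * M"
      have "1 * M \<le> ?r'"
        using \<rho> M1 by (intro mult_right_mono one_le_power) auto
      then have "M \<le> ?r'"
        by (simp only: mult_1)
      with M have r: "R \<le> ?r'"
        by (rule order_trans)
      have r0: "0 \<le> ?r"
        using \<rho> M1 by simp
      have fin: "ball x0 ?r' \<inter> \<Omega> \<in> lmeasurable"
        by (intro fmeasurable_Int_fmeasurable) auto
      have "ennreal (C0 / 2 * (?V * ?r' ^ ?n)) \<le> ennreal (measure lebesgue (ball x0 ?r' \<inter> \<Omega>))"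
        by (intro ennreal_leI vol r)
      also have "\<dots> = emeasure lebesgue (ball x0 ?r' \<inter> \<Omega>)"
        using fin by (simp add: emeasure_eq_measure2)
      also have "\<dots> \<le> emeasure lebesgue (A k \<union> ball x0 ?r)"
      proof (rule emeasure_mono)
        show "ball x0 ?r' \<inter> \<Omega> \<subseteq> A k \<union> ball x0 ?r"
          unfolding A_def subset_iff Un_iff Int_iff mem_ball mem_Collect_eq by (meson not_less)
      qed auto
      also have "\<dots> \<le> emeasure lebesgue (A k) + emeasure lebesgue (ball x0 ?r)"
        by (intro emeasure_subadditive) auto
      also have "emeasure lebesgue (ball x0 ?r) = ennreal (?V * ?r ^ ?n)"
        by (intro emeasure_ball_eq r0)
      also have "ennreal (?V * ?r ^ ?n) \<le> ennreal (C0 / 4 * (?V * ?r' ^ ?n))"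
      proof (rule ennreal_leI)
        have "\<rho> \<le> \<rho> ^ ?n"
          using \<rho> by (intro self_le_power) auto
        then have "1 \<le> C0 / 4 * \<rho> ^ ?n"
          using C0 by (simp add: \<rho>_def field_simps)
        then have "?V * ?r ^ ?n * 1 \<le> ?V * ?r ^ ?n * (C0 / 4 * \<rho> ^ ?n)"
          using V r0 by (intro mult_left_mono) auto
        then show "?V * ?r ^ ?n \<le> C0 / 4 * (?V * ?r' ^ ?n)"
          by (simp add: power_mult_distrib mult_ac)
      qed
      finally have *: "ennreal (C0 / 2 * (?V * ?r' ^ ?n)) \<le> emeasure lebesgue (A k) + ennreal (C0 / 4 * (?V * ?r' ^ ?n))"
        by (blast intro: add_left_mono)
      have "0 \<le> ?r'"
        using \<rho> M1 by simp
      then have "0 \<le> ?r' ^ ?n"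
        by (rule zero_le_power)
      then have "0 \<le> C0 / 4 * (?V * ?r' ^ ?n)"
        using C0 V by (intro mult_nonneg_nonneg) (assumption | simp)+
      then have "ennreal (C0 / 4 * (?V * ?r' ^ ?n)) + ennreal (C0 / 4 * (?V * ?r' ^ ?n)) = ennreal (C0 / 2 * (?V * ?r' ^ ?n))"
        by (subst ennreal_plus[symmetric]) (assumption, rule arg_cong[of _ _ ennreal], simp)
      with * have "ennreal (C0 / 4 * (?V * ?r' ^ ?n)) + ennreal (C0 / 4 * (?V * ?r' ^ ?n))
          \<le> ennreal (C0 / 4 * (?V * ?r' ^ ?n)) + emeasure lebesgue (A k)"
        by (simp only: add.commute)
      then show ?thesis
        by (subst (asm) ennreal_add_left_cancel_le) auto
    qed
    have disj: "disjoint_family A"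
      unfolding disjoint_family_on_def
    proof (intro ballI impI)
      have *: "A i \<inter> A j = {}" if "i < j" for i j
      proof -
        have "\<rho> ^ Suc i * M \<le> \<rho> ^ j * M"
          using that \<rho> M1 by (intro mult_right_mono power_increasing) auto
        then show ?thesis
          unfolding A_def disjoint_iff mem_Collect_eq by (meson less_le_trans not_less)
      qed
      fix i j :: nat assume "i \<noteq> j"
      then show "A i \<inter> A j = {}"
        using *[of i j] *[of j i] by (cases i j rule: linorder_cases) auto
    qed
    have sub: "(\<Union>k. A k) \<subseteq> {y \<in> \<Omega>. M \<le> dist x0 y}"
    proof -
      have "M \<le> \<rho> ^ k * M" for k :: nat
        using mult_right_mono[of 1 "\<rho> ^ k" M] one_le_power[of \<rho> k] \<rho> M1 by simp
      then show ?thesis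
        unfolding A_def by (blast intro: order_trans)
    qed
    have est: "ennreal c \<le> (\<integral>\<^sup>+y\<in>{y \<in> \<Omega>. M \<le> dist x0 y}. ennreal (s / dist x0 y powr (real ?n + s * q)) \<partial>lebesgue)"
      if s: "0 < s" "s < ln 2 / (q * ln (\<rho> * M))" for s
    proof -
      define \<tau> where "\<tau> = \<rho> powr (- (s * q))"
      have \<tau>: "0 < \<tau>" "\<tau> < 1"
        using s q \<rho> by (auto simp: \<tau>_def powr_less_one)
      define \<mu> where "\<mu> = (\<rho> * M) powr (- (s * q))"
      \<comment> \<open>This is where \<open>s\<close> has to be small in terms of \<open>M\<close>.\<close>
      have \<mu>: "1 / 2 \<le> \<mu>"
      proof -
        have "s * (q * ln (\<rho> * M)) \<le> ln 2"
          using s q \<rho>M by (simp add: pos_less_divide_eq)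
        then have "- ln 2 \<le> - (s * q) * ln (\<rho> * M)"
          by (simp add: mult.assoc)
        then have "exp (- ln 2) \<le> \<mu>"
          using \<rho>M \<rho> M1 by (auto simp: \<mu>_def powr_def)
        then show ?thesis by (simp add: exp_minus inverse_eq_divide)
      qed
      have "c \<le> s * (C0 / 4 * ?V * \<mu> * (1 / (1 - \<tau>)))"
      proof -
        have "1 + - (s * q * ln \<rho>) \<le> \<tau>"
          using exp_ge_add_one_self[of "- (s * q * ln \<rho>)"] \<rho> by (simp add: \<tau>_def powr_def)
        then have "1 - \<tau> \<le> s * q * ln \<rho>" by simp
        then have "1 / (s * q * ln \<rho>) \<le> 1 / (1 - \<tau>)"
          using \<tau> s q ln\<rho> by (intro divide_left_mono mult_pos_pos) auto
        then have "s * (C0 / 4 * ?V * (1 / 2) * (1 / (s * q * ln \<rho>))) \<le> s * (C0 / 4 * ?V * \<mu> * (1 / (1 - \<tau>)))"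
          using s C0 V \<mu> q ln\<rho> by (intro mult_left_mono mult_mono) auto
        then show ?thesis
          using s q ln\<rho> by (simp add: c_def field_simps)
      qed
      then have "ennreal c \<le> ennreal (s * (C0 / 4 * ?V * \<mu> * (1 / (1 - \<tau>))))"
        by (rule ennreal_leI)
      also have "\<dots> = (\<Sum>k. ennreal (s * (C0 / 4 * ?V * \<mu> * \<tau> ^ k)))"
      proof -
        have "(\<lambda>k. s * (C0 / 4 * ?V * \<mu> * \<tau> ^ k)) sums (s * (C0 / 4 * ?V * \<mu> * (1 / (1 - \<tau>))))"
          using \<tau> by (intro sums_mult geometric_sums) auto
        then show ?thesis
          using s C0 V \<mu> \<tau> by (intro suminf_ennreal_eq[symmetric]) auto
      qed
      also have "\<dots> \<le> (\<Sum>k. \<integral>\<^sup>+y\<in>A k. ennreal (s / dist x0 y powr (real ?n + s * q)) \<partial>lebesgue)"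
      proof (intro suminf_le)
        fix k
        let ?r' = "\<rho> ^ Suc k * M"
        have r': "0 < ?r'" using \<rho> M1 by simp
        have pw: "?r' ^ ?n / ?r' powr (real ?n + s * q) = \<mu> * \<tau> ^ k"
        proof -
          have "?r' powr (real ?n + s * q) = ?r' ^ ?n * ?r' powr (s * q)"
            using r' by (simp add: powr_add powr_realpow)
          then have "?r' ^ ?n / ?r' powr (real ?n + s * q) = ?r' powr (- (s * q))"
            using r' by (simp add: powr_minus field_simps)
          also have "\<dots> = ((\<rho> * M) * \<rho> ^ k) powr (- (s * q))"
            by (simp add: mult_ac)
          also have "\<dots> = \<mu> * (\<rho> ^ k) powr (- (s * q))"
            unfolding \<mu>_def using \<rho> M1 by (intro powr_mult) 
          also have "(\<rho> ^ k) powr (- (s * q)) = \<tau> ^ k"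
            using \<rho> by (simp add: \<tau>_def powr_powr mult.commute flip: powr_realpow)
          finally show ?thesis .
        qed
        have "ennreal (s * (C0 / 4 * ?V * \<mu> * \<tau> ^ k))
            = ennreal (s / ?r' powr (real ?n + s * q)) * ennreal (C0 / 4 * (?V * ?r' ^ ?n))"
        proof -
          have "s * (C0 / 4 * ?V * \<mu> * \<tau> ^ k) = s * (C0 / 4 * ?V * (?r' ^ ?n / ?r' powr (real ?n + s * q)))"
            unfolding pw by (simp add: mult.assoc)
          also have "\<dots> = s / ?r' powr (real ?n + s * q) * (C0 / 4 * (?V * ?r' ^ ?n))"
            by simp
          finally show ?thesis
            using s C0 V r' by (simp only: ennreal_mult'[of "s / _"] divide_nonneg_nonneg less_imp_le powr_ge_zero)
        qed
        also have "\<dots> \<le> ennreal (s / ?r' powr (real ?n + s * q)) * emeasure lebesgue (A k)"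
          by (intro mult_left_mono vol_A) auto
        also have "\<dots> = (\<integral>\<^sup>+y\<in>A k. ennreal (s / ?r' powr (real ?n + s * q)) \<partial>lebesgue)"
          by (rule nn_integral_cmult_indicator[symmetric]) measurable
        also have "\<dots> \<le> (\<integral>\<^sup>+y\<in>A k. ennreal (s / dist x0 y powr (real ?n + s * q)) \<partial>lebesgue)"
        proof (rule nn_integral_mono)
          fix y
          have "s / ?r' powr (real ?n + s * q) \<le> s / dist x0 y powr (real ?n + s * q)" if "y \<in> A k"
          proof -
            have "0 < \<rho> ^ k * M" using \<rho> M1 by simp
            with that have d: "0 < dist x0 y" "dist x0 y \<le> ?r'"
              unfolding A_def by auto
            then have "dist x0 y powr (real ?n + s * q) \<le> ?r' powr (real ?n + s * q)"
              using s q by (intro powr_mono2) auto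
            with d r' s show ?thesis
              by (intro divide_left_mono mult_pos_pos) auto
          qed
          then show "ennreal (s / ?r' powr (real ?n + s * q)) * indicator (A k) y
              \<le> ennreal (s / dist x0 y powr (real ?n + s * q)) * indicator (A k) y"
            by (auto simp: indicator_def intro: ennreal_leI)
        qed
        finally show "ennreal (s * (C0 / 4 * ?V * \<mu> * \<tau> ^ k))
            \<le> (\<integral>\<^sup>+y\<in>A k. ennreal (s / dist x0 y powr (real ?n + s * q)) \<partial>lebesgue)" .
      qed auto
      also have "\<dots> = (\<integral>\<^sup>+y\<in>(\<Union>k. A k). ennreal (s / dist x0 y powr (real ?n + s * q)) \<partial>lebesgue)"
        by (rule nn_integral_disjoint_family[symmetric, OF _ _ disj]) measurable
      also have "\<dots> \<le> (\<integral>\<^sup>+y\<in>{y \<in> \<Omega>. M \<le> dist x0 y}. ennreal (s / dist x0 y powr (real ?n + s * q)) \<partial>lebesgue)"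
        using sub by (intro nn_integral_mono) (auto simp: indicator_def)
      finally show ?thesis .
    qed
    have "0 < ln 2 / (q * ln (\<rho> * M))"
      using q \<rho>M by simp
    then show ?thesis
      unfolding eventually_at_right_field using est by blast
  qed
  have "0 < c"
    using C0 V q ln\<rho> by (simp add: c_def)
  with ev show ?thesis using that by blast
qed

section \<open>Limits of Gagliardo seminorms\<close>

definition gagliardo_integral ::
    "'a::euclidean_space set \<Rightarrow> real \<Rightarrow> real \<Rightarrow> ('a \<Rightarrow> real) \<Rightarrow> 'a \<Rightarrow> ennreal"
  where "gagliardo_integral \<Omega> s q f x =
    (\<integral>\<^sup>+y\<in>\<Omega>. ennreal (\<bar>f x - f y\<bar> powr q / norm (x - y) powr (real DIM('a) + s * q)) \<partial>lebesgue)"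

text \<open>
  Vanishing off \<open>\<Omega>\<close>, this is the zero extension whose extended norm is the Gagliardo seminorm.
\<close>

definition gagliardo_function ::
    "'a::euclidean_space set \<Rightarrow> real \<Rightarrow> real \<Rightarrow> ('a \<Rightarrow> real) \<Rightarrow> 'a \<Rightarrow> ennreal"
  where "gagliardo_function \<Omega> s q f x =
    (if x \<in> \<Omega> then ennreal_powr (gagliardo_integral \<Omega> s q f x) (1 / q) else 0)"

lemma gagliardo_integral_measurable [measurable]:
  fixes \<Omega> :: "'a::euclidean_space set"
  assumes [measurable]: "f \<in> borel_measurable lebesgue" "\<Omega> \<in> sets lebesgue"
  shows "gagliardo_integral \<Omega> s q f \<in> borel_measurable lebesgue"
proof -
  have "(\<lambda>(x, y). ennreal (\<bar>f x - f y\<bar> powr q / dist x y powr (real DIM('a) + s * q)) * indicator \<Omega> y)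
      \<in> borel_measurable (lebesgue \<Otimes>\<^sub>M lebesgue)"
    unfolding split_beta by measurable
  from lebesgue.borel_measurable_nn_integral[OF this] show ?thesis
    unfolding gagliardo_integral_def[abs_def] dist_norm .
qed

lemma gagliardo_function_measurable [measurable]:
  assumes [measurable]: "f \<in> borel_measurable lebesgue" "\<Omega> \<in> sets lebesgue"
  shows "gagliardo_function \<Omega> s q f \<in> borel_measurable lebesgue"
  unfolding gagliardo_function_def[abs_def] by measurable

context ball_quasi_banach_function_space
begin

lemma extended_norm_cmult:
  assumes [measurable]: "F \<in> borel_measurable lebesgue" and c: "0 < c"
  shows "extended_norm Y (\<lambda>x. ennreal c * F x) = ennreal c * extended_norm Y F"
proof (rule antisym)
  have "extended_norm Y F = extended_norm Y (\<lambda>x. ennreal (1 / c) * (ennreal c * F x))"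
    using c by (simp add: mult.assoc[symmetric] flip: ennreal_mult)
  also have "\<dots> \<le> ennreal (1 / c) * extended_norm Y (\<lambda>x. ennreal c * F x)"
    using c by (intro extended_norm_cmult_le) auto
  finally have "ennreal c * extended_norm Y F \<le> ennreal c * (ennreal (1 / c) * extended_norm Y (\<lambda>x. ennreal c * F x))"
    by (rule mult_left_mono) auto
  then show "ennreal c * extended_norm Y F \<le> extended_norm Y (\<lambda>x. ennreal c * F x)"
    using c by (simp add: mult.assoc[symmetric] flip: ennreal_mult)
qed (rule extended_norm_cmult_le[OF assms])

lemma gagliardo_norm_eq_extended_norm:
  assumes [measurable]: "g \<in> borel_measurable lebesgue" "\<Omega> \<in> sets lebesgue"
    and eq: "\<And>x. x \<in> \<Omega> \<Longrightarrow> f x = g x"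
  shows "gagliardo_norm Y \<Omega> s q f = extended_norm Y (gagliardo_function \<Omega> s q g)"
proof -
  have "gagliardo_integral \<Omega> s q f x = gagliardo_integral \<Omega> s q g x" if "x \<in> \<Omega>" for x
    unfolding gagliardo_integral_def using that
    by (intro nn_integral_cong) (auto simp: eq indicator_def)
  then have "gagliardo_norm Y \<Omega> s q f = extended_norm Y (\<lambda>x. e2ennreal \<bar>enn2ereal (gagliardo_function \<Omega> s q g x)\<bar>)"
    unfolding gagliardo_norm_def
    by (intro restrict_norm_eq_extended_norm)
       (auto simp: gagliardo_function_def gagliardo_integral_def zero_ennreal.rep_eq)
  then show ?thesis by simp
qed

lemma restrict_norm_eq:
  assumes [measurable]: "g \<in> borel_measurable lebesgue"
    and "\<And>x. x \<in> \<Omega> \<Longrightarrow> g x = f x" "\<And>x. x \<notin> \<Omega> \<Longrightarrow> g x = 0"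
  shows "restrict_norm Y \<Omega> (\<lambda>x. ereal (f x)) = Y g"
proof -
  have "restrict_norm Y \<Omega> (\<lambda>x. ereal (f x)) = extended_norm Y (\<lambda>x. e2ennreal \<bar>ereal (g x)\<bar>)"
    using assms(2,3) by (intro restrict_norm_eq_extended_norm) auto
  then show ?thesis
    by (simp add: extended_norm_real)
qed

text \<open>
  Near the diagonal the kernel for \<open>s\<close> is below the kernel for \<open>s0\<close>, so this part is bounded in
  \<open>s\<close> and the factor \<open>s powr (1 / q)\<close> makes it vanish in the limit. Away from the diagonal
  \<open>\<bar>g x - g y\<bar>\<close> is split into \<open>\<bar>g x\<bar>\<close> and \<open>\<bar>g y\<bar>\<close>; the kernel integral of the first is
  of order \<open>1 / s\<close>, and that of the second is a power mean.
\<close>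

lemma Limsup_gagliardo_le:
  assumes q: "0 < q" and A: "0 < A" "\<And>t F. 0 < t \<Longrightarrow> t < 1 \<Longrightarrow> F \<in> borel_measurable lebesgue \<Longrightarrow>
    extended_norm Y (power_mean t q F) \<le> ennreal A * Y F"
  obtains C where "0 < C"
    "\<And>\<Omega> g s0. \<Omega> \<in> sets lebesgue \<Longrightarrow> g \<in> borel_measurable lebesgue \<Longrightarrow> 0 < s0 \<Longrightarrow> s0 < 1 \<Longrightarrow>
      extended_norm Y (gagliardo_function \<Omega> s0 q g) < \<infinity> \<Longrightarrow>
      Limsup (at_right 0) (\<lambda>s. ennreal (s powr (1 / q)) * extended_norm Y (gagliardo_function \<Omega> s q g))
        \<le> ennreal C * Y g"
proof -
  obtain B where B: "0 < B" "\<And>s x (y::'a). 0 < s \<Longrightarrow> s < 1 \<Longrightarrow> 1 \<le> dist x y \<Longrightarrow>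
      ennreal (s / dist x y powr (real DIM('a) + s * q)) \<le> ennreal B * averaging_kernel (2 powr (- (s * q))) x y"
    using powr_kernel_le_averaging_kernel[OF q, where 'a='a] by blast
  obtain K where K: "K \<ge> 1"
    "\<And>F G. F \<in> borel_measurable lebesgue \<Longrightarrow> G \<in> borel_measurable lebesgue \<Longrightarrow>
      extended_norm Y (\<lambda>x. F x + G x) \<le> ennreal K * (extended_norm Y F + extended_norm Y G)"
    using extended_norm_add_le by blast
  define a where "a = 2 powr (1 / q)"
  define D where "D = (B * 2 powr q) powr (1 / q) * a"
  define C where "C = a * K * (D * (K * (1 + A)))"
  have a: "0 < a" and D: "0 < D"
    using B by (auto simp: a_def D_def)
  then have C: "0 < C"
    using K A by (simp add: C_def)
  have "Limsup (at_right 0) (\<lambda>s. ennreal (s powr (1 / q)) * extended_norm Y (gagliardo_function \<Omega> s q g))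
        \<le> ennreal C * Y g"
    if [measurable]: "\<Omega> \<in> sets lebesgue" "g \<in> borel_measurable lebesgue" and s0: "0 < s0" "s0 < 1"
      and fin: "extended_norm Y (gagliardo_function \<Omega> s0 q g) < \<infinity>" for \<Omega> g s0
  proof -
    let ?N = "extended_norm Y (gagliardo_function \<Omega> s0 q g)"
    have bound: "ennreal (s powr (1 / q)) * extended_norm Y (gagliardo_function \<Omega> s q g)
        \<le> ennreal (a * K) * (ennreal (s powr (1 / q)) * ?N) + ennreal C * Y g"
      if s: "0 < s" "s < s0" for s
    proof -
      define t where "t = (2::real) powr (- (s * q))"
      have t: "0 < t" "t < 1"
        using s q by (auto simp: t_def powr_less_one)
      have pointwise: "ennreal s * ennreal (\<bar>g x - g y\<bar> powr q / norm (x - y) powr (real DIM('a) + s * q)) \<le>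
          ennreal s * ennreal (\<bar>g x - g y\<bar> powr q / norm (x - y) powr (real DIM('a) + s0 * q)) +
          ennreal (B * 2 powr q) * (averaging_kernel t x y * ennreal (\<bar>g x\<bar> powr q)
            + averaging_kernel t x y * ennreal (\<bar>g y\<bar> powr q))" for x y
      proof (cases "1 \<le> dist x y")
        case False
        have "\<bar>g x - g y\<bar> powr q / norm (x - y) powr (real DIM('a) + s * q)
            \<le> \<bar>g x - g y\<bar> powr q / norm (x - y) powr (real DIM('a) + s0 * q)"
        proof (cases "x = y")
          case ne: False
          have "norm (x - y) powr (real DIM('a) + s0 * q) \<le> norm (x - y) powr (real DIM('a) + s * q)"
            using False s s0 q by (intro powr_mono') (auto simp: dist_norm)
          with ne show ?thesis
            by (intro divide_left_mono mult_pos_pos) auto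
        qed simp
        then have "ennreal s * ennreal (\<bar>g x - g y\<bar> powr q / norm (x - y) powr (real DIM('a) + s * q)) \<le>
          ennreal s * ennreal (\<bar>g x - g y\<bar> powr q / norm (x - y) powr (real DIM('a) + s0 * q))"
          by (intro mult_left_mono ennreal_leI) auto
        then show ?thesis
          by (rule order_trans) simp
      next
        case True
        have tri: "\<bar>g x - g y\<bar> powr q \<le> 2 powr q * (\<bar>g x\<bar> powr q + \<bar>g y\<bar> powr q)"
          using abs_add_powr_le[OF q, of "g x" "- g y"] by simp
        have "ennreal s * ennreal (\<bar>g x - g y\<bar> powr q / norm (x - y) powr (real DIM('a) + s * q))
            = ennreal (s / dist x y powr (real DIM('a) + s * q)) * ennreal (\<bar>g x - g y\<bar> powr q)"
          using s by (subst (1 2) ennreal_mult[symmetric]) (auto simp: dist_norm)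
        also have "\<dots> \<le> (ennreal B * averaging_kernel t x y) * ennreal (2 powr q * (\<bar>g x\<bar> powr q + \<bar>g y\<bar> powr q))"
          unfolding t_def using s s0 True by (intro mult_mono B ennreal_leI tri) auto
        also have "\<dots> = ennreal (B * 2 powr q) * (averaging_kernel t x y * ennreal (\<bar>g x\<bar> powr q)
            + averaging_kernel t x y * ennreal (\<bar>g y\<bar> powr q))"
          using B by (simp add: ennreal_mult ennreal_plus distrib_left mult_ac)
        finally show ?thesis
          by (rule order_trans) simp
      qed
      have integral: "ennreal s * gagliardo_integral \<Omega> s q g x \<le> ennreal s * gagliardo_integral \<Omega> s0 q g x +
          ennreal (B * 2 powr q) * (ennreal (\<bar>g x\<bar> powr q)
            + (\<integral>\<^sup>+y. averaging_kernel t x y * ennreal (\<bar>g y\<bar> powr q) \<partial>lebesgue))" for x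
      proof -
        define I where "I s y = ennreal (\<bar>g x - g y\<bar> powr q / norm (x - y) powr (real DIM('a) + s * q)) * indicator \<Omega> y" for s y
        have [measurable]: "I s \<in> borel_measurable lebesgue" for s
          unfolding I_def dist_norm[symmetric] by measurable
        have I: "gagliardo_integral \<Omega> s q g x = (\<integral>\<^sup>+y. I s y \<partial>lebesgue)" for s
          unfolding gagliardo_integral_def I_def ..
        have "ennreal s * gagliardo_integral \<Omega> s q g x = (\<integral>\<^sup>+y. ennreal s * I s y \<partial>lebesgue)"
          unfolding I by (rule nn_integral_cmult[symmetric]) measurable
        also have "\<dots> \<le> (\<integral>\<^sup>+y. ennreal s * I s0 y + ennreal (B * 2 powr q) *
            (ennreal (\<bar>g x\<bar> powr q) * averaging_kernel t x y + averaging_kernel t x y * ennreal (\<bar>g y\<bar> powr q)) \<partial>lebesgue)"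
          using pointwise[of x] by (intro nn_integral_mono) (auto simp: I_def indicator_def mult.commute[of "ennreal (\<bar>g x\<bar> powr q)"])
        also have "\<dots> = ennreal s * gagliardo_integral \<Omega> s0 q g x + ennreal (B * 2 powr q) *
            (ennreal (\<bar>g x\<bar> powr q) * (\<integral>\<^sup>+y. averaging_kernel t x y \<partial>lebesgue)
              + (\<integral>\<^sup>+y. averaging_kernel t x y * ennreal (\<bar>g y\<bar> powr q) \<partial>lebesgue))"
          unfolding I by (simp add: nn_integral_add nn_integral_cmult)
        also have "\<dots> \<le> ennreal s * gagliardo_integral \<Omega> s0 q g x + ennreal (B * 2 powr q) *
            (ennreal (\<bar>g x\<bar> powr q) * 1
              + (\<integral>\<^sup>+y. averaging_kernel t x y * ennreal (\<bar>g y\<bar> powr q) \<partial>lebesgue))"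
          by (intro add_left_mono mult_left_mono add_right_mono integral_averaging_kernel_le_1 t) auto
        finally show ?thesis by simp
      qed
      have func: "ennreal (s powr (1 / q)) * gagliardo_function \<Omega> s q g x \<le> ennreal a *
          (ennreal (s powr (1 / q)) * gagliardo_function \<Omega> s0 q g x + ennreal D * (ennreal \<bar>g x\<bar> + power_mean t q g x))" for x
      proof (cases "x \<in> \<Omega>")
        case True
        have inv: "ennreal_powr (ennreal (\<bar>g x\<bar> powr q)) (1 / q) = ennreal \<bar>g x\<bar>"
          using q by (simp add: powr_powr)
        have "ennreal (s powr (1 / q)) * gagliardo_function \<Omega> s q g x
            = ennreal_powr (ennreal s * gagliardo_integral \<Omega> s q g x) (1 / q)"
          using True s by (simp add: gagliardo_function_def ennreal_powr_mult)
        also have "\<dots> \<le> ennreal_powr (ennreal s * gagliardo_integral \<Omega> s0 q g x +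
          ennreal (B * 2 powr q) * (ennreal (\<bar>g x\<bar> powr q)
            + (\<integral>\<^sup>+y. averaging_kernel t x y * ennreal (\<bar>g y\<bar> powr q) \<partial>lebesgue))) (1 / q)"
          using q by (intro ennreal_powr_mono integral) auto
        also have "\<dots> \<le> ennreal a * (ennreal_powr (ennreal s * gagliardo_integral \<Omega> s0 q g x) (1 / q) +
           ennreal_powr (ennreal (B * 2 powr q) * (ennreal (\<bar>g x\<bar> powr q)
            + (\<integral>\<^sup>+y. averaging_kernel t x y * ennreal (\<bar>g y\<bar> powr q) \<partial>lebesgue))) (1 / q))"
          unfolding a_def using q by (intro ennreal_powr_add_le) auto
        also have "ennreal_powr (ennreal s * gagliardo_integral \<Omega> s0 q g x) (1 / q)
            = ennreal (s powr (1 / q)) * gagliardo_function \<Omega> s0 q g x"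
          using True s by (simp add: gagliardo_function_def ennreal_powr_mult)
        also have "ennreal_powr (ennreal (B * 2 powr q) * (ennreal (\<bar>g x\<bar> powr q)
            + (\<integral>\<^sup>+y. averaging_kernel t x y * ennreal (\<bar>g y\<bar> powr q) \<partial>lebesgue))) (1 / q)
            = ennreal ((B * 2 powr q) powr (1 / q)) * ennreal_powr (ennreal (\<bar>g x\<bar> powr q)
            + (\<integral>\<^sup>+y. averaging_kernel t x y * ennreal (\<bar>g y\<bar> powr q) \<partial>lebesgue)) (1 / q)"
          using B by (intro ennreal_powr_mult) auto
        also have "ennreal_powr (ennreal (\<bar>g x\<bar> powr q)
            + (\<integral>\<^sup>+y. averaging_kernel t x y * ennreal (\<bar>g y\<bar> powr q) \<partial>lebesgue)) (1 / q)
            \<le> ennreal a * (ennreal \<bar>g x\<bar> + power_mean t q g x)"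
          unfolding a_def power_mean_def inv[symmetric] using q by (intro ennreal_powr_add_le) auto
        also have "ennreal ((B * 2 powr q) powr (1 / q)) * (ennreal a * (ennreal \<bar>g x\<bar> + power_mean t q g x))
            = ennreal D * (ennreal \<bar>g x\<bar> + power_mean t q g x)"
          using a by (simp add: D_def ennreal_mult mult.assoc)
        finally show ?thesis
          by (auto simp: mult_left_mono add_left_mono)
      qed (simp add: gagliardo_function_def)
      have "ennreal (s powr (1 / q)) * extended_norm Y (gagliardo_function \<Omega> s q g)
          = extended_norm Y (\<lambda>x. ennreal (s powr (1 / q)) * gagliardo_function \<Omega> s q g x)"
        using s by (subst extended_norm_cmult) auto
      also have "\<dots> \<le> extended_norm Y (\<lambda>x. ennreal a *
          (ennreal (s powr (1 / q)) * gagliardo_function \<Omega> s0 q g x + ennreal D * (ennreal \<bar>g x\<bar> + power_mean t q g x)))"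
        using func by (intro extended_norm_mono) auto
      also have "\<dots> = ennreal a * extended_norm Y (\<lambda>x.
          ennreal (s powr (1 / q)) * gagliardo_function \<Omega> s0 q g x + ennreal D * (ennreal \<bar>g x\<bar> + power_mean t q g x))"
        using a by (intro extended_norm_cmult) auto
      also have "\<dots> \<le> ennreal a * (ennreal K * (extended_norm Y (\<lambda>x. ennreal (s powr (1 / q)) * gagliardo_function \<Omega> s0 q g x)
          + extended_norm Y (\<lambda>x. ennreal D * (ennreal \<bar>g x\<bar> + power_mean t q g x))))"
        by (intro mult_left_mono K(2)) auto
      also have "extended_norm Y (\<lambda>x. ennreal (s powr (1 / q)) * gagliardo_function \<Omega> s0 q g x) = ennreal (s powr (1 / q)) * ?N"
        using s by (intro extended_norm_cmult) auto
      also have "extended_norm Y (\<lambda>x. ennreal D * (ennreal \<bar>g x\<bar> + power_mean t q g x))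
          = ennreal D * extended_norm Y (\<lambda>x. ennreal \<bar>g x\<bar> + power_mean t q g x)"
        using D by (intro extended_norm_cmult) auto
      also have "ennreal a * (ennreal K * (ennreal (s powr (1 / q)) * ?N + \<dots>))
          \<le> ennreal a * (ennreal K * (ennreal (s powr (1 / q)) * ?N + ennreal D * (ennreal K * (Y g + ennreal A * Y g))))"
      proof (intro mult_left_mono add_left_mono)
        have "extended_norm Y (\<lambda>x. ennreal \<bar>g x\<bar> + power_mean t q g x)
            \<le> ennreal K * (extended_norm Y (\<lambda>x. ennreal \<bar>g x\<bar>) + extended_norm Y (power_mean t q g))"
          by (intro K(2)) auto
        also have "\<dots> \<le> ennreal K * (Y g + ennreal A * Y g)"
          by (intro mult_left_mono add_mono A t) (auto simp: extended_norm_real)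
        finally show "extended_norm Y (\<lambda>x. ennreal \<bar>g x\<bar> + power_mean t q g x) \<le> ennreal K * (Y g + ennreal A * Y g)" .
      qed auto
      also have "\<dots> = ennreal (a * K) * (ennreal (s powr (1 / q)) * ?N) + ennreal C * Y g"
      proof -
        have "Y g + ennreal A * Y g = ennreal (1 + A) * Y g"
          using A by (simp add: distrib_right)
        moreover have "ennreal a * (ennreal K * (u + ennreal D * (ennreal K * (ennreal P * v))))
            = ennreal (a * K) * u + ennreal (a * K * (D * (K * P))) * v" for P u v
          using a K D by (simp only: ennreal_mult' less_imp_le[OF a] less_imp_le[OF D]
              order_trans[OF zero_le_one K(1)] mult.assoc distrib_left)
        ultimately show ?thesis
          unfolding C_def by simp
      qed
      finally show ?thesis .
    qed
    obtain n0 where n0: "?N = ennreal n0" "0 \<le> n0"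
      using fin by (cases ?N) auto
    have "((\<lambda>s. a * K * (s powr (1 / q) * n0)) \<longlongrightarrow> a * K * (0 powr (1 / q) * n0)) (at_right 0)"
      using q by (intro tendsto_intros tendsto_powr') (auto intro!: tendsto_eq_intros eventually_at_rightI[of 0 1])
    then have "((\<lambda>s. ennreal (a * K * (s powr (1 / q) * n0))) \<longlongrightarrow> ennreal 0) (at_right 0)"
      by (intro tendsto_ennrealI) simp
    then have "((\<lambda>s. ennreal (a * K) * (ennreal (s powr (1 / q)) * ?N)) \<longlongrightarrow> 0) (at_right 0)"
      using a K n0 by (simp add: ennreal_mult)
    then have lim: "((\<lambda>s. ennreal (a * K) * (ennreal (s powr (1 / q)) * ?N) + ennreal C * Y g) \<longlongrightarrow> 0 + ennreal C * Y g) (at_right 0)"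
      by (intro tendsto_add tendsto_const)
    have "Limsup (at_right 0) (\<lambda>s. ennreal (s powr (1 / q)) * extended_norm Y (gagliardo_function \<Omega> s q g))
        \<le> Limsup (at_right 0) (\<lambda>s. ennreal (a * K) * (ennreal (s powr (1 / q)) * ?N) + ennreal C * Y g)"
      using s0 bound by (intro Limsup_mono eventually_at_rightI[of 0 s0]) auto
    also have "\<dots> = ennreal C * Y g"
      using lim_imp_Limsup[OF _ lim] by simp
    finally show ?thesis .
  qed
  with C show ?thesis using that by blast
qed

text \<open>
  Fix \<open>x\<close> in a ball of radius \<open>N\<close> and let \<open>y\<close> range over the part of \<open>\<Omega>\<close> at distance at least
  \<open>M > N\<close> from the centre \<open>x0\<close>. By the WMD condition this part carries kernel mass of order
  \<open>1 / s\<close>, and there \<open>\<bar>g x\<bar>\<close> is at most \<open>\<bar>g x - g y\<bar> + \<bar>g y\<bar>\<close>, where the contribution of \<open>\<bar>g y\<bar>\<close> is a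
  power mean of the tail of \<open>g\<close>. Letting first \<open>s\<close> tend to 0, then \<open>M\<close> and at last \<open>N\<close> to infinity
  removes the tail and the restriction on \<open>x\<close>.
\<close>

lemma norm_le_Liminf_gagliardo:
  fixes \<Omega> :: "'a set"
  assumes q: "0 < q" and A: "0 < A" "\<And>t F. 0 < t \<Longrightarrow> t < 1 \<Longrightarrow> F \<in> borel_measurable lebesgue \<Longrightarrow>
    extended_norm Y (power_mean t q F) \<le> ennreal A * Y F"
    and \<Omega> [measurable]: "\<Omega> \<in> sets lebesgue" and WMD: "WMD \<Omega>"
  obtains C x0 where "0 < C"
    "\<And>g. g \<in> borel_measurable lebesgue \<Longrightarrow> (\<And>x. x \<notin> \<Omega> \<Longrightarrow> g x = 0) \<Longrightarrow>
      (\<lambda>M::nat. Y (\<lambda>x. g x * indicator {x. real M \<le> dist x0 x} x)) \<longlonglongrightarrow> 0 \<Longrightarrow>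
      Y g \<le> ennreal C * Liminf (at_right 0) (\<lambda>s. ennreal (s powr (1 / q)) * extended_norm Y (gagliardo_function \<Omega> s q g))"
proof -
  let ?n = "real DIM('a)"
  obtain B where B: "0 < B" "\<And>s x (y::'a). 0 < s \<Longrightarrow> s < 1 \<Longrightarrow> 1 \<le> dist x y \<Longrightarrow>
      ennreal (s / dist x y powr (?n + s * q)) \<le> ennreal B * averaging_kernel (2 powr (- (s * q))) x y"
    using powr_kernel_le_averaging_kernel[OF q, where 'a='a] by blast
  obtain K where K: "K \<ge> 1"
    "\<And>F G. F \<in> borel_measurable lebesgue \<Longrightarrow> G \<in> borel_measurable lebesgue \<Longrightarrow>
      extended_norm Y (\<lambda>x. F x + G x) \<le> ennreal K * (extended_norm Y F + extended_norm Y G)"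
    using extended_norm_add_le by blast
  obtain x0 c R where c: "0 < c" and mass: "\<And>M. R \<le> M \<Longrightarrow> \<forall>\<^sub>F s in at_right 0.
      ennreal c \<le> (\<integral>\<^sup>+y\<in>{y \<in> \<Omega>. M \<le> dist x0 y}. ennreal (s / dist x0 y powr (?n + s * q)) \<partial>lebesgue)"
    by (rule integral_powr_kernel_ge_if_WMD[OF q \<Omega> WMD]) (rule that)
  define b where "b = 1 / 2 powr (?n + 2 * q)"
  define a where "a = 2 powr (1 / q)"
  define d where "d = (b * c) powr (1 / q)"
  define C1 where "C1 = a * K / d"
  define C2 where "C2 = C1 * (B powr (1 / q) * A)"
  have b: "0 < b" and a: "0 < a"
    by (auto simp: b_def a_def)
  with c have d: "0 < d"
    by (simp add: d_def)
  with a K have C1: "0 < C1"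
    by (simp add: C1_def)
  with A B have C2: "0 < C2"
    by (simp add: C2_def)
  have main: "Y g \<le> ennreal C1 * Liminf (at_right 0) (\<lambda>s. ennreal (s powr (1 / q)) * extended_norm Y (gagliardo_function \<Omega> s q g))"
    if [measurable]: "g \<in> borel_measurable lebesgue" and off: "\<And>x. x \<notin> \<Omega> \<Longrightarrow> g x = 0"
      and tail: "(\<lambda>M::nat. Y (\<lambda>x. g x * indicator {x. real M \<le> dist x0 x} x)) \<longlonglongrightarrow> 0" for g
  proof -
    define gM where "gM M x = g x * indicator {x. real M \<le> dist x0 x} x" for M :: nat and x
    define gN where "gN N x = \<bar>g x\<bar> * indicator {x. dist x0 x < real N} x" for N :: nat and x
    let ?X = "\<lambda>s. ennreal (s powr (1 / q)) * extended_norm Y (gagliardo_function \<Omega> s q g)"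
    let ?L = "Liminf (at_right 0) ?X"
    have gM_meas [measurable]: "gM M \<in> borel_measurable lebesgue" for M
      unfolding gM_def indicator_def by measurable
    have gN_meas [measurable]: "gN N \<in> borel_measurable lebesgue" for N
      unfolding gN_def indicator_def by measurable
    have est: "Y (gN N) \<le> ennreal C1 * ?X s + ennreal C2 * Y (gM M)"
      if NM: "N + 1 \<le> M" and s: "0 < s" "s < 1" and mass: "ennreal c \<le>
        (\<integral>\<^sup>+y\<in>{y \<in> \<Omega>. real M \<le> dist x0 y}. ennreal (s / dist x0 y powr (?n + s * q)) \<partial>lebesgue)" for N M s
    proof -
      define t where "t = (2::real) powr (- (s * q))"
      have t: "0 < t" "t < 1"
        using s q by (auto simp: t_def powr_less_one)
      let ?S = "{y \<in> \<Omega>. real M \<le> dist x0 y}"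
      have [measurable]: "?S \<in> sets lebesgue"
      proof -
        have "?S = \<Omega> \<inter> {y \<in> space lebesgue. real M \<le> dist x0 y}" by auto
        also have "\<dots> \<in> sets lebesgue" by measurable
        finally show ?thesis .
      qed
      have pointwise: "ennreal (b * \<bar>g x\<bar> powr q) * ennreal (s / dist x0 y powr (?n + s * q)) \<le>
          ennreal s * ennreal (\<bar>g x - g y\<bar> powr q / norm (x - y) powr (?n + s * q)) +
          ennreal B * (averaging_kernel t x y * ennreal (\<bar>gM M y\<bar> powr q))"
        if x: "dist x0 x < real N" and y: "y \<in> ?S" for x y
      proof -
        let ?e = "?n + s * q"
        have d1: "1 \<le> dist x y" and d2: "dist x y \<le> 2 * dist x0 y" and d3: "0 < dist x0 y"
          using x y NM dist_triangle[of x0 y x] dist_triangle[of x y x0] by (auto simp: dist_commute)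
        then have "x \<noteq> y" by auto
        have "dist x y powr ?e \<le> (2 * dist x0 y) powr ?e"
          using d2 s q by (intro powr_mono2) auto
        also have "\<dots> = 2 powr ?e * dist x0 y powr ?e"
          by (simp add: powr_mult)
        also have "\<dots> \<le> 2 powr (?n + q) * dist x0 y powr ?e"
          using s q by (intro mult_right_mono powr_mono) auto
        finally have k: "1 / dist x0 y powr ?e \<le> 2 powr (?n + q) / dist x y powr ?e"
          using d1 d3 \<open>x \<noteq> y\<close> by (simp add: divide_simps mult.commute)
        have tri: "\<bar>g x\<bar> powr q \<le> 2 powr q * (\<bar>g x - g y\<bar> powr q + \<bar>g y\<bar> powr q)"
          using abs_add_powr_le[OF q, of "g x - g y" "g y"] by simp
        have "b * \<bar>g x\<bar> powr q * (s / dist x0 y powr ?e)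
            \<le> b * (2 powr q * (\<bar>g x - g y\<bar> powr q + \<bar>g y\<bar> powr q)) * (s * (2 powr (?n + q) / dist x y powr ?e))"
          using mult_left_mono[OF k, of s] s b by (intro mult_mono tri mult_left_mono) auto
        also have "\<dots> = s * (\<bar>g x - g y\<bar> powr q / norm (x - y) powr ?e) + s / dist x y powr ?e * \<bar>g y\<bar> powr q"
        proof -
          have "b * 2 powr q * 2 powr (?n + q) = 1"
            by (simp add: b_def powr_add[symmetric] mult.assoc add.commute)
          moreover have "b * (2 powr q * (\<bar>g x - g y\<bar> powr q + \<bar>g y\<bar> powr q)) * (s * (2 powr (?n + q) / dist x y powr ?e))
             = (b * 2 powr q * 2 powr (?n + q)) * ((\<bar>g x - g y\<bar> powr q + \<bar>g y\<bar> powr q) * (s / dist x y powr ?e))"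
            by simp
          ultimately show ?thesis
            by (simp add: dist_norm add_divide_distrib distrib_left distrib_right mult_ac)
        qed
        finally have "ennreal (b * \<bar>g x\<bar> powr q * (s / dist x0 y powr ?e)) \<le>
            ennreal (s * (\<bar>g x - g y\<bar> powr q / norm (x - y) powr ?e) + s / dist x y powr ?e * \<bar>g y\<bar> powr q)"
          by (rule ennreal_leI)
        also have "\<dots> = ennreal s * ennreal (\<bar>g x - g y\<bar> powr q / norm (x - y) powr ?e)
            + ennreal (s / dist x y powr ?e) * ennreal (\<bar>g y\<bar> powr q)"
          using s by (simp only: ennreal_plus ennreal_mult mult_nonneg_nonneg divide_nonneg_nonneg powr_ge_zero less_imp_le)
        also have "\<dots> \<le> ennreal s * ennreal (\<bar>g x - g y\<bar> powr q / norm (x - y) powr ?e)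
            + (ennreal B * averaging_kernel t x y) * ennreal (\<bar>g y\<bar> powr q)"
          unfolding t_def using s d1 by (intro add_left_mono mult_right_mono B) auto
        finally show ?thesis
          using s b y by (simp only: ennreal_mult' mult_nonneg_nonneg powr_ge_zero less_imp_le mult.assoc gM_def
              indicator_simps mem_Collect_eq mult_1_right)
      qed
      have integral: "ennreal (b * c) * ennreal (\<bar>g x\<bar> powr q) \<le> ennreal s * gagliardo_integral \<Omega> s q g x +
          ennreal B * (\<integral>\<^sup>+y. averaging_kernel t x y * ennreal (\<bar>gM M y\<bar> powr q) \<partial>lebesgue)"
        if x: "dist x0 x < real N" for x
      proof -
        define I where "I y = ennreal (\<bar>g x - g y\<bar> powr q / norm (x - y) powr (?n + s * q)) * indicator \<Omega> y" for y
        have [measurable]: "I \<in> borel_measurable lebesgue"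
          unfolding I_def dist_norm[symmetric] by measurable
        have I: "gagliardo_integral \<Omega> s q g x = (\<integral>\<^sup>+y. I y \<partial>lebesgue)"
          unfolding gagliardo_integral_def I_def ..
        have "ennreal (b * c) * ennreal (\<bar>g x\<bar> powr q) = ennreal (b * \<bar>g x\<bar> powr q) * ennreal c"
          using b c by (simp add: ennreal_mult mult_ac)
        also have "\<dots> \<le> ennreal (b * \<bar>g x\<bar> powr q) *
            (\<integral>\<^sup>+y\<in>?S. ennreal (s / dist x0 y powr (?n + s * q)) \<partial>lebesgue)"
          by (intro mult_left_mono mass) auto
        also have "\<dots> = (\<integral>\<^sup>+y. ennreal (b * \<bar>g x\<bar> powr q) *
            (ennreal (s / dist x0 y powr (?n + s * q)) * indicator ?S y) \<partial>lebesgue)"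
          by (rule nn_integral_cmult[symmetric]) measurable
        also have "\<dots> \<le> (\<integral>\<^sup>+y. ennreal s * I y +
          ennreal B * (averaging_kernel t x y * ennreal (\<bar>gM M y\<bar> powr q)) \<partial>lebesgue)"
        proof (rule nn_integral_mono)
          fix y
          show "ennreal (b * \<bar>g x\<bar> powr q) * (ennreal (s / dist x0 y powr (?n + s * q)) * indicator ?S y)
             \<le> ennreal s * I y + ennreal B * (averaging_kernel t x y * ennreal (\<bar>gM M y\<bar> powr q))"
            using pointwise[OF x, of y] by (cases "y \<in> ?S") (auto simp: I_def)
        qed
        also have "\<dots> = ennreal s * gagliardo_integral \<Omega> s q g x +
          ennreal B * (\<integral>\<^sup>+y. averaging_kernel t x y * ennreal (\<bar>gM M y\<bar> powr q) \<partial>lebesgue)"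
          unfolding I by (simp add: nn_integral_add nn_integral_cmult)
        finally show ?thesis .
      qed
      have func: "ennreal d * ennreal (gN N x) \<le> ennreal a *
          (ennreal (s powr (1 / q)) * gagliardo_function \<Omega> s q g x + ennreal (B powr (1 / q)) * power_mean t q (gM M) x)" for x
      proof (cases "x \<in> \<Omega> \<and> dist x0 x < real N")
        case True
        have "ennreal d * ennreal (gN N x) = ennreal_powr (ennreal (b * c) * ennreal (\<bar>g x\<bar> powr q)) (1 / q)"
          using True b c q by (simp add: ennreal_powr_mult powr_powr d_def gN_def)
        also have "\<dots> \<le> ennreal_powr (ennreal s * gagliardo_integral \<Omega> s q g x +
          ennreal B * (\<integral>\<^sup>+y. averaging_kernel t x y * ennreal (\<bar>gM M y\<bar> powr q) \<partial>lebesgue)) (1 / q)"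
          using q True by (intro ennreal_powr_mono integral) auto
        also have "\<dots> \<le> ennreal a * (ennreal_powr (ennreal s * gagliardo_integral \<Omega> s q g x) (1 / q) +
          ennreal_powr (ennreal B * (\<integral>\<^sup>+y. averaging_kernel t x y * ennreal (\<bar>gM M y\<bar> powr q) \<partial>lebesgue)) (1 / q))"
          unfolding a_def using q by (intro ennreal_powr_add_le) auto
        also have "\<dots> = ennreal a *
          (ennreal (s powr (1 / q)) * gagliardo_function \<Omega> s q g x + ennreal (B powr (1 / q)) * power_mean t q (gM M) x)"
          using True s B by (simp add: ennreal_powr_mult gagliardo_function_def power_mean_def)
        finally show ?thesis .
      qed (auto simp: gN_def off)
      have "ennreal d * Y (gN N) = extended_norm Y (\<lambda>x. ennreal d * ennreal \<bar>gN N x\<bar>)"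
        using d by (simp add: extended_norm_cmult extended_norm_real)
      also have "\<dots> \<le> extended_norm Y (\<lambda>x. ennreal a *
          (ennreal (s powr (1 / q)) * gagliardo_function \<Omega> s q g x + ennreal (B powr (1 / q)) * power_mean t q (gM M) x))"
        using func by (intro extended_norm_mono) (auto simp: gN_def)
      also have "\<dots> = ennreal a * extended_norm Y (\<lambda>x.
          ennreal (s powr (1 / q)) * gagliardo_function \<Omega> s q g x + ennreal (B powr (1 / q)) * power_mean t q (gM M) x)"
        using a by (intro extended_norm_cmult) auto
      also have "\<dots> \<le> ennreal a * (ennreal K * (extended_norm Y (\<lambda>x. ennreal (s powr (1 / q)) * gagliardo_function \<Omega> s q g x)
           + extended_norm Y (\<lambda>x. ennreal (B powr (1 / q)) * power_mean t q (gM M) x)))"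
        by (intro mult_left_mono K(2)) auto
      also have "extended_norm Y (\<lambda>x. ennreal (s powr (1 / q)) * gagliardo_function \<Omega> s q g x) = ?X s"
        using s by (intro extended_norm_cmult) auto
      also have "extended_norm Y (\<lambda>x. ennreal (B powr (1 / q)) * power_mean t q (gM M) x)
          = ennreal (B powr (1 / q)) * extended_norm Y (power_mean t q (gM M))"
        using B by (intro extended_norm_cmult) auto
      also have "ennreal a * (ennreal K * (?X s + ennreal (B powr (1 / q)) * extended_norm Y (power_mean t q (gM M))))
          \<le> ennreal a * (ennreal K * (?X s + ennreal (B powr (1 / q)) * (ennreal A * Y (gM M))))"
        by (intro mult_left_mono add_left_mono A t) auto
      finally have "ennreal (1 / d) * (ennreal d * Y (gN N))
          \<le> ennreal (1 / d) * (ennreal a * (ennreal K * (?X s + ennreal (B powr (1 / q)) * (ennreal A * Y (gM M)))))"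
        by (rule mult_left_mono) auto
      also have "\<dots> = ennreal C1 * ?X s + ennreal C2 * Y (gM M)"
      proof -
        have C1: "C1 = 1 / d * (a * K)" by (simp add: C1_def)
        have "0 \<le> 1 / d" "0 \<le> a" "0 \<le> K" "0 \<le> B powr (1 / q)" "0 \<le> A" "0 \<le> a * K"
          using d a K A by auto
        then show ?thesis
          unfolding C2_def C1 by (simp only: ennreal_mult mult_nonneg_nonneg mult.assoc distrib_left)
      qed
      also have "ennreal (1 / d) * (ennreal d * Y (gN N)) = Y (gN N)"
        using d by (simp add: mult.assoc[symmetric] flip: ennreal_mult)
      finally show ?thesis .
    qed
    have lim_s: "Y (gN N) \<le> ennreal C1 * ?L + ennreal C2 * Y (gM M)"
      if NM: "N + 1 \<le> M" and M: "R \<le> real M" and fin: "Y (gM M) < 1" for N M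
    proof -
      have fin_C2: "ennreal C2 * Y (gM M) \<noteq> top"
        using fin by (auto simp: ennreal_mult_eq_top_iff)
      have "\<forall>\<^sub>F s in at_right 0. 0 < s \<and> s < (1::real)"
        by (rule eventually_at_rightI[of 0 1]) auto
      with mass[OF M] have "\<forall>\<^sub>F s in at_right 0. ennreal (1 / C1) * (Y (gN N) - ennreal C2 * Y (gM M)) \<le> ?X s"
      proof eventually_elim
        case (elim s)
        \<comment> \<open>The tail term is moved to the left, where it is constant in \<open>s\<close>, before the limit inferior
            is taken; this needs it to be finite.\<close>
        have "Y (gN N) - ennreal C2 * Y (gM M) \<le> ennreal C1 * ?X s"
          using est[OF NM, of s] elim fin_C2 by (subst ennreal_minus_le_iff) (auto simp: add.commute)
        then have "ennreal (1 / C1) * (Y (gN N) - ennreal C2 * Y (gM M)) \<le> ennreal (1 / C1) * (ennreal C1 * ?X s)"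
          by (rule mult_left_mono) auto
        also have "\<dots> = ?X s"
          using C1 by (simp add: mult.assoc[symmetric] flip: ennreal_mult)
        finally show ?case .
      qed
      then have "ennreal (1 / C1) * (Y (gN N) - ennreal C2 * Y (gM M)) \<le> ?L"
        by (rule Liminf_bounded)
      then have "ennreal C1 * (ennreal (1 / C1) * (Y (gN N) - ennreal C2 * Y (gM M))) \<le> ennreal C1 * ?L"
        by (rule mult_left_mono) auto
      then have "Y (gN N) - ennreal C2 * Y (gM M) \<le> ennreal C1 * ?L"
        using C1 by (simp add: mult.assoc[symmetric] flip: ennreal_mult)
      then show ?thesis
        unfolding ennreal_minus_le_iff by (simp only: add.commute)
    qed
    have "Y (gN N) \<le> ennreal C1 * ?L" for N
    proof (rule LIMSEQ_le_const)
      have "(\<lambda>M. ennreal C2 * Y (gM M)) \<longlonglongrightarrow> ennreal C2 * 0"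
        using tail unfolding gM_def by (intro ennreal_tendsto_cmult) auto
      then have "(\<lambda>M. ennreal C1 * ?L + ennreal C2 * Y (gM M)) \<longlonglongrightarrow> ennreal C1 * ?L + ennreal C2 * 0"
        by (intro tendsto_add tendsto_const)
      then show "(\<lambda>M. ennreal C1 * ?L + ennreal C2 * Y (gM M)) \<longlonglongrightarrow> ennreal C1 * ?L"
        by simp
      obtain M0 :: nat where M0: "R \<le> real M0" using real_arch_simple by blast
      have "\<forall>\<^sub>F M in sequentially. Y (gM M) < 1"
        using tail unfolding gM_def by (rule order_tendstoD(2)) simp
      then obtain M1 where M1: "\<And>M. M1 \<le> M \<Longrightarrow> Y (gM M) < 1"
        by (auto simp: eventually_sequentially)
      have "Y (gN N) \<le> ennreal C1 * ?L + ennreal C2 * Y (gM M)" if "max (max M0 (N + 1)) M1 \<le> M" for M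
        by (rule lim_s) (use that M0 M1 in auto)
      then show "\<exists>M0. \<forall>M\<ge>M0. Y (gN N) \<le> ennreal C1 * ?L + ennreal C2 * Y (gM M)"
        by blast
    qed
    then have "(SUP N. Y (gN N)) \<le> ennreal C1 * ?L"
      by (rule SUP_least)
    moreover have "Y (\<lambda>x. \<bar>g x\<bar>) = (SUP N. Y (gN N))"
    proof (rule fatou_SUP)
      show "AE x in lebesgue. (\<forall>N. 0 \<le> gN N x \<and> gN N x \<le> gN (Suc N) x) \<and> (\<lambda>N. gN N x) \<longlonglongrightarrow> \<bar>g x\<bar>"
      proof (intro AE_I2 conjI allI)
        fix x N
        show "0 \<le> gN N x" "gN N x \<le> gN (Suc N) x"
          by (auto simp: gN_def indicator_def)
      next
        fix x
        obtain N0 :: nat where "dist x0 x < real N0" using reals_Archimedean2 by blast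
        then show "(\<lambda>N. gN N x) \<longlonglongrightarrow> \<bar>g x\<bar>"
          by (intro tendsto_eventually eventually_sequentiallyI[of N0]) (auto simp: gN_def)
      qed
    qed auto
    moreover have "Y (\<lambda>x. \<bar>g x\<bar>) = Y g"
      by (rule cong_abs) auto
    ultimately show ?thesis by simp
  qed
  show ?thesis
    by (rule that[OF C1 main])
qed

end

theorem corollary1p14:
  fixes Y :: "('a::euclidean_space \<Rightarrow> real) \<Rightarrow> ennreal"
    and \<Omega> :: "'a set"
    and p q :: real
  assumes "0 < q" and "q \<le> p"
    and "ball_quasi_banach_function_space Y"
    and "\<Omega> \<in> sets lebesgue" and "WMD \<Omega>"
    and "ball_banach_function_space (power_norm Y (1 / p))"
    and "maximal_bounded (associate_norm (power_norm Y (1 / p))) \<or>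
      (\<exists>\<theta>::nat \<Rightarrow> real.
         (\<forall>m. 0 < \<theta> m \<and> \<theta> m < 1) \<and> \<theta> \<longlonglongrightarrow> 1 \<and>
         (\<forall>m. ball_banach_function_space (power_norm Y (1 / (p * \<theta> m))) \<and>
              maximal_bounded (associate_norm (power_norm Y (1 / (p * \<theta> m))))) \<and>
         (\<exists>L<\<infinity>. (\<lambda>m. maximal_operator_norm (associate_norm (power_norm Y (1 / (p * \<theta> m)))))
            \<longlonglongrightarrow> L))"
  shows "\<exists>C C'::real. C > 0 \<and> C' > 0 \<and>
    (\<forall>f \<in> C_c \<Omega> \<inter> (\<Union>s\<in>{0<..<1}. homogeneous_sobolev Y \<Omega> s q).
       ennreal C * restrict_norm Y \<Omega> (\<lambda>x. ereal (f x))
         \<le> Liminf (at_right 0) (\<lambda>s. ennreal (s powr (1 / q)) * gagliardo_norm Y \<Omega> s q f) \<and>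
       Liminf (at_right 0) (\<lambda>s. ennreal (s powr (1 / q)) * gagliardo_norm Y \<Omega> s q f)
         \<le> Limsup (at_right 0) (\<lambda>s. ennreal (s powr (1 / q)) * gagliardo_norm Y \<Omega> s q f) \<and>
       Limsup (at_right 0) (\<lambda>s. ennreal (s powr (1 / q)) * gagliardo_norm Y \<Omega> s q f)
         \<le> ennreal C' * restrict_norm Y \<Omega> (\<lambda>x. ereal (f x))) \<and>
    (absolutely_continuous_norm Y \<longrightarrow>
     (\<forall>f \<in> quotient_space Y \<Omega> \<inter> (\<Union>s\<in>{0<..<1}. homogeneous_sobolev Y \<Omega> s q).
       ennreal C * quotient_norm Y \<Omega> f
         \<le> Liminf (at_right 0) (\<lambda>s. ennreal (s powr (1 / q)) * gagliardo_norm Y \<Omega> s q f) \<and>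
       Liminf (at_right 0) (\<lambda>s. ennreal (s powr (1 / q)) * gagliardo_norm Y \<Omega> s q f)
         \<le> Limsup (at_right 0) (\<lambda>s. ennreal (s powr (1 / q)) * gagliardo_norm Y \<Omega> s q f) \<and>
       Limsup (at_right 0) (\<lambda>s. ennreal (s powr (1 / q)) * gagliardo_norm Y \<Omega> s q f)
         \<le> ennreal C' * quotient_norm Y \<Omega> f))"
proof -
  interpret Y: ball_quasi_banach_function_space Y by fact
  have [measurable]: "\<Omega> \<in> sets lebesgue" by fact
  obtain A where A: "0 < A" "\<And>t F. 0 < t \<Longrightarrow> t < 1 \<Longrightarrow> F \<in> borel_measurable lebesgue \<Longrightarrow>
      extended_norm Y (power_mean t q F) \<le> ennreal A * Y F"
    by (rule power_mean_bounded_uniformly[OF assms(1-3,6,7)]) (rule that)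
  obtain C' where C': "0 < C'"
    "\<And>\<Omega> g s0. \<Omega> \<in> sets lebesgue \<Longrightarrow> g \<in> borel_measurable lebesgue \<Longrightarrow> 0 < s0 \<Longrightarrow> s0 < 1 \<Longrightarrow>
      extended_norm Y (gagliardo_function \<Omega> s0 q g) < \<infinity> \<Longrightarrow>
      Limsup (at_right 0) (\<lambda>s. ennreal (s powr (1 / q)) * extended_norm Y (gagliardo_function \<Omega> s q g))
        \<le> ennreal C' * Y g"
    by (rule Y.Limsup_gagliardo_le[OF assms(1) A]) (assumption, assumption, assumption, rule that)
  obtain D x0 where D: "0 < D"
    "\<And>g. g \<in> borel_measurable lebesgue \<Longrightarrow> (\<And>x. x \<notin> \<Omega> \<Longrightarrow> g x = 0) \<Longrightarrow>
      (\<lambda>M::nat. Y (\<lambda>x. g x * indicator {x. real M \<le> dist x0 x} x)) \<longlonglongrightarrow> 0 \<Longrightarrow>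
      Y g \<le> ennreal D * Liminf (at_right 0) (\<lambda>s. ennreal (s powr (1 / q)) * extended_norm Y (gagliardo_function \<Omega> s q g))"
    by (rule Y.norm_le_Liminf_gagliardo[OF assms(1) A assms(4,5)]) (assumption, assumption, assumption, rule that, assumption, blast)
  let ?X = "\<lambda>f s. ennreal (s powr (1 / q)) * gagliardo_norm Y \<Omega> s q f"
  \<comment> \<open>The Gagliardo seminorm does not see additive constants, so both estimates can be applied to
      the zero extension of \<open>f + a\<close> for any \<open>a\<close>.\<close>
  define ext where "ext f a x = (if x \<in> \<Omega> then f x + a else 0)" for f :: "'a \<Rightarrow> real" and a x
  have ext_meas: "ext f a \<in> borel_measurable lebesgue" if "f \<in> borel_measurable (lebesgue_on \<Omega>)" for f a
  proof -
    have "(\<lambda>x. f x + a) \<in> borel_measurable (lebesgue_on \<Omega>)"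
      using that by measurable
    then show ?thesis
      unfolding ext_def[abs_def] by (simp only: borel_measurable_if[OF assms(4)])
  qed
  have gagliardo: "gagliardo_norm Y \<Omega> s q f = extended_norm Y (gagliardo_function \<Omega> s q (ext f a))"
    if "f \<in> borel_measurable (lebesgue_on \<Omega>)" for f a s
  proof -
    have "gagliardo_norm Y \<Omega> s q f = gagliardo_norm Y \<Omega> s q (\<lambda>x. f x + a)"
      by (simp add: gagliardo_norm_def)
    also have "\<dots> = extended_norm Y (gagliardo_function \<Omega> s q (ext f a))"
      by (intro Y.gagliardo_norm_eq_extended_norm ext_meas that) (auto simp: ext_def)
    finally show ?thesis .
  qed
  have restrict: "restrict_norm Y \<Omega> (\<lambda>x. ereal (f x + a)) = Y (ext f a)"
    if "f \<in> borel_measurable (lebesgue_on \<Omega>)" for f a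
    by (intro Y.restrict_norm_eq ext_meas that) (auto simp: ext_def)
  have middle: "Liminf (at_right 0) (?X f) \<le> Limsup (at_right 0) (?X f)" for f
    by (rule Liminf_le_Limsup) simp
  have upper: "Limsup (at_right 0) (?X f) \<le> ennreal C' * restrict_norm Y \<Omega> (\<lambda>x. ereal (f x + a))"
    if f: "f \<in> (\<Union>s\<in>{0<..<1}. homogeneous_sobolev Y \<Omega> s q)" for f a
  proof -
    from f obtain s0 where s0: "0 < s0" "s0 < 1" "gagliardo_norm Y \<Omega> s0 q f < \<infinity>"
      and meas: "f \<in> borel_measurable (lebesgue_on \<Omega>)"
      by (auto simp: homogeneous_sobolev_def)
    then show ?thesis
      unfolding gagliardo[OF meas, of _ a] restrict[OF meas] by (intro C' ext_meas) auto
  qed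
  have lower: "ennreal (1 / D) * restrict_norm Y \<Omega> (\<lambda>x. ereal (f x + a)) \<le> Liminf (at_right 0) (?X f)"
    if meas: "f \<in> borel_measurable (lebesgue_on \<Omega>)"
      and tail: "(\<lambda>M::nat. Y (\<lambda>x. ext f a x * indicator {x. real M \<le> dist x0 x} x)) \<longlonglongrightarrow> 0" for f a
  proof -
    have "Y (ext f a) \<le> ennreal D * Liminf (at_right 0) (?X f)"
      unfolding gagliardo[OF meas, of _ a] by (intro D ext_meas meas tail) (simp add: ext_def)
    then have "ennreal (1 / D) * Y (ext f a) \<le> ennreal (1 / D) * (ennreal D * Liminf (at_right 0) (?X f))"
      by (rule mult_left_mono) auto
    also have "\<dots> = Liminf (at_right 0) (?X f)"
      using D(1) by (simp add: mult.assoc[symmetric] flip: ennreal_mult)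
    finally show ?thesis
      by (simp add: restrict[OF meas])
  qed
  have sobolev_meas: "f \<in> borel_measurable (lebesgue_on \<Omega>)"
    if "f \<in> (\<Union>s\<in>{0<..<1}. homogeneous_sobolev Y \<Omega> s q)" for f
    using that by (auto simp: homogeneous_sobolev_def)
  \<comment> \<open>For a boundedly supported \<open>f\<close> and \<open>a = 0\<close> the tails vanish eventually.\<close>
  have compact_support: "ennreal (1 / D) * restrict_norm Y \<Omega> (\<lambda>x. ereal (f x)) \<le> Liminf (at_right 0) (?X f) \<and>
      Liminf (at_right 0) (?X f) \<le> Limsup (at_right 0) (?X f) \<and>
      Limsup (at_right 0) (?X f) \<le> ennreal C' * restrict_norm Y \<Omega> (\<lambda>x. ereal (f x))"
    if "f \<in> C_c \<Omega>" and f: "f \<in> (\<Union>s\<in>{0<..<1}. homogeneous_sobolev Y \<Omega> s q)" for f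
  proof -
    have "bounded {x \<in> \<Omega>. f x \<noteq> 0}"
      using that(1) unfolding C_c_def by (auto intro: bounded_subset[OF compact_imp_bounded closure_subset])
    then obtain e where e: "\<And>x. x \<in> \<Omega> \<Longrightarrow> f x \<noteq> 0 \<Longrightarrow> dist x0 x \<le> e"
      using bounded_any_center[of _ x0] by auto
    obtain M0 :: nat where M0: "e < real M0" using reals_Archimedean2 by blast
    have "(\<lambda>M::nat. Y (\<lambda>x. ext f 0 x * indicator {x. real M \<le> dist x0 x} x)) \<longlonglongrightarrow> 0"
    proof (rule tendsto_eventually, rule eventually_sequentiallyI[of M0])
      fix M assume M: "M0 \<le> M"
      have "ext f 0 x * indicator {x. real M \<le> dist x0 x} x = 0" for x
        using e[of x] M0 M by (auto simp: ext_def indicator_def)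
      then show "Y (\<lambda>x. ext f 0 x * indicator {x. real M \<le> dist x0 x} x) = 0"
        by (simp only: Y.norm_zero)
    qed
    from lower[OF sobolev_meas[OF f] this] upper[OF f, of 0] middle show ?thesis
      by simp
  qed
  \<comment> \<open>Absolute continuity makes the tails of \<open>f + a\<close> small for one \<open>a\<close> with finite norm, which suffices
      for the lower bound; the upper bound holds for all \<open>a\<close> and hence for the infimum.\<close>
  have quotient: "ennreal (1 / D) * quotient_norm Y \<Omega> f \<le> Liminf (at_right 0) (?X f) \<and>
      Liminf (at_right 0) (?X f) \<le> Limsup (at_right 0) (?X f) \<and>
      Limsup (at_right 0) (?X f) \<le> ennreal C' * quotient_norm Y \<Omega> f"
    if ac: "absolutely_continuous_norm Y" and quot: "f \<in> quotient_space Y \<Omega>"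
      and f: "f \<in> (\<Union>s\<in>{0<..<1}. homogeneous_sobolev Y \<Omega> s q)" for f
  proof (intro conjI middle)
    have meas: "f \<in> borel_measurable (lebesgue_on \<Omega>)"
      by (rule sobolev_meas[OF f])
    from quot obtain a where a: "restrict_norm Y \<Omega> (\<lambda>x. ereal (f x + a)) < \<infinity>"
      by (auto simp: quotient_space_def quotient_norm_def INF_less_iff)
    have "ext f a \<in> fspace Y"
      using a ext_meas[OF meas] by (simp add: fspace_def restrict[OF meas])
    moreover have "{x. real M \<le> dist x0 x} \<in> sets lebesgue" for M
    proof -
      have "{x \<in> space lebesgue. real M \<le> dist x0 x} \<in> sets lebesgue" by measurable
      then show ?thesis by simp
    qed
    moreover have "(\<lambda>M::nat. indicator {x. real M \<le> dist x0 x} x :: real) \<longlonglongrightarrow> 0" for x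
    proof -
      obtain M0 :: nat where "dist x0 x < real M0" using reals_Archimedean2 by blast
      then show ?thesis
        by (intro tendsto_eventually eventually_sequentiallyI[of M0]) auto
    qed
    ultimately have "(\<lambda>M::nat. Y (\<lambda>x. ext f a x * indicator {x. real M \<le> dist x0 x} x)) \<longlonglongrightarrow> 0"
      using ac unfolding absolutely_continuous_norm_def by simp
    note lower[OF meas this]
    moreover have "ennreal (1 / D) * quotient_norm Y \<Omega> f \<le> ennreal (1 / D) * restrict_norm Y \<Omega> (\<lambda>x. ereal (f x + a))"
      unfolding quotient_norm_def by (intro mult_left_mono INF_lower) auto
    ultimately show "ennreal (1 / D) * quotient_norm Y \<Omega> f \<le> Liminf (at_right 0) (?X f)"
      by (rule order_trans[rotated])
  next
    have "ennreal (1 / C') * Limsup (at_right 0) (?X f) \<le> restrict_norm Y \<Omega> (\<lambda>x. ereal (f x + a))" for a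
    proof -
      have "ennreal (1 / C') * Limsup (at_right 0) (?X f)
          \<le> ennreal (1 / C') * (ennreal C' * restrict_norm Y \<Omega> (\<lambda>x. ereal (f x + a)))"
        by (intro mult_left_mono upper f) auto
      then show ?thesis
        using C'(1) by (simp add: mult.assoc[symmetric] flip: ennreal_mult)
    qed
    then have "ennreal (1 / C') * Limsup (at_right 0) (?X f) \<le> quotient_norm Y \<Omega> f"
      unfolding quotient_norm_def by (intro INF_greatest)
    then have "ennreal C' * (ennreal (1 / C') * Limsup (at_right 0) (?X f)) \<le> ennreal C' * quotient_norm Y \<Omega> f"
      by (rule mult_left_mono) auto
    then show "Limsup (at_right 0) (?X f) \<le> ennreal C' * quotient_norm Y \<Omega> f"
      using C'(1) by (simp add: mult.assoc[symmetric] flip: ennreal_mult)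
  qed
  have "0 < 1 / D"
    using D(1) by simp
  with C'(1) compact_support quotient show ?thesis
    by (intro exI[of _ "1 / D"] exI[of _ C'] conjI ballI impI) blast+
qed

end
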